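(* Let $T>0$ and $u_0\in\mathcal{M}^+(\mathbb{R})$. Let $\varphi\in C^\infty([0,\infty))$, $\varphi(0)=0$, $\varphi'\in L^\infty(0,\infty)$, with $C_\varphi:=\lim_{u\to\infty}\varphi(u)/u$ existing in $\mathbb{R}$, and suppose there exist $H\ge-1$, $K\in\mathbb{R}$ such that $$\varphi''(u)\,\{H[\varphi(u)-C_\varphi u]+K\}\le-[\varphi'(u)-C_\varphi]^2<0\quad\text{for all }u\in[0,\infty).$$ Let $u\mapsto\varphi(u)-C_\varphi u$ be bounded in $(0,\infty)$. Then every constructed entropy solution $u$ of problem $(P)$ satisfies, for a.e. $t\in(0,T)$ and all $x_0\in\operatorname{supp}\mathcal{T}_{-C_\varphi t}(u_s(\cdot,t))$, $$\operatorname*{ess\,lim}_{x\to x_0^+}u_r(x+C_\varphi t,t)=\infty\ \text{ if }\varphi'>C_\varphi\text{ in }[0,\infty),\qquad \operatorname*{ess\,lim}_{x\to x_0^-}u_r(x+C_\varphi t,t)=\infty\ \text{ if }\varphi'<C_\varphi\text{ in }[0,\infty).$$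
   Context: Problem $(P)$ is the Cauchy problem $u_t+[\varphi(u)]_x=0$ in $S:=\mathbb{R}\times(0,T)$, $u=u_0$ in $\mathbb{R}\times\{0\}$. Measures. $\mathcal{M}(\mathbb{R})$ is the space of finite Radon measures on $\mathbb{R}$ with norm $\|\mu\|_{\mathcal{M}(\mathbb{R})}=|\mu|(\mathbb{R})$, $\mathcal{M}^+(\mathbb{R})$ the cone of nonnegative ones, and $\langle\mu,\rho\rangle_{\mathbb{R}}=\int\rho\,d\mu$. Each $\mu$ decomposes as $\mu=\mu_{ac}+\mu_s$ with respect to Lebesgue measure; $\mu_r\in L^1(\mathbb{R})$ is the density of $\mu_{ac}$. $\mu_n\stackrel{*}{\rightharpoonup}\mu$ means convergence tested against $C_c$ functions. The translate $\mathcal{T}_a(\mu)$ is defined by $\langle\mathcal{T}_a(\mu),\rho\rangle_{\mathbb{R}}=\int\rho(x+a)\,d\mu(x)$. $L^\infty(0,T;\mathcal{M}^+(\mathbb{R}))$ is the set of finite nonnegative Radon measures $u$ on $S$ such that for a.e. $t\in(0,T)$ there is $u(\cdot,t)\in\mathcal{M}^+(\mathbb{R})$ with: for $\zeta\in C([0,T];C_c(\mathbb{R}))$, $t\mapsto\langle u(\cdot,t),\zeta(\cdot,t)\rangle_{\mathbb{R}}$ is in $L^1(0,T)$ and $\int_S\zeta\,du=\int_0^T\langle u(\cdot,t),\zeta(\cdot,t)\rangle_{\mathbb{R}}dt$; and $t\mapsto\|u(\cdot,t)\|_{\mathcal{M}(\mathbb{R})}$ is in $L^\infty(0,T)$. For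 such $u$, $u_s(\cdot,t)=[u(\cdot,t)]_s$ and $u_r(\cdot,t)=[u(\cdot,t)]_r$ for a.e. $t$. $\operatorname{ess\,lim}_{x\to x_0^{\pm}}f(x)=l$ means: there is a Lebesgue-null set $E^*$ such that $f(x_n)\to l$ for every sequence $x_n\to x_0$ from the right/left, $x_n\notin E^*\cup\{x_0\}$. Solution: $u\in L^\infty(0,T;\mathcal{M}^+(\mathbb{R}))$ is a solution of $(P)$ if for all $\zeta\in C^1([0,T];C^1_c(\mathbb{R}))$ with $\zeta(\cdot,T)=0$, $$\iint_S[u_r\zeta_t+\varphi(u_r)\zeta_x]dxdt+\int_0^T\langle u_s(\cdot,t),\zeta_t(\cdot,t)+C_\varphi\zeta_x(\cdot,t)\rangle_{\mathbb{R}}dt=-\langle u_0,\zeta(\cdot,0)\rangle_{\mathbb{R}}.$$ It is an entropy solution if moreover, for all such $\zeta\ge0$ and all $E,F:[0,\infty)\to\mathbb{R}$ with $E$ convex, $E',F'\in L^\infty(0,\infty)$, $F'=E'\varphi'$ and existing limits $C_E=\lim_{u\to\infty}E(u)/u$, $C_F=\lim_{u\to\infty}F(u)/u$, $$\iint_S[E(u_r)\zeta_t+F(u_r)\zeta_x]dxdt+\int_0^T\langle u_s(\cdot,t),C_E\zeta_t(\cdot,t)+C_F\zeta_x(\cdot,t)\rangle_{\mathbb{R}}dt\ge-\int_{\mathbb{R}}E(u_{0r})\zeta(x,0)dx-C_E\langle u_{0s},\zeta(\cdot,0)\rangle_{\mathbb{R}}.$$ Constructed entropy solution: an entropy solution $u$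 for which there are $u_{0n}\in L^1(\mathbb{R})\cap L^\infty(\mathbb{R})$, $u_{0n}\ge0$, $\|u_{0n}\|_{L^1}\le\|u_0\|_{\mathcal{M}(\mathbb{R})}$, $u_{0n}\stackrel{*}{\rightharpoonup}u_0$, $u_{0n}\to u_{0r}$ a.e. in $\mathbb{R}$ and in $L^1_{loc}(\mathbb{R}\setminus\operatorname{supp}u_{0s})$, such that a subsequence of the (Kruzkov) entropy solutions $u_n\in L^\infty(0,T;L^1(\mathbb{R}))\cap L^\infty(S)$ of $u_{nt}+[\varphi(u_n)]_x=0$ in $S$, $u_n(\cdot,0)=u_{0n}$, converges weakly* to $u$ as measures on $S$. (Entropy solution of this approximating problem: $\iint_S[E(u_n)\zeta_t+F(u_n)\zeta_x]dxdt\ge-\int_{\mathbb{R}}E(u_{0n})\zeta(x,0)dx$ for all $\zeta\in C^1([0,T];C^1_c(\mathbb{R}))$ with $\zeta\ge0$ and $\zeta(\cdot,T)=0$, and all $E$ convex, $F'=E'\varphi'$.) *)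

theory Defs
  imports "HOL-Analysis.Analysis"
begin

section \<open>Function spaces\<close>

definition Linf :: "'a measure \<Rightarrow> ('a \<Rightarrow> real) set" where
  "Linf M = {f. f \<in> borel_measurable M \<and> (\<exists>C. AE x in M. \<bar>f x\<bar> \<le> C)}"

text \<open>Only the values on \<open>X\<close> matter. For \<open>X = \<real> \<times> [0,T]\<close> this is \<open>C([0,T]; C_c(\<real>))\<close>: a continuous
  map from a compact interval into the inductive limit \<open>C_c(\<real>)\<close> has supports in a common compact set.\<close>

definition Cc :: "'a::topological_space set \<Rightarrow> ('a \<Rightarrow> real) set" where
  "Cc X = {f. continuous_on X f \<and> (\<exists>K. compact K \<and> K \<subseteq> X \<and> (\<forall>x \<in> X - K. f x = 0))}"

definition strip :: "real \<Rightarrow> (real \<times> real) set" where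
  "strip T = UNIV \<times> {0<..<T}"

text \<open>\<open>\<zeta> \<in> C\<^sup>1([0,T]; C\<^sup>1_c(\<real>))\<close>, with time derivative \<open>\<zeta>t\<close> and space derivative \<open>\<zeta>x\<close>. The mixed
  derivative \<open>\<zeta>tx\<close> occurs since the time derivative is to be continuous with values in \<open>C\<^sup>1_c(\<real>)\<close>.\<close>

definition test_function ::
  "real \<Rightarrow> (real \<times> real \<Rightarrow> real) \<Rightarrow> (real \<times> real \<Rightarrow> real) \<Rightarrow> (real \<times> real \<Rightarrow> real) \<Rightarrow> bool" where
  "test_function T \<zeta> \<zeta>t \<zeta>x \<longleftrightarrow>
    (\<exists>\<zeta>tx. {\<zeta>, \<zeta>t, \<zeta>x, \<zeta>tx} \<subseteq> Cc (UNIV \<times> {0..T}) \<and>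
      (\<forall>x. \<forall>t\<in>{0..T}.
        ((\<lambda>s. \<zeta> (x, s)) has_real_derivative \<zeta>t (x, t)) (at t within {0..T}) \<and>
        ((\<lambda>y. \<zeta> (y, t)) has_real_derivative \<zeta>x (x, t)) (at x) \<and>
        ((\<lambda>y. \<zeta>t (y, t)) has_real_derivative \<zeta>tx (x, t)) (at x)))"

text \<open>Derivative of a function on \<open>[0,\<infinity>)\<close>, one-sided at \<open>0\<close>.\<close>

definition hderiv :: "(real \<Rightarrow> real) \<Rightarrow> real \<Rightarrow> real" where
  "hderiv f u = vector_derivative f (at u within {0..})"

definition smooth_halfline :: "(real \<Rightarrow> real) \<Rightarrow> bool" where
  "smooth_halfline f \<longleftrightarrow> (\<forall>k. \<forall>u\<ge>0. (hderiv ^^ k) f differentiable (at u within {0..}))"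

text \<open>\<open>f\<close> is locally absolutely continuous on \<open>[0,\<infinity>)\<close> with a.e. derivative \<open>g\<close>. Entropies such as
  \<open>\<bar>u - k\<bar>\<close> are not differentiable everywhere, so \<open>E'\<close> and \<open>F' = E' \<phi>'\<close> are read in this sense.\<close>

definition has_ae_derivative :: "(real \<Rightarrow> real) \<Rightarrow> (real \<Rightarrow> real) \<Rightarrow> bool" where
  "has_ae_derivative f g \<longleftrightarrow>
    (\<forall>b\<ge>0. integrable (lebesgue_on {0..b}) g \<and> f b - f 0 = (\<integral>u. g u \<partial>lebesgue_on {0..b}))"

definition ess_lim_right :: "(real \<Rightarrow> real) \<Rightarrow> real \<Rightarrow> ereal \<Rightarrow> bool" where
  "ess_lim_right f x\<^sub>0 l \<longleftrightarrow>
    (\<exists>N \<in> null_sets lebesgue. \<forall>X. (\<forall>n. x\<^sub>0 < X n \<and> X n \<notin> N) \<and> X \<longlonglongrightarrow> x\<^sub>0 \<longrightarrow>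
      (\<lambda>n. ereal (f (X n))) \<longlonglongrightarrow> l)"

definition ess_lim_left :: "(real \<Rightarrow> real) \<Rightarrow> real \<Rightarrow> ereal \<Rightarrow> bool" where
  "ess_lim_left f x\<^sub>0 l \<longleftrightarrow>
    (\<exists>N \<in> null_sets lebesgue. \<forall>X. (\<forall>n. X n < x\<^sub>0 \<and> X n \<notin> N) \<and> X \<longlonglongrightarrow> x\<^sub>0 \<longrightarrow>
      (\<lambda>n. ereal (f (X n))) \<longlonglongrightarrow> l)"

section \<open>Measures\<close>

text \<open>Nonnegative finite Radon measures on \<open>X\<close>; for an open subset \<open>X\<close> of a Euclidean space, these are
  all the finite Borel measures.\<close>

definition Radon_pos :: "'a::topological_space set \<Rightarrow> 'a measure set" where
  "Radon_pos X = {\<mu>. sets \<mu> = sets (restrict_space borel X) \<and> finite_measure \<mu>}"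

definition mass :: "'a measure \<Rightarrow> real" where
  "mass \<mu> = measure \<mu> (space \<mu>)"

definition msupport :: "'a::topological_space measure \<Rightarrow> 'a set" where
  "msupport \<mu> = {x. \<forall>U. open U \<longrightarrow> x \<in> U \<longrightarrow> emeasure \<mu> U > 0}"

definition translate :: "real \<Rightarrow> real measure \<Rightarrow> real measure" where
  "translate a \<mu> = distr \<mu> borel (\<lambda>x. x + a)"

definition mutually_singular :: "'a measure \<Rightarrow> 'a measure \<Rightarrow> bool" where
  "mutually_singular M N \<longleftrightarrow> (\<exists>A \<in> sets M. emeasure M A = 0 \<and> emeasure N (space M - A) = 0)"

definition lebesgue_decomposition ::
  "'a measure \<Rightarrow> 'a measure \<Rightarrow> 'a measure \<Rightarrow> 'a measure \<Rightarrow> bool" where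
  "lebesgue_decomposition M \<mu> \<alpha> \<sigma> \<longleftrightarrow>
    sets \<alpha> = sets M \<and> sets \<sigma> = sets M \<and>
    absolutely_continuous M \<alpha> \<and> mutually_singular M \<sigma> \<and>
    (\<forall>A \<in> sets M. emeasure \<mu> A = emeasure \<alpha> A + emeasure \<sigma> A)"

definition ac_part :: "'a measure \<Rightarrow> 'a measure \<Rightarrow> 'a measure" where
  "ac_part M \<mu> = (THE \<alpha>. \<exists>\<sigma>. lebesgue_decomposition M \<mu> \<alpha> \<sigma>)"

definition sing_part :: "'a measure \<Rightarrow> 'a measure \<Rightarrow> 'a measure" where
  "sing_part M \<mu> = (THE \<sigma>. \<exists>\<alpha>. lebesgue_decomposition M \<mu> \<alpha> \<sigma>)"

definition ac_density :: "'a measure \<Rightarrow> 'a measure \<Rightarrow> 'a \<Rightarrow> real" where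
  "ac_density M \<mu> x = enn2real (RN_deriv M (ac_part M \<mu>) x)"

section \<open>The space \<open>L\<^sup>\<infinity>(0,T; M\<^sup>+(\<real>))\<close>\<close>

definition time_slices :: "real \<Rightarrow> (real \<times> real) measure \<Rightarrow> (real \<Rightarrow> real measure) \<Rightarrow> bool" where
  "time_slices T u U \<longleftrightarrow>
    (AE t in lebesgue_on {0<..<T}. U t \<in> Radon_pos UNIV) \<and>
    (\<forall>\<zeta> \<in> Cc (UNIV \<times> {0..T}).
      integrable (lebesgue_on {0<..<T}) (\<lambda>t. \<integral>x. \<zeta> (x, t) \<partial>U t) \<and>
      (\<integral>p. \<zeta> p \<partial>u) = (\<integral>t. (\<integral>x. \<zeta> (x, t) \<partial>U t) \<partial>lebesgue_on {0<..<T})) \<and>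
    (\<lambda>t. mass (U t)) \<in> Linf (lebesgue_on {0<..<T})"

definition Linf_Radon_pos :: "real \<Rightarrow> (real \<times> real) measure set" where
  "Linf_Radon_pos T = {u \<in> Radon_pos (strip T). \<exists>U. time_slices T u U}"

text \<open>\<open>slice T u t\<close> is \<open>u(\<cdot>,t)\<close>; the family of slices is unique up to a null set of times \<open>t\<close>.\<close>

definition slice :: "real \<Rightarrow> (real \<times> real) measure \<Rightarrow> real \<Rightarrow> real measure" where
  "slice T u = (SOME U. time_slices T u U)"

definition slice_s :: "real \<Rightarrow> (real \<times> real) measure \<Rightarrow> real \<Rightarrow> real measure" where
  "slice_s T u t = sing_part lborel (slice T u t)"

text \<open>\<open>u_r\<close> is the density of the absolutely continuous part of \<open>u\<close> on the strip. Its section at \<open>t\<close> is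
  the density \<open>[u(\<cdot>,t)]_r\<close> for a.e. \<open>t\<close>; unlike an arbitrary choice of versions of the latter, it is
  jointly measurable.\<close>

definition reg :: "real \<Rightarrow> (real \<times> real) measure \<Rightarrow> real \<times> real \<Rightarrow> real" where
  "reg T u = ac_density (restrict_space lborel (strip T)) u"

section \<open>Solutions\<close>

text \<open>In what follows \<open>C\<close> stands for \<open>C\<^sub>\<phi>\<close>.\<close>

definition solution ::
  "real \<Rightarrow> (real \<Rightarrow> real) \<Rightarrow> real \<Rightarrow> real measure \<Rightarrow> (real \<times> real) measure \<Rightarrow> bool" where
  "solution T \<phi> C u\<^sub>0 u \<longleftrightarrow>
    u \<in> Linf_Radon_pos T \<and>
    (\<forall>\<zeta> \<zeta>t \<zeta>x. test_function T \<zeta> \<zeta>t \<zeta>x \<and> (\<forall>x. \<zeta> (x, T) = 0) \<longrightarrow>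
      (\<integral>p. reg T u p * \<zeta>t p + \<phi> (reg T u p) * \<zeta>x p \<partial>lebesgue_on (strip T))
      + (\<integral>t. (\<integral>x. \<zeta>t (x, t) + C * \<zeta>x (x, t) \<partial>slice_s T u t) \<partial>lebesgue_on {0<..<T})
      = - (\<integral>x. \<zeta> (x, 0) \<partial>u\<^sub>0))"

definition entropy_solution ::
  "real \<Rightarrow> (real \<Rightarrow> real) \<Rightarrow> real \<Rightarrow> real measure \<Rightarrow> (real \<times> real) measure \<Rightarrow> bool" where
  "entropy_solution T \<phi> C u\<^sub>0 u \<longleftrightarrow>
    solution T \<phi> C u\<^sub>0 u \<and>
    (\<forall>\<zeta> \<zeta>t \<zeta>x E E' F C\<^sub>E C\<^sub>F.
      test_function T \<zeta> \<zeta>t \<zeta>x \<and> (\<forall>x. \<zeta> (x, T) = 0) \<and> (\<forall>x. \<forall>t\<in>{0..T}. \<zeta> (x, t) \<ge> 0) \<and>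
      convex_on {0..} E \<and> has_ae_derivative E E' \<and> has_ae_derivative F (\<lambda>v. E' v * hderiv \<phi> v) \<and>
      E' \<in> Linf (lebesgue_on {0<..}) \<and> (\<lambda>v. E' v * hderiv \<phi> v) \<in> Linf (lebesgue_on {0<..}) \<and>
      ((\<lambda>v. E v / v) \<longlongrightarrow> C\<^sub>E) at_top \<and> ((\<lambda>v. F v / v) \<longlongrightarrow> C\<^sub>F) at_top \<longrightarrow>
      (\<integral>p. E (reg T u p) * \<zeta>t p + F (reg T u p) * \<zeta>x p \<partial>lebesgue_on (strip T))
      + (\<integral>t. (\<integral>x. C\<^sub>E * \<zeta>t (x, t) + C\<^sub>F * \<zeta>x (x, t) \<partial>slice_s T u t) \<partial>lebesgue_on {0<..<T})
      \<ge> - (\<integral>x. E (ac_density lborel u\<^sub>0 x) * \<zeta> (x, 0) \<partial>lebesgue)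
        - C\<^sub>E * (\<integral>x. \<zeta> (x, 0) \<partial>sing_part lborel u\<^sub>0))"

text \<open>Entropy solutions of the problem with initial datum in \<open>L\<^sup>1 \<inter> L\<^sup>\<infinity>\<close>. As \<open>\<phi>\<close>, \<open>E\<close> and \<open>F\<close> are
  defined on \<open>[0,\<infinity>)\<close> only, \<open>v\<close> has to be nonnegative.\<close>

definition kruzkov_solution ::
  "real \<Rightarrow> (real \<Rightarrow> real) \<Rightarrow> (real \<Rightarrow> real) \<Rightarrow> (real \<times> real \<Rightarrow> real) \<Rightarrow> bool" where
  "kruzkov_solution T \<phi> v\<^sub>0 v \<longleftrightarrow>
    v \<in> Linf (lebesgue_on (strip T)) \<and>
    (AE t in lebesgue_on {0<..<T}. integrable lebesgue (\<lambda>x. v (x, t))) \<and>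
    (\<lambda>t. \<integral>x. \<bar>v (x, t)\<bar> \<partial>lebesgue) \<in> Linf (lebesgue_on {0<..<T}) \<and>
    (AE p in lebesgue_on (strip T). v p \<ge> 0) \<and>
    (\<forall>\<zeta> \<zeta>t \<zeta>x E E' F.
      test_function T \<zeta> \<zeta>t \<zeta>x \<and> (\<forall>x. \<zeta> (x, T) = 0) \<and> (\<forall>x. \<forall>t\<in>{0..T}. \<zeta> (x, t) \<ge> 0) \<and>
      convex_on {0..} E \<and> has_ae_derivative E E' \<and>
      has_ae_derivative F (\<lambda>w. E' w * hderiv \<phi> w) \<longrightarrow>
      (\<integral>p. E (v p) * \<zeta>t p + F (v p) * \<zeta>x p \<partial>lebesgue_on (strip T))
      \<ge> - (\<integral>x. E (v\<^sub>0 x) * \<zeta> (x, 0) \<partial>lebesgue))"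

definition constructed_entropy_solution ::
  "real \<Rightarrow> (real \<Rightarrow> real) \<Rightarrow> real \<Rightarrow> real measure \<Rightarrow> (real \<times> real) measure \<Rightarrow> bool" where
  "constructed_entropy_solution T \<phi> C u\<^sub>0 u \<longleftrightarrow>
    entropy_solution T \<phi> C u\<^sub>0 u \<and>
    (\<exists>(v\<^sub>0 :: nat \<Rightarrow> real \<Rightarrow> real) (v :: nat \<Rightarrow> real \<times> real \<Rightarrow> real) r.
      (\<forall>n. integrable lebesgue (v\<^sub>0 n) \<and> v\<^sub>0 n \<in> Linf lebesgue \<and> (AE x in lebesgue. v\<^sub>0 n x \<ge> 0) \<and>
        (\<integral>x. \<bar>v\<^sub>0 n x\<bar> \<partial>lebesgue) \<le> mass u\<^sub>0) \<and>
      (\<forall>\<rho> \<in> Cc UNIV. (\<lambda>n. \<integral>x. \<rho> x * v\<^sub>0 n x \<partial>lebesgue) \<longlonglongrightarrow> (\<integral>x. \<rho> x \<partial>u\<^sub>0)) \<and>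
      (AE x in lebesgue. (\<lambda>n. v\<^sub>0 n x) \<longlonglongrightarrow> ac_density lborel u\<^sub>0 x) \<and>
      (\<forall>K. compact K \<and> K \<subseteq> - msupport (sing_part lborel u\<^sub>0) \<longrightarrow>
        (\<lambda>n. \<integral>x. \<bar>v\<^sub>0 n x - ac_density lborel u\<^sub>0 x\<bar> \<partial>lebesgue_on K) \<longlonglongrightarrow> 0) \<and>
      (\<forall>n. kruzkov_solution T \<phi> (v\<^sub>0 n) (v n)) \<and>
      strict_mono r \<and>
      (\<forall>\<zeta> \<in> Cc (strip T).
        (\<lambda>n. \<integral>p. \<zeta> p * v (r n) p \<partial>lebesgue_on (strip T)) \<longlonglongrightarrow> (\<integral>p. \<zeta> p \<partial>u)))"

end

theory Submission
  imports Defs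
begin

text \<open>Along the characteristic lines \<open>x = y + \<phi>'(k) t\<close> the quantities \<open>(k - u)\<^sup>+\<close> to the left of the line and \<open>(u - j)\<^sup>+\<close> to
  the right of it only decay, by the concavity of \<open>\<phi>\<close>. For \<open>k < j\<close>, the amount of pairs \<open>x\<^sub>1 < x\<^sub>2\<close> in the cone between the lines for
  \<open>j\<close> and \<open>k\<close> with \<open>u(x\<^sub>1,t) > j\<close> and \<open>u(x\<^sub>2,t) < k\<close> therefore does not increase in time; as the cone closes up at \<open>t = 0\<close>, there are
  none. This is Oleinik's inequality: wherever an approximating solution exceeds \<open>j\<close>, it is at least \<open>k\<close> on an interval of length
  \<open>(\<phi>'(k) - \<phi>'(j)) t\<close> to the right.

  In the moving frame \<open>x - C t\<close> the approximating solutions are Lipschitz in time, uniformly and in the weak sense, because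
  \<open>\<phi>(u) - C u\<close> is bounded. Near a point of the support of \<open>u\<^sub>s(\<cdot>,t)\<close> they therefore exceed every \<open>j\<close> at all nearby times, so that
  they are at least \<open>k\<close> on an open set next to the point. This bound passes to the weak limit \<open>u\<close> and to its density \<open>u\<^sub>r\<close>. The case
  \<open>\<phi>' < C\<close> is reduced to this one by the reflection \<open>x \<mapsto> -x\<close>.\<close>

section \<open>Truncated powers and test functions\<close>

text \<open>The approximating solutions are known only almost everywhere and through integral
  inequalities: there are no traces at t = 0 and no values on single lines. Hence the tests used
  here have compact support in the open strip, and pairs of points at equal times are reached by
  doubling the variables with a kernel in \<open>t2 - t1\<close> of vanishing width. Weak
  convergence does not commute with the nonlinear quantities (u - j)^+ and (k - u)^+. Oleinik's
  inequality is therefore used only to get u_n \<ge> k, a linear statement, on one open set for all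
  large n. For this some value above j must occur at almost every time of a common window. In the
  frame moving with speed C the equation has the flux \<phi>(u) - C u, so the smoothed mass of a
  fixed interval changes at a rate independent of n, and mass concentrated at one time persists for
  a while. Finally, the exceptional null set of times must not depend on x_0, which may range over
  an uncountable set; this is why intervals, windows and centres have rational parameters
  throughout.\<close>

definition trunc_pow :: "nat \<Rightarrow> real \<Rightarrow> real" where
  "trunc_pow n s = max 0 s ^ n"

lemma trunc_pow_nonneg [simp]: "0 \<le> trunc_pow n s"
  by (simp add: trunc_pow_def)

lemma trunc_pow_eq_0: "n > 0 \<Longrightarrow> s \<le> 0 \<Longrightarrow> trunc_pow n s = 0"
  by (simp add: trunc_pow_def)

lemma continuous_on_trunc_pow [continuous_intros]:
  "continuous_on S f \<Longrightarrow> continuous_on S (\<lambda>x. trunc_pow n (f x))"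
  unfolding trunc_pow_def by (intro continuous_intros)

text \<open>At 0 the difference quotient of the power n + 2 is the power n + 1 itself, which tends
  to 0; elsewhere the function is locally a polynomial or zero.\<close>

lemma DERIV_trunc_pow: "((\<lambda>x. trunc_pow (Suc (Suc n)) x) has_real_derivative (real n + 2) * trunc_pow (Suc n) x) (at x)"
proof -
  consider "x < 0" | "x = 0" | "x > 0" by linarith
  then show ?thesis
  proof cases
    case 1
    have "((\<lambda>x. 0) has_real_derivative (real n + 2) * trunc_pow (Suc n) x) (at x)"
      using 1 by (simp add: trunc_pow_def)
    then show ?thesis
      by (rule has_field_derivative_transform_within_open[where S = "{..<0}"]) (use 1 in \<open>auto simp: trunc_pow_def\<close>)
  next
    case 3
    have "((\<lambda>x. x ^ (Suc (Suc n))) has_real_derivative (real n + 2) * trunc_pow (Suc n) x) (at x)"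
      by (rule derivative_eq_intros refl | use 3 in \<open>simp add: trunc_pow_def\<close>)+
    then show ?thesis
      by (rule has_field_derivative_transform_within_open[where S = "{0<..}"]) (use 3 in \<open>auto simp: trunc_pow_def\<close>)
  next
    case 2
    have "((\<lambda>h. trunc_pow (Suc n) h) \<longlongrightarrow> trunc_pow (Suc n) 0) (at 0)"
    proof -
      have "continuous_on UNIV (trunc_pow (Suc n))"
        using continuous_on_trunc_pow[OF continuous_on_id, of UNIV "Suc n"] by (simp add: id_def)
      then show ?thesis by (metis UNIV_I continuous_on_def)
    qed
    moreover have "\<forall>\<^sub>F h in at 0. trunc_pow (Suc n) h = (trunc_pow (Suc (Suc n)) (0 + h) - trunc_pow (Suc (Suc n)) 0) / h"
      by (rule eventually_at_filter[THEN iffD2]) (auto simp: trunc_pow_def max_def intro!: always_eventually)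
    ultimately have "((\<lambda>h. (trunc_pow (Suc (Suc n)) (0 + h) - trunc_pow (Suc (Suc n)) 0) / h) \<longlongrightarrow> trunc_pow (Suc n) 0) (at 0)"
      by (rule Lim_transform_eventually)
    then show ?thesis
      using 2 by (simp add: DERIV_def trunc_pow_def)
  qed
qed

lemma DERIV_trunc_pow2 [derivative_intros]:
  "(f has_real_derivative f') (at x) \<Longrightarrow> ((\<lambda>x. trunc_pow 2 (f x)) has_real_derivative (2 * trunc_pow 1 (f x)) * f') (at x)"
  using DERIV_chain2[OF DERIV_trunc_pow[of 0]] by (simp add: numeral_2_eq_2)

lemma DERIV_trunc_pow3 [derivative_intros]:
  "(f has_real_derivative f') (at x) \<Longrightarrow> ((\<lambda>x. trunc_pow 3 (f x)) has_real_derivative (3 * trunc_pow 2 (f x)) * f') (at x)"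
  using DERIV_chain2[OF DERIV_trunc_pow[of 1]] by (simp add: numeral_2_eq_2 numeral_3_eq_3)

text \<open>The antiderivative of the quadratic B-spline with knots 0, 1, 2, 3, a piecewise cubic
  step of class C^2. Two continuous derivatives are needed because the mixed derivative of a test
  function reaches \<open>smooth_step''\<close>.\<close>

definition smooth_step :: "real \<Rightarrow> real" where
  "smooth_step s = 1/6 * trunc_pow 3 s - 1/2 * trunc_pow 3 (s - 1) + 1/2 * trunc_pow 3 (s - 2) - 1/6 * trunc_pow 3 (s - 3)"

definition smooth_step' :: "real \<Rightarrow> real" where
  "smooth_step' s = 1/2 * trunc_pow 2 s - 3/2 * trunc_pow 2 (s - 1) + 3/2 * trunc_pow 2 (s - 2) - 1/2 * trunc_pow 2 (s - 3)"

definition smooth_step'' :: "real \<Rightarrow> real" where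
  "smooth_step'' s = trunc_pow 1 s - 3 * trunc_pow 1 (s - 1) + 3 * trunc_pow 1 (s - 2) - trunc_pow 1 (s - 3)"

lemma DERIV_smooth_step [derivative_intros]:
  "(f has_real_derivative f') (at x) \<Longrightarrow> ((\<lambda>x. smooth_step (f x)) has_real_derivative smooth_step' (f x) * f') (at x)"
  unfolding smooth_step_def smooth_step'_def
  by (rule derivative_eq_intros refl | assumption)+ (simp add: algebra_simps)

lemma DERIV_smooth_step' [derivative_intros]:
  "(f has_real_derivative f') (at x) \<Longrightarrow> ((\<lambda>x. smooth_step' (f x)) has_real_derivative smooth_step'' (f x) * f') (at x)"
  unfolding smooth_step''_def smooth_step'_def
  by (rule derivative_eq_intros refl | assumption)+ (simp add: algebra_simps)

lemma continuous_on_smooth_step [continuous_intros]: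
  "continuous_on S f \<Longrightarrow> continuous_on S (\<lambda>x. smooth_step (f x))"
  unfolding smooth_step_def by (intro continuous_intros) auto

lemma continuous_on_smooth_step' [continuous_intros]:
  "continuous_on S f \<Longrightarrow> continuous_on S (\<lambda>x. smooth_step' (f x))"
  unfolding smooth_step'_def by (intro continuous_intros) auto

lemma continuous_on_smooth_step'' [continuous_intros]:
  "continuous_on S f \<Longrightarrow> continuous_on S (\<lambda>x. smooth_step'' (f x))"
  unfolding smooth_step''_def by (intro continuous_intros) auto

lemma smooth_step_eq_0: "s \<le> 0 \<Longrightarrow> smooth_step s = 0" "s \<le> 0 \<Longrightarrow> smooth_step' s = 0"
  by (simp_all add: smooth_step_def smooth_step'_def trunc_pow_eq_0)

lemma smooth_step_eq_1: "s \<ge> 3 \<Longrightarrow> smooth_step s = 1" "s \<ge> 3 \<Longrightarrow> smooth_step' s = 0"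
  by (simp_all add: smooth_step_def smooth_step'_def trunc_pow_def max_def power3_eq_cube power2_eq_square algebra_simps)

text \<open>The spline equals s^2 / 2 and (3 - s)^2 / 2 on the outer pieces and, after completing
  the square, 3/4 - (s - 3/2)^2 on the middle one.\<close>

lemma smooth_step'_bounds: "0 \<le> smooth_step' s" "smooth_step' s \<le> 1"
proof -
  consider "s \<le> 0" | "0 \<le> s" "s \<le> 1" | "1 \<le> s" "s \<le> 2" | "2 \<le> s" "s \<le> 3" | "3 \<le> s" by linarith
  then have "0 \<le> smooth_step' s \<and> smooth_step' s \<le> 1"
  proof cases
    case 1 then show ?thesis by (simp add: smooth_step_eq_0)
  next
    case 2
    then have "smooth_step' s = s\<^sup>2 / 2" by (simp add: smooth_step'_def trunc_pow_def max_def)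
    moreover have "s\<^sup>2 \<le> 1" using 2 by (simp add: power_le_one)
    ultimately show ?thesis using zero_le_power2[of s] by linarith
  next
    case 3
    then have "smooth_step' s = 1/2 * s\<^sup>2 - 3/2 * (s - 1)\<^sup>2" by (simp add: smooth_step'_def trunc_pow_def max_def)
    also have "\<dots> = 3/4 - (s - 3/2)\<^sup>2" by (simp add: power2_eq_square algebra_simps)
    finally have eq: "smooth_step' s = 3/4 - (s - 3/2)\<^sup>2" .
    have "\<bar>s - 3/2\<bar> \<le> \<bar>1/2\<bar>" using 3 unfolding abs_le_iff by auto
    then have "(s - 3/2)\<^sup>2 \<le> (1/2)\<^sup>2" by (simp only: abs_le_square_iff)
    moreover have "(\<bar>1/2\<bar>::real)\<^sup>2 = 1/4" by (simp add: power2_eq_square)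
    moreover have "(1/2::real)\<^sup>2 = 1/4" by (simp add: power2_eq_square)
    ultimately show ?thesis using eq zero_le_power2[of "s - 3/2"] by linarith
  next
    case 4
    then have "smooth_step' s = 1/2 * s\<^sup>2 - 3/2 * (s - 1)\<^sup>2 + 3/2 * (s - 2)\<^sup>2" by (simp add: smooth_step'_def trunc_pow_def max_def)
    also have "\<dots> = (3 - s)\<^sup>2 / 2" by (simp add: power2_eq_square algebra_simps)
    finally have eq: "smooth_step' s = (3 - s)\<^sup>2 / 2" .
    have "(3 - s)\<^sup>2 \<le> 1" using 4 by (simp add: power_le_one)
    then show ?thesis using eq zero_le_power2[of "3 - s"] by linarith
  next
    case 5 then show ?thesis by (simp add: smooth_step_eq_1)
  qed
  then show "0 \<le> smooth_step' s" "smooth_step' s \<le> 1" by auto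
qed

lemma smooth_step_mono: "s \<le> t \<Longrightarrow> smooth_step s \<le> smooth_step t"
  by (rule DERIV_nonneg_imp_nondecreasing[where f = smooth_step])
     (auto intro!: exI smooth_step'_bounds derivative_eq_intros)

lemma smooth_step_bounds: "0 \<le> smooth_step s" "smooth_step s \<le> 1"
  using smooth_step_mono[of "min 0 s" s] smooth_step_mono[of s "max 3 s"] smooth_step_eq_0(1)[of "min 0 s"] smooth_step_eq_1(1)[of "max 3 s"]
  by auto

text \<open>More restrictive than \<open>test_function\<close>: derivatives are two-sided on the
  whole plane and the support is compact in the open strip. The terms at t = 0 then vanish, and
  integrals over the strip become integrals over the plane.\<close>

definition test_fn ::
  "real \<Rightarrow> (real \<times> real \<Rightarrow> real) \<Rightarrow> (real \<times> real \<Rightarrow> real) \<Rightarrow> (real \<times> real \<Rightarrow> real) \<Rightarrow> bool" where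
  "test_fn T g gt gx \<longleftrightarrow> (\<exists>gtx K.
     continuous_on UNIV g \<and> continuous_on UNIV gt \<and> continuous_on UNIV gx \<and> continuous_on UNIV gtx \<and>
     (\<forall>x t. ((\<lambda>s. g (x, s)) has_real_derivative gt (x, t)) (at t) \<and>
            ((\<lambda>y. g (y, t)) has_real_derivative gx (x, t)) (at x) \<and>
            ((\<lambda>y. gt (y, t)) has_real_derivative gtx (x, t)) (at x)) \<and>
     compact K \<and> K \<subseteq> strip T \<and> (\<forall>p. p \<notin> K \<longrightarrow> g p = 0))"

lemma deriv_zero_outside_1:
  fixes g :: "real \<times> real \<Rightarrow> real"
  assumes "\<And>x t. ((\<lambda>y. g (y, t)) has_real_derivative gx (x, t)) (at x)"
    and "closed K" "\<And>p. p \<notin> K \<Longrightarrow> g p = 0" "p \<notin> K"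
  shows "gx p = 0"
proof -
  obtain x t where p: "p = (x, t)" by (cases p)
  have o: "open {y. (y, t) \<notin> K}"
    using open_vimage[of "- K" "\<lambda>y. (y, t)"] assms(2)
    by (simp add: vimage_def open_Compl continuous_on_Pair continuous_on_id continuous_on_const)
  have "((\<lambda>y. 0) has_real_derivative gx (x, t)) (at x)"
    by (rule has_field_derivative_transform_within_open[OF assms(1) o]) (use assms p in auto)
  then show ?thesis using p DERIV_unique[OF _ DERIV_const] by blast
qed

lemma deriv_zero_outside_2:
  fixes g :: "real \<times> real \<Rightarrow> real"
  assumes "\<And>x t. ((\<lambda>s. g (x, s)) has_real_derivative gt (x, t)) (at t)"
    and "closed K" "\<And>p. p \<notin> K \<Longrightarrow> g p = 0" "p \<notin> K"
  shows "gt p = 0"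
proof -
  obtain x t where p: "p = (x, t)" by (cases p)
  have o: "open {s. (x, s) \<notin> K}"
    using open_vimage[of "- K" "\<lambda>s. (x, s)"] assms(2)
    by (simp add: vimage_def open_Compl continuous_on_Pair continuous_on_id continuous_on_const)
  have "((\<lambda>y. 0) has_real_derivative gt (x, t)) (at t)"
    by (rule has_field_derivative_transform_within_open[OF assms(1) o]) (use assms p in auto)
  then show ?thesis using p DERIV_unique[OF _ DERIV_const] by blast
qed

lemma test_fn_test_function:
  assumes "test_fn T g gt gx"
  shows "test_function T g gt gx" "g (x, 0) = 0" "g (x, T) = 0"
    "\<exists>K. compact K \<and> K \<subseteq> strip T \<and> (\<forall>p. p \<notin> K \<longrightarrow> g p = 0 \<and> gt p = 0 \<and> gx p = 0)"
    "continuous_on UNIV gt" "continuous_on UNIV gx"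
proof -
  obtain gtx K where c: "continuous_on UNIV g" "continuous_on UNIV gt" "continuous_on UNIV gx" "continuous_on UNIV gtx"
    and d: "\<And>x t. ((\<lambda>s. g (x, s)) has_real_derivative gt (x, t)) (at t)"
            "\<And>x t. ((\<lambda>y. g (y, t)) has_real_derivative gx (x, t)) (at x)"
            "\<And>x t. ((\<lambda>y. gt (y, t)) has_real_derivative gtx (x, t)) (at x)"
    and K: "compact K" "K \<subseteq> strip T" "\<And>p. p \<notin> K \<Longrightarrow> g p = 0"
    using assms unfolding test_fn_def by metis
  have cl: "closed K" using K(1) by (rule compact_imp_closed)
  have zt: "gt p = 0" if "p \<notin> K" for p by (rule deriv_zero_outside_2[OF d(1) cl K(3) that])
  have zx: "gx p = 0" if "p \<notin> K" for p by (rule deriv_zero_outside_1[OF d(2) cl K(3) that])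
  have ztx: "gtx p = 0" if "p \<notin> K" for p by (rule deriv_zero_outside_1[OF d(3) cl zt that])
  have KS: "K \<subseteq> UNIV \<times> {0..T}" using K(2) by (auto simp: strip_def)
  have "f \<in> Cc (UNIV \<times> {0..T})" if "continuous_on UNIV f" "\<And>p. p \<notin> K \<Longrightarrow> f p = 0" for f :: "real \<times> real \<Rightarrow> real"
    unfolding Cc_def using that K(1) KS continuous_on_subset[OF that(1)] by blast
  then show "test_function T g gt gx"
    unfolding test_function_def
    by (intro exI[of _ gtx] conjI insert_subsetI empty_subsetI allI ballI)
       (use c K(3) zt zx ztx d has_field_derivative_at_within[OF d(1)] in blast)+
  show "g (x, 0) = 0" "g (x, T) = 0" by (rule K(3), use K(2) in \<open>auto simp: strip_def\<close>)+
  show "\<exists>K. compact K \<and> K \<subseteq> strip T \<and> (\<forall>p. p \<notin> K \<longrightarrow> g p = 0 \<and> gt p = 0 \<and> gx p = 0)"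
    using K zt zx by blast
qed (use assms test_fn_def in auto)

text \<open>The shape of every test function built below: a factor in time, a factor in space and a
  factor constant along lines of speed \<open>v\<close>. The last one needs two derivatives, since
  in the mixed derivative both differentiations may fall on it.\<close>

lemma test_fn_product:
  fixes a a' b b' c c' c'' :: "real \<Rightarrow> real"
  assumes "\<And>s. (a has_real_derivative a' s) (at s)" "\<And>s. (b has_real_derivative b' s) (at s)"
    "\<And>s. (c has_real_derivative c' s) (at s)" "\<And>s. (c' has_real_derivative c'' s) (at s)"
    and cont: "continuous_on UNIV a'" "continuous_on UNIV b'" "continuous_on UNIV c''"
    and K: "compact K" "K \<subseteq> strip T" "\<And>x t. (x, t) \<notin> K \<Longrightarrow> a t * b x * c (x - v * t) = 0"
  shows "test_fn T (\<lambda>(x, t). a t * b x * c (x - v * t))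
    (\<lambda>(x, t). a' t * b x * c (x - v * t) - v * a t * b x * c' (x - v * t))
    (\<lambda>(x, t). a t * b' x * c (x - v * t) + a t * b x * c' (x - v * t))"
proof -
  have ca: "continuous_on UNIV a" "continuous_on UNIV b" "continuous_on UNIV c" "continuous_on UNIV c'"
    using assms(1-4) by (meson DERIV_isCont continuous_at_imp_continuous_on)+
  note d = assms(1-4)[THEN DERIV_chain2]
  have cc: "continuous_on S (\<lambda>p. f (k p))" if "continuous_on UNIV f" "continuous_on S k" for f :: "real \<Rightarrow> real" and k and S :: "(real\<times>real) set"
    using continuous_on_compose2[OF that(1) that(2)] by simp
  show ?thesis
    unfolding test_fn_def case_prod_beta
    apply (rule exI[of _ "\<lambda>p. a' (snd p) * b' (fst p) * c (fst p - v * snd p) + a' (snd p) * b (fst p) * c' (fst p - v * snd p)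
       - v * a (snd p) * b' (fst p) * c' (fst p - v * snd p) - v * a (snd p) * b (fst p) * c'' (fst p - v * snd p)"])
    apply (rule exI[of _ K])
    apply (intro conjI allI impI K(1,2))
    subgoal by (intro continuous_intros cc[OF ca(1)] cc[OF ca(2)] cc[OF ca(3)])
    subgoal by (intro continuous_intros cc[OF ca(1)] cc[OF ca(2)] cc[OF ca(3)] cc[OF ca(4)] cc[OF cont(1)])
    subgoal by (intro continuous_intros cc[OF ca(1)] cc[OF ca(2)] cc[OF ca(3)] cc[OF ca(4)] cc[OF cont(2)])
    subgoal by (intro continuous_intros cc[OF ca(1)] cc[OF ca(2)] cc[OF ca(3)] cc[OF ca(4)] cc[OF cont(1)] cc[OF cont(2)] cc[OF cont(3)])
    subgoal for x t
      by (rule derivative_eq_intros d refl | simp add: algebra_simps)+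
    subgoal for x t
      by (rule derivative_eq_intros d refl | simp add: algebra_simps)+
    subgoal for x t
      by (rule derivative_eq_intros d refl | simp add: algebra_simps)+
    subgoal for p using K(3)[of "fst p" "snd p"] by simp
    done
qed

section \<open>Continuity of translations in the mean\<close>

lemma integrable_bounded_times_compact:
  fixes b k :: "'a::euclidean_space \<Rightarrow> real"
  assumes [measurable]: "b \<in> borel_measurable borel" and b: "\<And>p. \<bar>b p\<bar> \<le> M"
    and k: "continuous_on UNIV k" and K: "compact K" and z: "\<And>p. p \<notin> K \<Longrightarrow> k p = 0"
  shows "integrable lborel (\<lambda>p. b p * k p)"
proof -
  have [measurable]: "k \<in> borel_measurable borel" using k by (rule borel_measurable_continuous_onI)
  have "compact (k ` K)" using K k by (intro compact_continuous_image continuous_on_subset[OF k]) auto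
  then obtain C where C: "\<And>p. p \<in> K \<Longrightarrow> \<bar>k p\<bar> \<le> C"
    by (metis (no_types) bounded_real compact_imp_bounded imageI)
  have [measurable]: "K \<in> sets borel" using K by (simp add: compact_imp_closed)
  show ?thesis
  proof (rule Bochner_Integration.integrable_bound)
    show "integrable lborel (\<lambda>p. \<bar>M\<bar> * \<bar>C\<bar> * indicator K p :: real)"
      using emeasure_lborel_cbox_finite emeasure_bounded_finite[OF compact_imp_bounded[OF K]]
      by (intro integrable_mult_right integrable_real_indicator) auto
    show "AE p in lborel. norm (b p * k p) \<le> norm (\<bar>M\<bar> * \<bar>C\<bar> * indicator K p)"
    proof (rule AE_I2)
      fix p
      show "norm (b p * k p) \<le> norm (\<bar>M\<bar> * \<bar>C\<bar> * indicator K p)"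
      proof (cases "p \<in> K")
        case True
        have "\<bar>b p\<bar> \<le> \<bar>M\<bar>" "\<bar>k p\<bar> \<le> \<bar>C\<bar>" using b[of p] C[OF True] by auto
        then show ?thesis using True by (simp add: abs_mult mult_mono)
      qed (simp add: z)
    qed
  qed simp
qed

lemma translation_lborel:
  fixes f :: "'a::euclidean_space \<Rightarrow> real"
  shows "(\<integral>z. f (z + h) \<partial>lborel) = (\<integral>z. f z \<partial>lborel)" (is ?A)
    and "integrable lborel f \<Longrightarrow> integrable lborel (\<lambda>z. f (z + h))"
proof -
  have d: "distr lborel borel (\<lambda>z. z + h) = lborel"
    using lborel_distr_plus[of h] by (simp add: add.commute[of _ h])
  show I: "integrable lborel (\<lambda>z. f (z + h))" if "integrable lborel f"
  proof -
    have "integrable (distr lborel borel (\<lambda>z. z + h)) f" using that by (simp add: d)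
    then show ?thesis by (rule integrable_distr[rotated]) simp
  qed
  show ?A
  proof (cases "f \<in> borel_measurable borel")
    case True
    have "(\<integral>z. f z \<partial>distr lborel borel (\<lambda>z. z + h)) = (\<integral>z. f (z + h) \<partial>lborel)"
      by (rule integral_distr) (use True in simp_all)
    then show ?thesis by (simp add: d)
  next
    \<comment> \<open>Functions that are not integrable have Bochner integral 0, and the inverse
      translation shows that neither function is measurable.\<close>
    case False
    have "\<not> integrable lborel f" using False by (auto dest: borel_measurable_integrable)
    moreover have "\<not> integrable lborel (\<lambda>z. f (z + h))"
    proof
      assume "integrable lborel (\<lambda>z. f (z + h))"
      then have "(\<lambda>z. f (z + h)) \<in> borel_measurable borel" by (auto dest: borel_measurable_integrable)
      from measurable_compose[OF _ this, of "\<lambda>z. z - h" borel] have "f \<in> borel_measurable borel" by simp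
      with False show False by simp
    qed
    ultimately show ?thesis by (simp add: not_integrable_integral_eq)
  qed
qed

text \<open>Density argument. The indicator of a set is handled by enclosing the set between a
  compact and an open set of nearly equal measure: short translations of the compact set stay in the
  open one. Sums and dominated limits follow by the triangle inequality. This is the only source of
  smallness in the doubling argument, where nothing is known about the regularity of the
  solution.\<close>

lemma L1_translation:
  fixes f :: "'a::euclidean_space \<Rightarrow> real"
  assumes "integrable lborel f" "e > 0"
  shows "\<exists>d>0. \<forall>h. norm h < d \<longrightarrow> (\<integral>z. \<bar>f (z + h) - f z\<bar> \<partial>lborel) < e"
  using assms
proof (induction arbitrary: e rule: integrable_induct)
  case (base A c)
  have fin: "emeasure lborel A < \<infinity>" and A[measurable]: "A \<in> sets borel" using base by auto
  \<comment> \<open>The exceptional set has measure below \<open>2 * e'\<close> and occurs twice,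
    once translated, whence the 4; \<open>+ 1\<close> covers \<open>c = 0\<close> and makes the last
    inequality strict.\<close>
  define e' where "e' = e / (\<bar>c\<bar> + 1) / 4"
  have e': "e' > 0" using base by (simp add: e'_def)
  obtain U where U: "open U" "A \<subseteq> U" "emeasure lborel (U - A) < e'"
    using outer_regular_lborel[OF A e'] by metis
  \<comment> \<open>Inner regularity is applied to a finite measure, so Lebesgue measure is
    restricted to \<open>A\<close> first.\<close>
  define M where "M = density lborel (indicator A :: 'a \<Rightarrow> ennreal)"
  have M: "emeasure M B = emeasure lborel (A \<inter> B)" if "B \<in> sets borel" for B
    using that by (simp add: M_def emeasure_restricted)
  have MA: "emeasure M A = (SUP K \<in> {K. K \<subseteq> A \<and> compact K}. emeasure M K)"
    by (rule inner_regular) (use M[of UNIV] fin in \<open>auto simp: M_def\<close>)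
  obtain K where K: "compact K" "K \<subseteq> A" "emeasure lborel (A - K) < e'"
  proof (cases "emeasure lborel A = 0")
    case True
    then show ?thesis using that[of "{}"] e' by simp
  next
    case False
    have "emeasure lborel A - e' < emeasure lborel A"
      using False fin e' by (intro ennreal_between) (auto simp: zero_less_iff_neq_zero)
    then have "emeasure lborel A - e' < (SUP K \<in> {K. K \<subseteq> A \<and> compact K}. emeasure M K)"
      using MA M[OF A] by simp
    then obtain K where K: "K \<subseteq> A" "compact K" "emeasure lborel A - e' < emeasure M K"
      by (auto simp: less_SUP_iff)
    have Kb: "K \<in> sets borel" using K by (simp add: compact_imp_closed)
    have MK: "emeasure M K = emeasure lborel K" using M[OF Kb] K(1) by (simp add: Int_absorb1)
    have fK: "emeasure lborel K < \<infinity>" using emeasure_mono[of K A lborel] K(1) A fin by (simp add: le_less_trans)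
    have "emeasure lborel (A - K) = emeasure lborel A - emeasure lborel K"
      using K(1) Kb A fK by (intro emeasure_Diff) auto
    moreover obtain a where a: "emeasure lborel A = ennreal a" "0 \<le> a" using fin by (cases "emeasure lborel A") auto
    moreover obtain k where k: "emeasure lborel K = ennreal k" "0 \<le> k" using fK by (cases "emeasure lborel K") auto
    moreover have "a - e' < k"
    proof (rule ccontr)
      assume "\<not> a - e' < k"
      then have "ennreal k \<le> ennreal (a - e')" by (intro ennreal_leI) simp
      then show False using K(3) MK a k e' by (simp add: ennreal_minus)
    qed
    ultimately have "emeasure lborel (A - K) < e'"
      using e' by (simp add: ennreal_minus ennreal_lessI)
    then show ?thesis using that K by blast
  qed
  have Kb[measurable]: "K \<in> sets borel" using K by (simp add: compact_imp_closed)
  have Ub[measurable]: "U \<in> sets borel" using U by simp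
  have "emeasure lborel (U - K) \<le> emeasure lborel ((U - A) \<union> (A - K))"
    by (intro emeasure_mono) auto
  also have "\<dots> \<le> emeasure lborel (U - A) + emeasure lborel (A - K)"
    by (rule emeasure_subadditive) auto
  also have "\<dots> < ennreal e' + ennreal e'" using U(3) K(3) by (rule add_strict_mono)
  also have "\<dots> = ennreal (2 * e')" using e' by (simp flip: ennreal_plus)
  finally have UK: "emeasure lborel (U - K) < ennreal (2 * e')" .
  then have mUK: "measure lborel (U - K) < 2 * e'"
    using e' by (cases "emeasure lborel (U - K)") (auto simp: measure_def ennreal_less_iff)
  have iUK: "integrable lborel (indicat_real (U - K))"
    using UK by (intro integrable_real_indicator) (auto simp: less_top intro: less_trans)
  have "K \<inter> - U = {}" using K(2) U(2) by auto
  then obtain d where d: "d > 0" "\<And>x y. x \<in> K \<Longrightarrow> y \<in> - U \<Longrightarrow> d \<le> dist x y"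
    using separate_compact_closed[OF K(1), of "- U"] U(1) by (auto simp: closed_Compl)
  have "(\<integral>z. \<bar>indicat_real A (z + h) *\<^sub>R c - indicat_real A z *\<^sub>R c\<bar> \<partial>lborel) < e" if h: "norm h < d" for h
  proof -
    have pt: "\<bar>indicat_real A (z + h) *\<^sub>R c - indicat_real A z *\<^sub>R c\<bar>
        \<le> \<bar>c\<bar> * (indicat_real (U - K) z + indicat_real (U - K) (z + h))" for z
    proof -
      have "z \<in> K \<Longrightarrow> z + h \<in> U" "z + h \<in> K \<Longrightarrow> z \<in> U"
        using d(2)[of z "z + h"] d(2)[of "z + h" z] h by (auto simp: dist_norm)
      then show ?thesis using K(2) U(2) by (auto simp: indicator_def)
    qed
    have ih: "integrable lborel (\<lambda>z. indicat_real (U - K) (z + h))" using translation_lborel(2)[OF iUK] .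
    have "integrable lborel (\<lambda>z. indicat_real A z *\<^sub>R c)" using fin by (auto intro: integrable_real_indicator)
    note iA = this translation_lborel(2)[OF this, of h]
    have "(\<integral>z. \<bar>indicat_real A (z + h) *\<^sub>R c - indicat_real A z *\<^sub>R c\<bar> \<partial>lborel)
       \<le> (\<integral>z. \<bar>c\<bar> * (indicat_real (U - K) z + indicat_real (U - K) (z + h)) \<partial>lborel)"
      using iA iUK ih pt by (intro integral_mono integrable_abs Bochner_Integration.integrable_diff
          Bochner_Integration.integrable_add integrable_mult_right) auto
    also have "\<dots> = \<bar>c\<bar> * (2 * measure lborel (U - K))"
      using iUK ih translation_lborel(1)[of "indicat_real (U - K)" h] by simp
    also have "\<dots> \<le> \<bar>c\<bar> * (4 * e')" using mUK by (intro mult_left_mono) auto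
    also have "\<dots> = e * (\<bar>c\<bar> / (\<bar>c\<bar> + 1))"
    proof -
      have "\<bar>c\<bar> + 1 > 0" "\<bar>c\<bar> * 4 + 4 > 0" by auto
      then show ?thesis by (simp add: e'_def divide_simps)
    qed
    also have "\<dots> < e * 1" using base.prems by (intro mult_strict_left_mono) (simp_all add: divide_less_eq)
    finally show ?thesis by simp
  qed
  then show ?case using d(1) by blast
next
  case (add f g)
  obtain d1 where d1: "d1 > 0" "\<And>h. norm h < d1 \<Longrightarrow> (\<integral>z. \<bar>f (z + h) - f z\<bar> \<partial>lborel) < e / 2"
    using add.IH(1)[of "e/2"] add.prems by auto
  obtain d2 where d2: "d2 > 0" "\<And>h. norm h < d2 \<Longrightarrow> (\<integral>z. \<bar>g (z + h) - g z\<bar> \<partial>lborel) < e / 2"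
    using add.IH(2)[of "e/2"] add.prems by auto
  have "(\<integral>z. \<bar>(f (z + h) + g (z + h)) - (f z + g z)\<bar> \<partial>lborel) < e" if "norm h < min d1 d2" for h
  proof -
    have i: "integrable lborel (\<lambda>z. \<bar>f (z + h) - f z\<bar>)" "integrable lborel (\<lambda>z. \<bar>g (z + h) - g z\<bar>)"
      using translation_lborel(2)[OF add.hyps(1)] translation_lborel(2)[OF add.hyps(2)] add.hyps by auto
    have "(\<integral>z. \<bar>(f (z + h) + g (z + h)) - (f z + g z)\<bar> \<partial>lborel)
        \<le> (\<integral>z. \<bar>f (z + h) - f z\<bar> + \<bar>g (z + h) - g z\<bar> \<partial>lborel)"
      using translation_lborel(2)[OF add.hyps(1)] translation_lborel(2)[OF add.hyps(2)] add.hyps i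
      by (intro integral_mono) auto
    also have "\<dots> < e" using d1(2)[of h] d2(2)[of h] that i by simp
    finally show ?thesis .
  qed
  then show ?case using d1(1) d2(1) by (intro exI[of _ "min d1 d2"]) auto
next
  case (lim f s)
  have tr: "integrable lborel (\<lambda>z. f (z + h))" "integrable lborel (\<lambda>z. s i (z + h))" for h i
    using translation_lborel(2)[OF lim.hyps(4)] translation_lborel(2)[OF lim.hyps(1)] by auto
  have "(\<lambda>i. \<integral>z. \<bar>s i z - f z\<bar> \<partial>lborel) \<longlonglongrightarrow> (\<integral>z. 0 \<partial>(lborel::'a measure))"
  proof (rule integral_dominated_convergence)
    \<comment> \<open>The approximants provided by the induction rule are bounded by twice
      \<open>f\<close> in absolute value, so their distance from \<open>f\<close> is at most three
      times it.\<close>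
    show "integrable lborel (\<lambda>z. 3 * \<bar>f z\<bar>)" using lim by auto
    show "AE z in lborel. (\<lambda>i. \<bar>s i z - f z\<bar>) \<longlonglongrightarrow> 0"
      using lim.hyps(2) by (auto intro!: AE_I2 tendsto_eq_intros)
    show "AE z in lborel. norm \<bar>s i z - f z\<bar> \<le> 3 * \<bar>f z\<bar>" for i
      using lim.hyps(3)[of _ i] by (intro AE_I2) (fastforce simp: abs_if split: if_splits)
  qed (use lim in auto)
  then have "(\<lambda>i. \<integral>z. \<bar>s i z - f z\<bar> \<partial>lborel) \<longlonglongrightarrow> 0" by simp
  then have "\<forall>\<^sub>F i in sequentially. (\<integral>z. \<bar>s i z - f z\<bar> \<partial>lborel) < e / 3"
    by (rule order_tendstoD) (use lim.prems in simp)
  then obtain i where i: "(\<integral>z. \<bar>s i z - f z\<bar> \<partial>lborel) < e / 3" by (auto simp: eventually_sequentially)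
  obtain d where d: "d > 0" "\<And>h. norm h < d \<Longrightarrow> (\<integral>z. \<bar>s i (z + h) - s i z\<bar> \<partial>lborel) < e / 3"
    using lim.IH[of "e/3" i] lim.prems by auto
  have "(\<integral>z. \<bar>f (z + h) - f z\<bar> \<partial>lborel) < e" if "norm h < d" for h
  proof -
    have j: "integrable lborel (\<lambda>z. \<bar>s i z - f z\<bar>)" "integrable lborel (\<lambda>z. \<bar>s i (z + h) - f (z + h)\<bar>)"
       "integrable lborel (\<lambda>z. \<bar>s i (z + h) - s i z\<bar>)"
      using tr lim.hyps by auto
    have "(\<integral>z. \<bar>f (z + h) - f z\<bar> \<partial>lborel)
        \<le> (\<integral>z. \<bar>s i z - f z\<bar> + \<bar>s i (z + h) - f (z + h)\<bar> + \<bar>s i (z + h) - s i z\<bar> \<partial>lborel)"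
      using tr lim.hyps j by (intro integral_mono) auto
    also have "\<dots> = 2 * (\<integral>z. \<bar>s i z - f z\<bar> \<partial>lborel) + (\<integral>z. \<bar>s i (z + h) - s i z\<bar> \<partial>lborel)"
      using j translation_lborel(1)[of "\<lambda>z. \<bar>s i z - f z\<bar>" h] by simp
    also have "\<dots> < e" using d(2)[OF that] i by simp
    finally show ?thesis .
  qed
  then show ?case using d(1) by blast
qed

section \<open>Doubling of variables\<close>

text \<open>The inequality A_t + F_x \<le> 0 in the sense of distributions on the open
  strip.\<close>

definition subconserved :: "real \<Rightarrow> (real \<times> real \<Rightarrow> real) \<Rightarrow> (real \<times> real \<Rightarrow> real) \<Rightarrow> bool" where
  "subconserved T A F \<longleftrightarrow>
    (\<forall>g gt gx. test_fn T g gt gx \<and> (\<forall>p. 0 \<le> g p) \<longrightarrow> 0 \<le> (\<integral>p. A p * gt p + F p * gx p \<partial>lborel))"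

text \<open>A C^1 kernel supported in [0, e]. It is left unnormalised, since its mass either cancels
  or is divided out where it matters.\<close>

definition pulse :: "real \<Rightarrow> real \<Rightarrow> real" where
  "pulse e s = trunc_pow 2 s * trunc_pow 2 (e - s)"

definition pulse' :: "real \<Rightarrow> real \<Rightarrow> real" where
  "pulse' e s = 2 * trunc_pow 1 s * trunc_pow 2 (e - s) - 2 * trunc_pow 2 s * trunc_pow 1 (e - s)"

lemma DERIV_pulse [derivative_intros]:
  "(f has_real_derivative f') (at x) \<Longrightarrow> ((\<lambda>x. pulse e (f x)) has_real_derivative pulse' e (f x) * f') (at x)"
  unfolding pulse_def pulse'_def
  by (rule derivative_eq_intros refl | assumption)+ (simp add: algebra_simps)

lemma continuous_on_pulse [continuous_intros]:
  "continuous_on S f \<Longrightarrow> continuous_on S (\<lambda>x. pulse e (f x))"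
  "continuous_on S f \<Longrightarrow> continuous_on S (\<lambda>x. pulse' e (f x))"
  unfolding pulse_def pulse'_def by (intro continuous_intros; simp)+

lemma pulse_eq_0: "s \<le> 0 \<or> e \<le> s \<Longrightarrow> pulse e s = 0" "s \<le> 0 \<or> e \<le> s \<Longrightarrow> pulse' e s = 0"
  by (auto simp: pulse_def pulse'_def trunc_pow_eq_0)

lemma pulse_nonneg: "0 \<le> pulse e s"
  by (simp add: pulse_def)

lemma borel_measurable_fst_snd [measurable]:
  "fst \<in> (borel :: ('a::topological_space \<times> 'b::topological_space) measure) \<rightarrow>\<^sub>M borel"
  "snd \<in> (borel :: ('a::topological_space \<times> 'b::topological_space) measure) \<rightarrow>\<^sub>M borel"
  by (intro borel_measurable_continuous_onI continuous_intros)+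

text \<open>From y1 + lam t1 \<le> x1 \<le> x2 \<le> y2 + mu t2 the gap y1 - y2 is at most mu t2 -
  lam t1. The smallness of \<open>e0\<close> lets the difference t2 - t1 account for at most half of
  the gap; the other half is bridged by (mu - lam) t1, so both times stay away from 0. One box thus
  contains the supports for all kernels of width at most \<open>e0\<close>.\<close>

lemma region_bounds:
  fixes lam mu y1 y2 T' T e0 t1 t2 x1 x2 :: real
  assumes y: "y2 < y1" and lm: "lam < mu" and e0: "0 < e0" "\<bar>mu\<bar> * e0 \<le> (y1 - y2) / 2" "T' + e0 < T"
    and t: "t1 \<le> T'" "0 \<le> t2 - t1" "t2 - t1 \<le> e0" and x: "x1 \<le> x2" "y1 \<le> x1 - lam * t1" "x2 - mu * t2 \<le> y2"
  shows "(x1, t1) \<in> cbox (- (\<bar>y1\<bar> + \<bar>y2\<bar> + (\<bar>lam\<bar> + \<bar>mu\<bar>) * T), (y1 - y2) / (2 * (mu - lam))) (\<bar>y1\<bar> + \<bar>y2\<bar> + (\<bar>lam\<bar> + \<bar>mu\<bar>) * T, T' + e0)"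
    and "(x2, t2) \<in> cbox (- (\<bar>y1\<bar> + \<bar>y2\<bar> + (\<bar>lam\<bar> + \<bar>mu\<bar>) * T), (y1 - y2) / (2 * (mu - lam))) (\<bar>y1\<bar> + \<bar>y2\<bar> + (\<bar>lam\<bar> + \<bar>mu\<bar>) * T, T' + e0)"
proof -
  define X where "X = \<bar>y1\<bar> + \<bar>y2\<bar> + (\<bar>lam\<bar> + \<bar>mu\<bar>) * T"
  define d where "d = (y1 - y2) / (2 * (mu - lam))"
  have "mu * (t2 - t1) \<le> \<bar>mu\<bar> * (t2 - t1)" using t by (intro mult_right_mono) auto
  also have "\<dots> \<le> \<bar>mu\<bar> * e0" using t by (intro mult_left_mono) auto
  also have "\<dots> \<le> (y1 - y2) / 2" by (rule e0)
  finally have mt: "mu * t2 - mu * t1 \<le> (y1 - y2) / 2" by (simp only: right_diff_distrib)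
  have "(y1 - y2) / 2 \<le> mu * t1 - lam * t1" using mt x by argo
  also have "\<dots> = (mu - lam) * t1" by (simp only: left_diff_distrib)
  finally have "(y1 - y2) / 2 \<le> (mu - lam) * t1" .
  then have t1: "d \<le> t1" using lm by (simp add: d_def field_simps)
  have d: "0 < d" using y lm by (simp add: d_def)
  have t0: "0 \<le> t1" "t1 \<le> T" "0 \<le> t2" "t2 \<le> T" "t1 \<le> T' + e0" "t2 \<le> T' + e0" "d \<le> t2" using t1 d t e0 by auto
  have "\<bar>lam * t1\<bar> \<le> \<bar>lam\<bar> * T" "\<bar>mu * t2\<bar> \<le> \<bar>mu\<bar> * T"
    using t0 by (auto simp: abs_mult intro!: mult_left_mono)
  moreover have X: "X = \<bar>y1\<bar> + \<bar>y2\<bar> + \<bar>lam\<bar> * T + \<bar>mu\<bar> * T" by (simp add: X_def algebra_simps)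
  moreover have "\<bar>p\<bar> \<le> a \<Longrightarrow> - a \<le> p \<and> p \<le> a" for p a :: real by (auto simp: abs_le_iff)
  ultimately have b: "- (\<bar>lam\<bar> * T) \<le> lam * t1" "mu * t2 \<le> \<bar>mu\<bar> * T" "0 \<le> \<bar>lam\<bar> * T" "0 \<le> \<bar>mu\<bar> * T" 
    by (metis abs_ge_zero order_trans)+
  have "- X \<le> x1" "x2 \<le> X" unfolding X using b x abs_ge_self[of y2] abs_ge_minus_self[of y1] abs_ge_zero[of y1] abs_ge_zero[of y2] by argo+
  then have "- X \<le> x1" "x1 \<le> X" "- X \<le> x2" "x2 \<le> X" using x by auto
  then show "(x1, t1) \<in> cbox (- (\<bar>y1\<bar> + \<bar>y2\<bar> + (\<bar>lam\<bar> + \<bar>mu\<bar>) * T), (y1 - y2) / (2 * (mu - lam))) (\<bar>y1\<bar> + \<bar>y2\<bar> + (\<bar>lam\<bar> + \<bar>mu\<bar>) * T, T' + e0)"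
    "(x2, t2) \<in> cbox (- (\<bar>y1\<bar> + \<bar>y2\<bar> + (\<bar>lam\<bar> + \<bar>mu\<bar>) * T), (y1 - y2) / (2 * (mu - lam))) (\<bar>y1\<bar> + \<bar>y2\<bar> + (\<bar>lam\<bar> + \<bar>mu\<bar>) * T, T' + e0)"
    unfolding X_def[symmetric] d_def[symmetric] using t0 t1 by (auto simp: cbox_Pair_eq)
qed

text \<open>The abstract cone argument. It is applied to A = (k - u)^+ and B = (u - j)^+ with k < j
  and their entropy fluxes, where \<open>mu\<close> and \<open>lam\<close> are the characteristic
  speeds of the levels k and j. The products vanish because the two quantities live on disjoint
  sets, and the two speed bounds express concavity of the flux.\<close>

locale two_fluxes =
  fixes T :: real and lam mu M :: real and A B FA FB :: "real \<times> real \<Rightarrow> real"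
  assumes A_meas [measurable]: "A \<in> borel_measurable borel" and B_meas [measurable]: "B \<in> borel_measurable borel"
    and FA_meas [measurable]: "FA \<in> borel_measurable borel" and FB_meas [measurable]: "FB \<in> borel_measurable borel"
    and A_nonneg: "\<And>p. 0 \<le> A p" and B_nonneg: "\<And>p. 0 \<le> B p"
    and A_le: "\<And>p. A p \<le> M" and B_le: "\<And>p. B p \<le> M" and FA_le: "\<And>p. \<bar>FA p\<bar> \<le> M" and FB_le: "\<And>p. \<bar>FB p\<bar> \<le> M"
    and disj: "\<And>p. A p * B p = 0" "\<And>p. FA p * B p = 0" "\<And>p. A p * FB p = 0"
    and FB_speed: "\<And>p. FB p \<le> lam * B p" and FA_speed: "\<And>p. mu * A p \<le> FA p"
    and sub_A: "subconserved T A FA" and sub_B: "subconserved T B FB"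
    and T: "0 < T" and lam_mu: "lam < mu"
begin

text \<open>The cut-offs follow the characteristic lines, and \<open>y2 < y1\<close> keeps the support away from \<open>t = 0\<close>. With a one-sided kernel
  in \<open>t2 - t1\<close> and an increasing step in \<open>x2 - x1\<close>, all terms but the last have a sign; it vanishes in the limit since \<open>A B = FA B = A FB = 0\<close>.\<close>

lemma doubling:
  assumes y: "y2 < y1" and T': "0 < T'" "T' < T" and e0: "0 < e0" "\<bar>mu\<bar> * e0 \<le> (y1 - y2) / 2" "T' + e0 < T"
    and e: "0 < e" "e \<le> e0"
  defines "P \<equiv> \<lambda>(x1, t1) (x2, t2). 2 * trunc_pow 1 (T' - t1) * pulse e (t2 - t1) * smooth_step ((x2 - x1) / e)
                  * trunc_pow 3 (x1 - lam * t1 - y1) * trunc_pow 3 (y2 - (x2 - mu * t2))"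
    and "Q \<equiv> \<lambda>(x1, t1) (x2, t2). trunc_pow 2 (T' - t1) * pulse e (t2 - t1) * (smooth_step' ((x2 - x1) / e) / e)
                  * trunc_pow 3 (x1 - lam * t1 - y1) * trunc_pow 3 (y2 - (x2 - mu * t2))"
  shows "(\<integral>\<^sup>+z1. \<integral>\<^sup>+z2. ennreal (P z1 z2 * (A z2 * B z1)) \<partial>lborel \<partial>lborel)
       \<le> (\<integral>\<^sup>+z1. \<integral>\<^sup>+z2. ennreal (Q z1 z2 * \<bar>FA z2 * B z1 - FB z1 * A z2\<bar>) \<partial>lborel \<partial>lborel)"
proof -
  define X where "X \<equiv> \<bar>y1\<bar> + \<bar>y2\<bar> + (\<bar>lam\<bar> + \<bar>mu\<bar>) * T"
  define d where "d \<equiv> (y1 - y2) / (2 * (mu - lam))"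
  define K where "K = cbox (-X, d) (X, T' + e0)"
  have cK: "compact K" by (simp add: K_def compact_cbox)
  have d: "0 < d" using y lam_mu by (simp add: d_def)
  have KT: "K \<subseteq> strip T" using d e0 by (auto simp: K_def strip_def cbox_Pair_eq)
  have reg: "(x1, t1) \<in> K \<and> (x2, t2) \<in> K"
    if "t1 < T'" "0 < t2 - t1" "t2 - t1 < e" "x1 < x2" "y1 < x1 - lam * t1" "x2 - mu * t2 < y2" for x1 t1 x2 t2
    unfolding K_def X_def d_def using region_bounds[OF y lam_mu e0, of t1 t2 x1 x2] that e by auto
  note zero_simps = trunc_pow_eq_0 pulse_eq_0 smooth_step_eq_0 divide_le_0_iff
  have reg': "t1 \<ge> T' \<or> t2 - t1 \<le> 0 \<or> e \<le> t2 - t1 \<or> x2 - x1 \<le> 0 \<or> x1 - lam * t1 - y1 \<le> 0 \<or> y2 - (x2 - mu * t2) \<le> 0"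
    if "(x1, t1) \<notin> K \<or> (x2, t2) \<notin> K" for x1 t1 x2 t2
    using reg[of t1 t2 x1 x2] that by linarith
  \<comment> \<open>One function of four variables is differentiated in \<open>(x1, t1)\<close>, to
    be tested against \<open>B\<close>, and in \<open>(x2, t2)\<close>, to be tested against
    \<open>A\<close>. The factors are grouped as \<open>test_fn_product\<close> delivers
    them.\<close>
  define g1t where "g1t = (\<lambda>((x1, t1), (x2, t2)).
     (- (2 * trunc_pow 1 (T' - t1)) * pulse e (t2 - t1) - trunc_pow 2 (T' - t1) * pulse' e (t2 - t1)) * (smooth_step ((x2 - x1) / e) * trunc_pow 3 (y2 - (x2 - mu * t2)))
        * trunc_pow 3 (x1 - lam * t1 - y1)
     - lam * (trunc_pow 2 (T' - t1) * pulse e (t2 - t1)) * (smooth_step ((x2 - x1) / e) * trunc_pow 3 (y2 - (x2 - mu * t2))) * (3 * trunc_pow 2 (x1 - lam * t1 - y1)))"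
  define g1x where "g1x = (\<lambda>((x1, t1), (x2, t2)).
     (trunc_pow 2 (T' - t1) * pulse e (t2 - t1)) * (- (smooth_step' ((x2 - x1) / e) / e) * trunc_pow 3 (y2 - (x2 - mu * t2))) * trunc_pow 3 (x1 - lam * t1 - y1)
     + (trunc_pow 2 (T' - t1) * pulse e (t2 - t1)) * (smooth_step ((x2 - x1) / e) * trunc_pow 3 (y2 - (x2 - mu * t2))) * (3 * trunc_pow 2 (x1 - lam * t1 - y1)))"
  define g2t where "g2t = (\<lambda>((x1, t1), (x2, t2)).
     (trunc_pow 2 (T' - t1) * pulse' e (t2 - t1)) * (smooth_step ((x2 - x1) / e) * trunc_pow 3 (x1 - lam * t1 - y1)) * trunc_pow 3 (y2 - (x2 - mu * t2))
     - mu * (trunc_pow 2 (T' - t1) * pulse e (t2 - t1)) * (smooth_step ((x2 - x1) / e) * trunc_pow 3 (x1 - lam * t1 - y1)) * (- (3 * trunc_pow 2 (y2 - (x2 - mu * t2)))))"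
  define g2x where "g2x = (\<lambda>((x1, t1), (x2, t2)).
     (trunc_pow 2 (T' - t1) * pulse e (t2 - t1)) * (smooth_step' ((x2 - x1) / e) / e * trunc_pow 3 (x1 - lam * t1 - y1)) * trunc_pow 3 (y2 - (x2 - mu * t2))
     + (trunc_pow 2 (T' - t1) * pulse e (t2 - t1)) * (smooth_step ((x2 - x1) / e) * trunc_pow 3 (x1 - lam * t1 - y1)) * (- (3 * trunc_pow 2 (y2 - (x2 - mu * t2)))))"
  have t1: "test_fn T (\<lambda>(x1, t1). (trunc_pow 2 (T' - t1) * pulse e (t2 - t1)) * (smooth_step ((x2 - x1) / e) * trunc_pow 3 (y2 - (x2 - mu * t2))) * trunc_pow 3 (x1 - lam * t1 - y1))
      (\<lambda>p. g1t (p, (x2, t2))) (\<lambda>p. g1x (p, (x2, t2)))" for x2 t2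
  proof -
    have "test_fn T (\<lambda>(x1, t1). (trunc_pow 2 (T' - t1) * pulse e (t2 - t1)) * (smooth_step ((x2 - x1) / e) * trunc_pow 3 (y2 - (x2 - mu * t2))) * trunc_pow 3 (x1 - lam * t1 - y1))
      (\<lambda>(x, t). g1t ((x, t), (x2, t2))) (\<lambda>(x, t). g1x ((x, t), (x2, t2)))"
      unfolding g1t_def g1x_def prod.case
      apply (rule test_fn_product[where K = K and c' = "\<lambda>s. 3 * trunc_pow 2 (s - y1)" and c = "\<lambda>s. trunc_pow 3 (s - y1)" and c'' = "\<lambda>s. 6 * trunc_pow 1 (s - y1)"])
      subgoal by (rule derivative_eq_intros refl | simp add: algebra_simps)+
      subgoal by (rule derivative_eq_intros refl | use e in \<open>simp add: field_simps\<close>)+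
      subgoal by (rule derivative_eq_intros refl | simp)+
      subgoal by (rule derivative_eq_intros refl | simp)+
      subgoal by (intro continuous_intros)
      subgoal by (intro continuous_intros) (use e in auto)
      subgoal by (intro continuous_intros)
      subgoal by (rule cK)
      subgoal by (rule KT)
      subgoal for x t by (drule reg'[where ?x2.0 = x2 and ?t2.0 = t2, OF disjI1], elim disjE) (use e in \<open>simp_all add: zero_simps\<close>)
      done
    then show ?thesis unfolding case_prod_unfold prod.collapse .
  qed
  have t2: "test_fn T (\<lambda>(x2, t2). (trunc_pow 2 (T' - t1) * pulse e (t2 - t1)) * (smooth_step ((x2 - x1) / e) * trunc_pow 3 (x1 - lam * t1 - y1)) * trunc_pow 3 (y2 - (x2 - mu * t2)))
      (\<lambda>p. g2t ((x1, t1), p)) (\<lambda>p. g2x ((x1, t1), p))" for x1 t1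
  proof -
    have "test_fn T (\<lambda>(x2, t2). (trunc_pow 2 (T' - t1) * pulse e (t2 - t1)) * (smooth_step ((x2 - x1) / e) * trunc_pow 3 (x1 - lam * t1 - y1)) * trunc_pow 3 (y2 - (x2 - mu * t2)))
      (\<lambda>(x, t). g2t ((x1, t1), (x, t))) (\<lambda>(x, t). g2x ((x1, t1), (x, t)))"
      unfolding g2t_def g2x_def prod.case
      apply (rule test_fn_product[where K = K and c' = "\<lambda>s. - (3 * trunc_pow 2 (y2 - s))" and c = "\<lambda>s. trunc_pow 3 (y2 - s)" and c'' = "\<lambda>s. 6 * trunc_pow 1 (y2 - s)"])
      subgoal by (rule derivative_eq_intros refl | simp add: algebra_simps)+
      subgoal by (rule derivative_eq_intros refl | use e in \<open>simp add: field_simps\<close>)+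
      subgoal by (rule derivative_eq_intros refl | simp)+
      subgoal by (rule derivative_eq_intros refl | simp)+
      subgoal by (intro continuous_intros)
      subgoal by (intro continuous_intros) (use e in auto)
      subgoal by (intro continuous_intros)
      subgoal by (rule cK)
      subgoal by (rule KT)
      subgoal for x t by (drule reg'[where ?x1.0 = x1 and ?t1.0 = t1, OF disjI2], elim disjE) (use e in \<open>simp_all add: zero_simps\<close>)
      done
    then show ?thesis unfolding case_prod_unfold prod.collapse .
  qed
  have nn: "0 \<le> smooth_step s" "0 \<le> pulse e s" "0 \<le> smooth_step' s / e" for s using smooth_step_bounds pulse_nonneg smooth_step'_bounds e by auto
  have PQ0: "0 \<le> case_prod P p" "0 \<le> case_prod Q p" for p
    unfolding P_def Q_def case_prod_unfold by (intro mult_nonneg_nonneg trunc_pow_nonneg nn zero_le_numeral)+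
  have i1: "0 \<le> (\<integral>z1. B z1 * g1t (z1, z2) + FB z1 * g1x (z1, z2) \<partial>lborel)" for z2
    using sub_B t1[of "snd z2" "fst z2"] unfolding subconserved_def by (fastforce simp: nn)
  have i2: "0 \<le> (\<integral>z2. A z2 * g2t (z1, z2) + FA z2 * g2x (z1, z2) \<partial>lborel)" for z1
    using sub_A t2[of "snd z1" "fst z1"] unfolding subconserved_def by (fastforce simp: nn)
  have cKK: "compact (K \<times> K)" by (intro compact_Times cK)
  have z: "g1t p = 0" "g1x p = 0" "g2t p = 0" "g2x p = 0" "case_prod P p = 0" "case_prod Q p = 0" if "p \<notin> K \<times> K" for p
  proof -
    obtain x1 t1 x2 t2 where p: "p = ((x1, t1), (x2, t2))" by (metis surj_pair)
    from that p have "(x1, t1) \<notin> K \<or> (x2, t2) \<notin> K" by auto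
    from reg'[OF this] e show "g1t p = 0" "g1x p = 0" "g2t p = 0" "g2x p = 0" "case_prod P p = 0" "case_prod Q p = 0"
      unfolding p g1t_def g1x_def g2t_def g2x_def P_def Q_def by (elim disjE; simp add: zero_simps)+
  qed
  have ct: "continuous_on UNIV g1t" "continuous_on UNIV g1x" "continuous_on UNIV g2t" "continuous_on UNIV g2x"
    "continuous_on UNIV (case_prod P)" "continuous_on UNIV (case_prod Q)"
    unfolding g1t_def g1x_def g2t_def g2x_def P_def Q_def case_prod_beta by (intro continuous_intros; use e in simp)+
  have M: "\<bar>A p * B q\<bar> \<le> M * M" "\<bar>A p * FB q\<bar> \<le> M * M" "\<bar>B p * A q\<bar> \<le> M * M" "\<bar>B p * FA q\<bar> \<le> M * M" for p q
    using A_le[of p] B_le[of q] A_nonneg[of p] B_nonneg[of q] FA_le[of q] FB_le[of q] A_le[of q] B_le[of p] A_nonneg[of q] B_nonneg[of p]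
    by (auto simp: abs_mult intro!: mult_mono)
  have gen: "integrable lborel (\<lambda>p. b p * k p)"
    if "b \<in> borel_measurable borel" "\<And>p. \<bar>b p\<bar> \<le> M * M" "continuous_on UNIV k" "\<And>p. p \<notin> K \<times> K \<Longrightarrow> k p = 0"
    for b k :: "(real \<times> real) \<times> (real \<times> real) \<Rightarrow> real"
    by (rule integrable_bounded_times_compact[OF that(1,2,3) cKK that(4)])
  have I: "integrable lborel (\<lambda>p. A (snd p) * B (fst p) * g1t p)" "integrable lborel (\<lambda>p. A (snd p) * FB (fst p) * g1x p)"
    "integrable lborel (\<lambda>p. B (fst p) * A (snd p) * g2t p)" "integrable lborel (\<lambda>p. B (fst p) * FA (snd p) * g2x p)"
    "integrable lborel (\<lambda>p. A (snd p) * B (fst p) * case_prod P p)"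
    "integrable lborel (\<lambda>p. A (snd p) * FB (fst p) * case_prod Q p)" "integrable lborel (\<lambda>p. B (fst p) * FA (snd p) * case_prod Q p)"
    by (rule gen, measurable, rule M, rule ct, erule z)+
  have J1: "integrable (lborel \<Otimes>\<^sub>M lborel) (\<lambda>p. A (snd p) * (B (fst p) * g1t p + FB (fst p) * g1x p))"
    unfolding lborel_prod using Bochner_Integration.integrable_add[OF I(1,2)] by (simp add: algebra_simps)
  have J2: "integrable (lborel \<Otimes>\<^sub>M lborel) (\<lambda>p. B (fst p) * (A (snd p) * g2t p + FA (snd p) * g2x p))"
    unfolding lborel_prod using Bochner_Integration.integrable_add[OF I(3,4)] by (simp add: algebra_simps)
  have "0 \<le> (\<integral>z2. A z2 * (\<integral>z1. B z1 * g1t (z1, z2) + FB z1 * g1x (z1, z2) \<partial>lborel) \<partial>lborel)"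
    using i1 A_nonneg by (intro integral_nonneg_AE AE_I2) simp
  also have "\<dots> = (\<integral>z2. (\<integral>z1. A z2 * (B z1 * g1t (z1, z2) + FB z1 * g1x (z1, z2)) \<partial>lborel) \<partial>lborel)" by simp
  also have "\<dots> = (\<integral>p. A (snd p) * (B (fst p) * g1t p + FB (fst p) * g1x p) \<partial>(lborel \<Otimes>\<^sub>M lborel))"
    using lborel_pair.integral_snd[of "\<lambda>z1 z2. A z2 * (B z1 * g1t (z1, z2) + FB z1 * g1x (z1, z2))"] J1
    by (simp only: case_prod_unfold prod.collapse)
  finally have S1: "0 \<le> (\<integral>p. A (snd p) * (B (fst p) * g1t p + FB (fst p) * g1x p) \<partial>(lborel \<Otimes>\<^sub>M lborel))" .
  have "0 \<le> (\<integral>z1. B z1 * (\<integral>z2. A z2 * g2t (z1, z2) + FA z2 * g2x (z1, z2) \<partial>lborel) \<partial>lborel)"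
    using i2 B_nonneg by (intro integral_nonneg_AE AE_I2) simp
  also have "\<dots> = (\<integral>z1. (\<integral>z2. B z1 * (A z2 * g2t (z1, z2) + FA z2 * g2x (z1, z2)) \<partial>lborel) \<partial>lborel)" by simp
  also have "\<dots> = (\<integral>p. B (fst p) * (A (snd p) * g2t p + FA (snd p) * g2x p) \<partial>(lborel \<Otimes>\<^sub>M lborel))"
    using lborel_pair.integral_fst'[OF J2] by simp
  finally have S2: "0 \<le> (\<integral>p. B (fst p) * (A (snd p) * g2t p + FA (snd p) * g2x p) \<partial>(lborel \<Otimes>\<^sub>M lborel))" .
  \<comment> \<open>The two terms with \<open>pulse'\<close> cancel, as the kernel depends on
    \<open>t2 - t1\<close> only. The time cut-off contributes \<open>P\<close>, the step in
    \<open>x2 - x1\<close> contributes \<open>Q\<close>, and the moving cut-offs contribute the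
    nonnegative factors \<open>lam * B - FB\<close> and \<open>FA - mu * A\<close> with a minus
    sign.\<close>
  have pt: "A z2 * (B z1 * g1t (z1, z2) + FB z1 * g1x (z1, z2)) + B z1 * (A z2 * g2t (z1, z2) + FA z2 * g2x (z1, z2))
      \<le> Q z1 z2 * \<bar>FA z2 * B z1 - FB z1 * A z2\<bar> - P z1 z2 * (A z2 * B z1)" for z1 z2
  proof -
    obtain x1 t1 x2 t2 where p: "z1 = (x1, t1)" "z2 = (x2, t2)" by (metis surj_pair)
    define th w H H' C1 C2 C1' C2' th1 where "th = trunc_pow 2 (T' - t1)" and "w = pulse e (t2 - t1)" and "H = smooth_step ((x2 - x1) / e)"
      and "H' = smooth_step' ((x2 - x1) / e) / e" and "C1 = trunc_pow 3 (x1 - lam * t1 - y1)" and "C2 = trunc_pow 3 (y2 - (x2 - mu * t2))"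
      and "C1' = 3 * trunc_pow 2 (x1 - lam * t1 - y1)" and "C2' = 3 * trunc_pow 2 (y2 - (x2 - mu * t2))" and "th1 = 2 * trunc_pow 1 (T' - t1)"
    note defs = this[symmetric]
    have n: "0 \<le> th" "0 \<le> w" "0 \<le> H" "0 \<le> H'" "0 \<le> C1" "0 \<le> C2" "0 \<le> C1'" "0 \<le> C2'"
      using nn by (auto simp: th_def w_def H_def H'_def C1_def C2_def C1'_def C2'_def)
    have "A z2 * (B z1 * g1t (z1, z2) + FB z1 * g1x (z1, z2)) + B z1 * (A z2 * g2t (z1, z2) + FA z2 * g2x (z1, z2))
      = th * w * H' * C1 * C2 * (FA z2 * B z1 - FB z1 * A z2) - th1 * w * H * C1 * C2 * (A z2 * B z1)
        - th * w * H * C2 * C1' * A z2 * (lam * B z1 - FB z1) - th * w * H * C1 * C2' * B z1 * (FA z2 - mu * A z2)"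
      unfolding g1t_def g1x_def g2t_def g2x_def p prod.case defs by (simp only: ring_distribs) (simp add: algebra_simps)
    also have "\<dots> \<le> th * w * H' * C1 * C2 * \<bar>FA z2 * B z1 - FB z1 * A z2\<bar> - th1 * w * H * C1 * C2 * (A z2 * B z1) - 0 - 0"
    proof (rule diff_mono[OF diff_mono[OF diff_mono[OF _ order_refl]]])
      show "th * w * H' * C1 * C2 * (FA z2 * B z1 - FB z1 * A z2) \<le> th * w * H' * C1 * C2 * \<bar>FA z2 * B z1 - FB z1 * A z2\<bar>"
        using n by (intro mult_left_mono mult_nonneg_nonneg) auto
      show "0 \<le> th * w * H * C2 * C1' * A z2 * (lam * B z1 - FB z1)"
        using n A_nonneg[of z2] FB_speed[of z1] by (intro mult_nonneg_nonneg) auto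
      show "0 \<le> th * w * H * C1 * C2' * B z1 * (FA z2 - mu * A z2)"
        using n B_nonneg[of z1] FA_speed[of z2] by (intro mult_nonneg_nonneg) auto
    qed
    finally show ?thesis unfolding P_def Q_def p prod.case defs by simp
  qed
  have IQ: "integrable lborel (\<lambda>p. case_prod Q p * \<bar>FA (snd p) * B (fst p) - FB (fst p) * A (snd p)\<bar>)"
  proof -
    have "integrable lborel (\<lambda>p. \<bar>B (fst p) * FA (snd p) * case_prod Q p - A (snd p) * FB (fst p) * case_prod Q p\<bar>)"
      using I(6,7) by (intro integrable_abs Bochner_Integration.integrable_diff)
    also have "(\<lambda>p. \<bar>B (fst p) * FA (snd p) * case_prod Q p - A (snd p) * FB (fst p) * case_prod Q p\<bar>)
       = (\<lambda>p. case_prod Q p * \<bar>FA (snd p) * B (fst p) - FB (fst p) * A (snd p)\<bar>)"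
    proof
      fix p :: "(real \<times> real) \<times> (real \<times> real)"
      have "\<bar>B (fst p) * FA (snd p) * case_prod Q p - A (snd p) * FB (fst p) * case_prod Q p\<bar> = \<bar>case_prod Q p * (FA (snd p) * B (fst p) - FB (fst p) * A (snd p))\<bar>"
        by (simp only: algebra_simps)
      then show "\<bar>B (fst p) * FA (snd p) * case_prod Q p - A (snd p) * FB (fst p) * case_prod Q p\<bar> = case_prod Q p * \<bar>FA (snd p) * B (fst p) - FB (fst p) * A (snd p)\<bar>"
        using PQ0(2)[of p] by (simp add: abs_mult)
    qed
    finally show ?thesis .
  qed
  have IP: "integrable lborel (\<lambda>p. case_prod P p * (A (snd p) * B (fst p)))"
    using I(5) by (simp add: algebra_simps)
  have "0 \<le> (\<integral>p. A (snd p) * (B (fst p) * g1t p + FB (fst p) * g1x p) + B (fst p) * (A (snd p) * g2t p + FA (snd p) * g2x p) \<partial>(lborel \<Otimes>\<^sub>M lborel))"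
    using S1 S2 J1 J2 by simp
  also have "\<dots> \<le> (\<integral>p. case_prod Q p * \<bar>FA (snd p) * B (fst p) - FB (fst p) * A (snd p)\<bar> - case_prod P p * (A (snd p) * B (fst p)) \<partial>(lborel \<Otimes>\<^sub>M lborel))"
    using J1 J2 IP IQ pt by (intro integral_mono) (auto simp: lborel_prod)
  also have "\<dots> = (\<integral>p. case_prod Q p * \<bar>FA (snd p) * B (fst p) - FB (fst p) * A (snd p)\<bar> \<partial>lborel) - (\<integral>p. case_prod P p * (A (snd p) * B (fst p)) \<partial>lborel)"
    using IP IQ by (simp add: lborel_prod)
  finally have le: "(\<integral>p. case_prod P p * (A (snd p) * B (fst p)) \<partial>lborel) \<le> (\<integral>p. case_prod Q p * \<bar>FA (snd p) * B (fst p) - FB (fst p) * A (snd p)\<bar> \<partial>lborel)"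
    by simp
  have P0: "0 \<le> case_prod P p * (A (snd p) * B (fst p))" for p
    using PQ0(1)[of p] A_nonneg[of "snd p"] B_nonneg[of "fst p"] by (intro mult_nonneg_nonneg)
  have Q0: "0 \<le> case_prod Q p * \<bar>FA (snd p) * B (fst p) - FB (fst p) * A (snd p)\<bar>" for p
    using PQ0(2)[of p] by (intro mult_nonneg_nonneg) auto
  have mP: "case_prod P \<in> borel_measurable borel" "case_prod Q \<in> borel_measurable borel"
    using ct by (auto intro: borel_measurable_continuous_onI)
  \<comment> \<open>With nonnegative integrals the later changes of variables and of the order of
    integration require measurability only.\<close>
  have n1: "(\<integral>\<^sup>+p. ennreal (case_prod P p * (A (snd p) * B (fst p))) \<partial>lborel) \<le> (\<integral>\<^sup>+p. ennreal (case_prod Q p * \<bar>FA (snd p) * B (fst p) - FB (fst p) * A (snd p)\<bar>) \<partial>lborel)"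
    using le IP IQ P0 Q0 by (simp add: nn_integral_eq_integral ennreal_leI)
  have f: "(\<integral>\<^sup>+p. f p \<partial>lborel) = (\<integral>\<^sup>+z1. \<integral>\<^sup>+z2. f (z1, z2) \<partial>lborel \<partial>lborel)" if "f \<in> borel_measurable borel" for f :: "(real \<times> real) \<times> (real \<times> real) \<Rightarrow> ennreal"
    using lborel.nn_integral_fst[of f lborel] that by (simp add: lborel_prod)
  note [measurable] = mP
  show ?thesis using n1 by (subst (asm) f f; simp)+
qed

end

section \<open>Translation, shear and sections for nonnegative integrals\<close>

lemma nn_translation_lborel:
  fixes f :: "'a::euclidean_space \<Rightarrow> ennreal"
  assumes [measurable]: "f \<in> borel_measurable borel"
  shows "(\<integral>\<^sup>+z. f (h + z) \<partial>lborel) = (\<integral>\<^sup>+z. f z \<partial>lborel)"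
  using nn_integral_distr[of "(+) h" lborel borel f] by (simp add: lborel_distr_plus)

text \<open>The substitution z2 = z1 + h followed by Tonelli makes the displacement the outer
  variable, on which alone the kernel and the step depend.\<close>

lemma nn_shear_lborel:
  fixes f :: "'a::euclidean_space \<times> 'a \<Rightarrow> ennreal"
  assumes f [measurable]: "f \<in> borel_measurable borel"
  shows "(\<integral>\<^sup>+z1. \<integral>\<^sup>+z2. f (z1, z2) \<partial>lborel \<partial>lborel) = (\<integral>\<^sup>+h. \<integral>\<^sup>+z. f (z, z + h) \<partial>lborel \<partial>lborel)"
proof -
  have m: "(\<lambda>p. f (fst p, fst p + snd p)) \<in> borel_measurable (borel :: ('a \<times> 'a) measure)"
    by (rule measurable_compose[OF _ f]) (intro borel_measurable_continuous_onI continuous_intros)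
  have "(\<integral>\<^sup>+z1. \<integral>\<^sup>+z2. f (z1, z2) \<partial>lborel \<partial>lborel) = (\<integral>\<^sup>+z. \<integral>\<^sup>+h. f (z, z + h) \<partial>lborel \<partial>lborel)"
  proof (rule nn_integral_cong)
    fix z :: 'a
    have "(\<lambda>y. f (z, y)) \<in> borel_measurable borel"
      by (rule measurable_compose[OF _ f]) (intro borel_measurable_continuous_onI continuous_intros)
    then show "(\<integral>\<^sup>+z2. f (z, z2) \<partial>lborel) = (\<integral>\<^sup>+h. f (z, z + h) \<partial>lborel)"
      using nn_translation_lborel[of "\<lambda>y. f (z, y)" z] by simp
  qed
  also have "\<dots> = (\<integral>\<^sup>+h. \<integral>\<^sup>+z. f (z, z + h) \<partial>lborel \<partial>lborel)"
    using lborel_pair.Fubini[of "\<lambda>p. f (fst p, fst p + snd p)"] m by (simp add: lborel_prod)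
  finally show ?thesis .
qed

lemma borel_nn_integral_section:
  fixes f :: "'a::euclidean_space \<times> 'b::euclidean_space \<Rightarrow> ennreal"
  assumes "f \<in> borel_measurable borel"
  shows "(\<lambda>x. \<integral>\<^sup>+y. f (x, y) \<partial>lborel) \<in> borel_measurable borel"
    "(\<lambda>y. \<integral>\<^sup>+x. f (x, y) \<partial>lborel) \<in> borel_measurable borel"
proof -
  have "(\<lambda>(x, y). f (x, y)) \<in> borel_measurable (lborel \<Otimes>\<^sub>M lborel)" using assms by (simp add: lborel_prod)
  then have "(\<lambda>x. \<integral>\<^sup>+y. f (x, y) \<partial>lborel) \<in> borel_measurable lborel"
    by (rule lborel.borel_measurable_nn_integral)
  then show "(\<lambda>x. \<integral>\<^sup>+y. f (x, y) \<partial>lborel) \<in> borel_measurable borel" by simp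
  have "(\<lambda>p. f (snd p, fst p)) \<in> borel_measurable (borel :: ('b \<times> 'a) measure)"
    by (rule measurable_compose[OF _ assms]) (intro borel_measurable_continuous_onI continuous_intros)
  then have "(\<lambda>(y, x). f (x, y)) \<in> borel_measurable (lborel \<Otimes>\<^sub>M lborel)" by (simp add: lborel_prod case_prod_beta)
  then have "(\<lambda>y. \<integral>\<^sup>+x. f (x, y) \<partial>lborel) \<in> borel_measurable lborel"
    by (rule lborel.borel_measurable_nn_integral)
  then show "(\<lambda>y. \<integral>\<^sup>+x. f (x, y) \<partial>lborel) \<in> borel_measurable borel" by simp
qed

lemma nn_integral_lborel_split:
  fixes f :: "'a::euclidean_space \<times> 'b::euclidean_space \<Rightarrow> ennreal"
  assumes "f \<in> borel_measurable borel"
  shows "(\<integral>\<^sup>+p. f p \<partial>lborel) = (\<integral>\<^sup>+x. \<integral>\<^sup>+y. f (x, y) \<partial>lborel \<partial>lborel)"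
  using lborel.nn_integral_fst[of f lborel] assms by (simp add: lborel_prod)

lemma L1_translation_nn:
  fixes f :: "'a::euclidean_space \<Rightarrow> real"
  assumes "integrable lborel f" "e > 0"
  shows "\<exists>d>0. \<forall>h. norm h < d \<longrightarrow> (\<integral>\<^sup>+z. ennreal \<bar>f (z + h) - f z\<bar> \<partial>lborel) \<le> ennreal e"
proof -
  obtain d where d: "d > 0" "\<And>h. norm h < d \<Longrightarrow> (\<integral>z. \<bar>f (z + h) - f z\<bar> \<partial>lborel) < e"
    using L1_translation[OF assms] by blast
  have "(\<integral>\<^sup>+z. ennreal \<bar>f (z + h) - f z\<bar> \<partial>lborel) \<le> ennreal e" if "norm h < d" for h
  proof -
    have "integrable lborel (\<lambda>z. \<bar>f (z + h) - f z\<bar>)"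
      using translation_lborel(2)[OF assms(1)] assms(1) by auto
    then have "(\<integral>\<^sup>+z. ennreal \<bar>f (z + h) - f z\<bar> \<partial>lborel) = ennreal (\<integral>z. \<bar>f (z + h) - f z\<bar> \<partial>lborel)"
      by (rule nn_integral_eq_integral) simp
    then show ?thesis using d(2)[OF that] by (simp add: ennreal_leI)
  qed
  then show ?thesis using d(1) by blast
qed

lemma pulse_pos_mass:
  assumes "e > 0"
  shows "(\<integral>\<^sup>+s. ennreal (pulse e s) \<partial>lborel) \<noteq> 0" "(\<integral>\<^sup>+s. ennreal (pulse e s) \<partial>lborel) \<noteq> top"
proof -
  have c: "continuous_on UNIV (pulse e)" using continuous_on_pulse(1)[OF continuous_on_id, of UNIV e] by (simp add: id_def)
  then have m: "pulse e \<in> borel_measurable borel" by (rule borel_measurable_continuous_onI)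
  have "integrable lborel (\<lambda>s. 1 * pulse e s)"
    by (rule integrable_bounded_times_compact[where K = "{0..e}" and M = 1]) (use c in \<open>auto simp: pulse_eq_0\<close>)
  then show "(\<integral>\<^sup>+s. ennreal (pulse e s) \<partial>lborel) \<noteq> top"
    by (simp add: nn_integral_eq_integral pulse_nonneg)
  show "(\<integral>\<^sup>+s. ennreal (pulse e s) \<partial>lborel) \<noteq> 0"
  proof
    assume "(\<integral>\<^sup>+s. ennreal (pulse e s) \<partial>lborel) = 0"
    then have "AE s in lborel. ennreal (pulse e s) = 0" using m by (subst (asm) nn_integral_0_iff_AE) auto
    then have "AE s in lborel. s \<notin> {0<..<e}"
      by (rule AE_mp) (auto intro!: AE_I2 simp: pulse_def trunc_pow_def ennreal_eq_0_iff mult_le_0_iff)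
    then have "{0<..<e} \<in> null_sets lborel"
      by (subst (asm) AE_iff_null) (auto simp: greaterThanLessThan_def greaterThan_def lessThan_def Int_def)
    then show False using assms by (simp add: null_sets_def)
  qed
qed

section \<open>Vanishing of the product at equal times inside the cone\<close>

context two_fluxes begin

text \<open>The width of the kernel in \<open>doubling\<close> is sent to 0. On the right-hand side
  FA(z + h) B(z) - FB(z) A(z + h) vanishes at h = 0, so it is controlled by translations in the
  mean; the slope 1/e of the step is compensated by the length 3e of its ramp. On the left-hand side
  the product at equal times survives for every fixed distance r > 0.\<close>

lemma disjoint_supports:
  assumes y: "y2 < y1" and T': "0 < T'" "T' < T"
  shows "AE r in lborel. 0 < r \<longrightarrow> (AE z in lborel. snd z < T' \<and> y1 < fst z - lam * snd z \<and>
     fst z + r - mu * snd z < y2 \<longrightarrow> A (z + (r, 0)) * B z = 0)"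
proof -
  \<comment> \<open>The first entry leaves half of the gap \<open>y1 - y2\<close> free, with
    \<open>+ 1\<close> against \<open>mu = 0\<close>; the second keeps \<open>T' + e0\<close> below
    \<open>T\<close>.\<close>
  define e0 where "e0 = min ((y1 - y2) / (2 * (\<bar>mu\<bar> + 1))) ((T - T') / 2)"
  have e0: "0 < e0" "\<bar>mu\<bar> * e0 \<le> (y1 - y2) / 2" "T' + e0 < T"
  proof -
    show "0 < e0" using y T' by (simp add: e0_def)
    have "\<bar>mu\<bar> * e0 \<le> (\<bar>mu\<bar> + 1) * ((y1 - y2) / (2 * (\<bar>mu\<bar> + 1)))"
      using \<open>0 < e0\<close> y by (intro mult_mono) (auto simp: e0_def)
    also have "\<dots> = (y1 - y2) / 2"
    proof -
      have "\<bar>mu\<bar> + 1 > 0" by simp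
      then show ?thesis by (simp add: divide_simps)
    qed
    finally show "\<bar>mu\<bar> * e0 \<le> (y1 - y2) / 2" .
    have "e0 \<le> (T - T') / 2" unfolding e0_def by (rule min.cobounded2)
    also have "\<dots> < T - T'" using T' by simp
    finally show "T' + e0 < T" by simp
  qed
  define K where "K = cbox (- (\<bar>y1\<bar> + \<bar>y2\<bar> + (\<bar>lam\<bar> + \<bar>mu\<bar>) * T), (y1 - y2) / (2 * (mu - lam))) (\<bar>y1\<bar> + \<bar>y2\<bar> + (\<bar>lam\<bar> + \<bar>mu\<bar>) * T, T' + e0)"
  have cK: "compact K" by (simp add: K_def)
  have Kb [measurable]: "K \<in> sets borel" by (simp add: K_def)
  have reg: "z \<in> K \<and> z + h \<in> K"
    if "snd z \<le> T'" "0 \<le> snd h" "snd h \<le> e0" "0 \<le> fst h" "y1 \<le> fst z - lam * snd z" "fst (z + h) - mu * snd (z + h) \<le> y2" for z h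
  proof -
    have p: "snd z \<le> T'" "0 \<le> snd (z + h) - snd z" "snd (z + h) - snd z \<le> e0" "fst z \<le> fst (z + h)"
      using that by auto
    show ?thesis
      using region_bounds[OF y lam_mu e0 p that(5,6)] unfolding K_def prod.collapse by blast
  qed
  \<comment> \<open>The factors of the two kernels of \<open>doubling\<close> that depend on one
    point only: \<open>c1\<close> and \<open>c0\<close> at the first point, \<open>c2\<close> at the
    second.\<close>
  define c1 c2 c0 where "c1 = (\<lambda>z::real\<times>real. 2 * trunc_pow 1 (T' - snd z) * trunc_pow 3 (fst z - lam * snd z - y1))"
    and "c2 = (\<lambda>z::real\<times>real. trunc_pow 3 (y2 - (fst z - mu * snd z)))"
    and "c0 = (\<lambda>z::real\<times>real. trunc_pow 2 (T' - snd z) * trunc_pow 3 (fst z - lam * snd z - y1))"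
  have cc: "continuous_on S c1" "continuous_on S c2" "continuous_on S c0" for S
    unfolding c1_def c2_def c0_def by (intro continuous_intros)+
  then have cm [measurable]: "c1 \<in> borel_measurable borel" "c2 \<in> borel_measurable borel" "c0 \<in> borel_measurable borel"
    by (auto intro: borel_measurable_continuous_onI)
  have c_nonneg: "0 \<le> c1 z" "0 \<le> c2 z" "0 \<le> c0 z" for z by (auto simp: c1_def c2_def c0_def)
  have bd: "\<exists>C>0. \<forall>z\<in>K. f z \<le> C" if "continuous_on K f" for f :: "real \<times> real \<Rightarrow> real"
  proof -
    have "compact (f ` K)" using that cK by (rule compact_continuous_image)
    then obtain C where "\<forall>z\<in>K. \<bar>f z\<bar> \<le> C" by (metis (no_types) bounded_real compact_imp_bounded imageI)
    then show ?thesis by (intro exI[of _ "\<bar>C\<bar> + 1"]) force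
  qed
  obtain C1 where C1: "C1 > 0" "\<And>z. z \<in> K \<Longrightarrow> c1 z \<le> C1" using bd[OF cc(1)] by blast
  obtain C2 where C2: "C2 > 0" "\<And>z. z \<in> K \<Longrightarrow> c2 z \<le> C2" using bd[OF cc(2)] by blast
  obtain C0 where C0: "C0 > 0" "\<And>z. z \<in> K \<Longrightarrow> c0 z \<le> C0" using bd[OF cc(3)] by blast
  have M0: "0 \<le> M" using A_nonneg[of 0] A_le[of 0] by linarith
  define q where "q = (\<lambda>z. c1 z * B z * indicator K z)"
  \<comment> \<open>Restricted to the box these functions are integrable, as continuity of
    translations requires. Within the cone both \<open>z\<close> and \<open>z + h\<close> lie in the
    box, so nothing is lost there.\<close>
  define G1 G2 G3 where "G1 = (\<lambda>z. FA z * indicator K z)" and "G2 = (\<lambda>z. A z * indicator K z)" and "G3 = (\<lambda>z. c2 z * A z * indicator K z)"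
  have qm [measurable]: "q \<in> borel_measurable borel" by (simp add: q_def)
  have Gm [measurable]: "G1 \<in> borel_measurable borel" "G2 \<in> borel_measurable borel" "G3 \<in> borel_measurable borel"
    by (simp_all add: G1_def G2_def G3_def)
  have q0: "0 \<le> q z" for z using c_nonneg B_nonneg by (simp add: q_def)
  have qC: "q z \<le> C1 * M" for z
    using C1(1) C1(2)[of z] M0 c_nonneg[of z] B_nonneg[of z] B_le[of z] by (auto simp: q_def indicator_def intro!: mult_mono)
  have G30: "0 \<le> G3 z" for z using c_nonneg A_nonneg by (simp add: G3_def)
  have iK: "integrable lborel (\<lambda>z. C * indicator K z :: real)" for C
    using emeasure_bounded_finite[OF compact_imp_bounded[OF cK]] by (intro integrable_mult_right integrable_real_indicator) auto
  have iG: "integrable lborel G1" "integrable lborel G2" "integrable lborel G3"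
  proof -
    have b: "integrable lborel f" if [measurable]: "f \<in> borel_measurable borel" and le: "\<And>z. \<bar>f z\<bar> \<le> C * indicator K z" for C and f :: "real \<times> real \<Rightarrow> real"
    proof (rule Bochner_Integration.integrable_bound[OF iK[of C]])
      show "AE z in lborel. norm (f z) \<le> norm (C * indicator K z)"
      proof (rule AE_I2)
        fix z show "norm (f z) \<le> norm (C * indicator K z)" using le[of z] by simp
      qed
    qed simp
    show "integrable lborel G1"
    proof (rule b)
      fix z show "\<bar>G1 z\<bar> \<le> M * indicator K z" using FA_le[of z] by (simp add: G1_def indicator_def)
    qed simp
    show "integrable lborel G2"
    proof (rule b)
      fix z show "\<bar>G2 z\<bar> \<le> M * indicator K z" using A_le[of z] A_nonneg[of z] by (simp add: G2_def indicator_def)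
    qed simp
    show "integrable lborel G3"
    proof (rule b)
      fix z show "\<bar>G3 z\<bar> \<le> (C2 * M) * indicator K z"
        using A_le[of z] A_nonneg[of z] C2(1) C2(2)[of z] c_nonneg[of z] by (auto simp: G3_def indicator_def abs_mult intro!: mult_mono)
    qed simp
  qed
  \<comment> \<open>A weighted overlap of \<open>B\<close> at \<open>z\<close> with \<open>A\<close>
    at \<open>z + h\<close>. The aim is \<open>Psi (r, 0) = 0\<close> for almost every
    \<open>r > 0\<close>.\<close>
  define Psi where "Psi = (\<lambda>h. \<integral>\<^sup>+z. ennreal (q z * G3 (z + h)) \<partial>lborel)"
  have m3: "(\<lambda>p. ennreal (q (snd p) * G3 (snd p + fst p))) \<in> borel_measurable (borel :: ((real\<times>real)\<times>(real\<times>real)) measure)"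
  proof -
    have "(\<lambda>p. snd p + fst p) \<in> borel_measurable (borel :: ((real\<times>real)\<times>(real\<times>real)) measure)"
      by (intro borel_measurable_continuous_onI continuous_intros)
    note [measurable] = measurable_compose[OF this Gm(3)]
    show ?thesis by measurable
  qed
  have Psi_m [measurable]: "Psi \<in> borel_measurable borel"
    using borel_nn_integral_section(1)[OF m3] by (simp add: Psi_def)
  have pair0: "(\<lambda>r::real. (r, 0::real)) \<in> borel \<rightarrow>\<^sub>M borel" by (intro borel_measurable_continuous_onI continuous_intros)
  have Psi_m0 [measurable]: "(\<lambda>r. Psi (r, 0)) \<in> borel_measurable borel"
    by (rule measurable_compose[OF pair0 Psi_m])
  have main: "(\<integral>\<^sup>+r. Psi (r, 0) * indicator {eta..R} r \<partial>lborel) = 0" if eta: "0 < eta" "eta < R" for eta R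
  proof -
    have "(\<integral>\<^sup>+r. Psi (r, 0) * indicator {eta..R} r \<partial>lborel) \<le> ennreal ((6 * C0 * C2 * M + C1 * M * R) * del)" if del: "0 < del" for del
    proof -
      obtain d1 where d1: "d1 > 0" "\<And>h. norm h < d1 \<Longrightarrow> (\<integral>\<^sup>+z. ennreal \<bar>G1 (z + h) - G1 z\<bar> \<partial>lborel) \<le> ennreal del"
        using L1_translation_nn[OF iG(1) del] by blast
      obtain d2 where d2: "d2 > 0" "\<And>h. norm h < d2 \<Longrightarrow> (\<integral>\<^sup>+z. ennreal \<bar>G2 (z + h) - G2 z\<bar> \<partial>lborel) \<le> ennreal del"
        using L1_translation_nn[OF iG(2) del] by blast
      obtain d3 where d3: "d3 > 0" "\<And>h. norm h < d3 \<Longrightarrow> (\<integral>\<^sup>+z. ennreal \<bar>G3 (z + h) - G3 z\<bar> \<partial>lborel) \<le> ennreal del"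
        using L1_translation_nn[OF iG(3) del] by blast
      \<comment> \<open>\<open>3 * e \<le> eta\<close> puts every distance in
        \<open>[eta, R]\<close> beyond the ramp of the step; \<open>5 * e\<close> bounds the norm of
        a displacement with components below \<open>3 * e\<close> and \<open>e\<close>.\<close>
      define e where "e = Min {e0, eta / 3, d1 / 5, d2 / 5, d3 / 5}"
      have e: "0 < e" "e \<le> e0" "3 * e \<le> eta" "5 * e \<le> d1" "5 * e \<le> d2" "5 * e \<le> d3"
        using e0 eta d1(1) d2(1) d3(1) by (auto simp: e_def min_def)
      define m where "m = (\<integral>\<^sup>+s. ennreal (pulse e s) \<partial>lborel)"
      have om_c: "continuous_on UNIV (pulse e)" using continuous_on_pulse(1)[OF continuous_on_id, of UNIV e] by (simp add: id_def)
      have om_m [measurable]: "pulse e \<in> borel_measurable borel" using om_c by (rule borel_measurable_continuous_onI)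
      have m: "m \<noteq> 0" "m \<noteq> top" using pulse_pos_mass[OF e(1)] by (auto simp: m_def)
      define P where "P = (\<lambda>z1 z2. c1 z1 * pulse e (snd z2 - snd z1) * smooth_step ((fst z2 - fst z1) / e) * c2 z2)"
      define Q where "Q = (\<lambda>z1 z2. c0 z1 * pulse e (snd z2 - snd z1) * (smooth_step' ((fst z2 - fst z1) / e) / e) * c2 z2)"
      have PQm: "case_prod P \<in> borel_measurable borel" "case_prod Q \<in> borel_measurable borel"
        unfolding P_def Q_def case_prod_unfold c1_def c2_def c0_def
        by (intro borel_measurable_continuous_onI continuous_intros; use e in simp)+
      have "(\<integral>\<^sup>+z1. \<integral>\<^sup>+z2. ennreal (P z1 z2 * (A z2 * B z1)) \<partial>lborel \<partial>lborel)
          \<le> (\<integral>\<^sup>+z1. \<integral>\<^sup>+z2. ennreal (Q z1 z2 * \<bar>FA z2 * B z1 - FB z1 * A z2\<bar>) \<partial>lborel \<partial>lborel)"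
        using doubling[OF y T' e0 e(1,2)] unfolding P_def Q_def c1_def c2_def c0_def case_prod_unfold
        by (simp only: mult_ac)
      also have "(\<integral>\<^sup>+z1. \<integral>\<^sup>+z2. ennreal (P z1 z2 * (A z2 * B z1)) \<partial>lborel \<partial>lborel)
          = (\<integral>\<^sup>+h. \<integral>\<^sup>+z. ennreal (P z (z + h) * (A (z + h) * B z)) \<partial>lborel \<partial>lborel)"
        using nn_shear_lborel[of "\<lambda>p. ennreal (case_prod P p * (A (snd p) * B (fst p)))"] PQm by simp
      also have "(\<integral>\<^sup>+z1. \<integral>\<^sup>+z2. ennreal (Q z1 z2 * \<bar>FA z2 * B z1 - FB z1 * A z2\<bar>) \<partial>lborel \<partial>lborel)
          = (\<integral>\<^sup>+h. \<integral>\<^sup>+z. ennreal (Q z (z + h) * \<bar>FA (z + h) * B z - FB z * A (z + h)\<bar>) \<partial>lborel \<partial>lborel)"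
        using nn_shear_lborel[of "\<lambda>p. ennreal (case_prod Q p * \<bar>FA (snd p) * B (fst p) - FB (fst p) * A (snd p)\<bar>)"] PQm by simp
      finally have D: "(\<integral>\<^sup>+h. \<integral>\<^sup>+z. ennreal (P z (z + h) * (A (z + h) * B z)) \<partial>lborel \<partial>lborel)
          \<le> (\<integral>\<^sup>+h. \<integral>\<^sup>+z. ennreal (Q z (z + h) * \<bar>FA (z + h) * B z - FB z * A (z + h)\<bar>) \<partial>lborel \<partial>lborel)" .
      have low: "(\<integral>\<^sup>+h. indicator {eta..R} (fst h) * ennreal (pulse e (snd h)) * Psi h \<partial>lborel)
          \<le> (\<integral>\<^sup>+h. \<integral>\<^sup>+z. ennreal (P z (z + h) * (A (z + h) * B z)) \<partial>lborel \<partial>lborel)"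
      proof (rule nn_integral_mono)
        fix h :: "real \<times> real"
        show "indicator {eta..R} (fst h) * ennreal (pulse e (snd h)) * Psi h \<le> (\<integral>\<^sup>+z. ennreal (P z (z + h) * (A (z + h) * B z)) \<partial>lborel)"
        proof (cases "fst h \<in> {eta..R}")
          case True
          \<comment> \<open>Beyond its ramp the step is 1, and \<open>P\<close> reduces to the pulse
            times the weights contained in \<open>Psi\<close>.\<close>
          have s1: "smooth_step (fst h / e) = 1" using True e by (intro smooth_step_eq_1) (auto simp: field_simps)
          have "ennreal (pulse e (snd h)) * Psi h = (\<integral>\<^sup>+z. ennreal (pulse e (snd h)) * ennreal (q z * G3 (z + h)) \<partial>lborel)"
            unfolding Psi_def
          proof (rule nn_integral_cmult[symmetric])
            have "(\<lambda>z. z + h) \<in> borel \<rightarrow>\<^sub>M borel" by simp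
            note [measurable] = measurable_compose[OF this Gm(3)]
            show "(\<lambda>z. ennreal (q z * G3 (z + h))) \<in> borel_measurable lborel" by simp
          qed
          also have "\<dots> \<le> (\<integral>\<^sup>+z. ennreal (P z (z + h) * (A (z + h) * B z)) \<partial>lborel)"
          proof (rule nn_integral_mono)
            fix z
            have "pulse e (snd h) * (q z * G3 (z + h)) \<le> pulse e (snd h) * ((c1 z * B z * 1) * (c2 (z + h) * A (z + h) * 1))"
              unfolding q_def G3_def using pulse_nonneg c_nonneg A_nonneg B_nonneg
              by (intro mult_left_mono mult_mono) (auto simp: indicator_def)
            also have "\<dots> = P z (z + h) * (A (z + h) * B z)" by (simp add: P_def s1)
            finally show "ennreal (pulse e (snd h)) * ennreal (q z * G3 (z + h)) \<le> ennreal (P z (z + h) * (A (z + h) * B z))"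
              using pulse_nonneg by (simp add: ennreal_mult'[symmetric] ennreal_leI)
          qed
          finally show ?thesis using True by simp
        qed simp
      qed
      have up: "(\<integral>\<^sup>+h. \<integral>\<^sup>+z. ennreal (Q z (z + h) * \<bar>FA (z + h) * B z - FB z * A (z + h)\<bar>) \<partial>lborel \<partial>lborel)
          \<le> m * ennreal (6 * C0 * C2 * M * del)"
      proof -
        have "(\<integral>\<^sup>+z. ennreal (Q z (z + h) * \<bar>FA (z + h) * B z - FB z * A (z + h)\<bar>) \<partial>lborel)
            \<le> (indicator {0..3 * e} (fst h) * ennreal (pulse e (snd h))) * ennreal (2 * C0 * C2 * M * del / e)" for h
        proof (cases "0 < snd h \<and> snd h < e \<and> 0 < fst h \<and> fst h < 3 * e")
          case False
          then have "pulse e (snd h) = 0 \<or> smooth_step' (fst h / e) = 0"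
          proof -
            have "fst h / e \<le> 0" if "fst h \<le> 0" using that e by (simp add: divide_nonpos_pos)
            moreover have "3 \<le> fst h / e" if "3 * e \<le> fst h" using that e by (simp add: field_simps)
            ultimately show ?thesis
              using False pulse_eq_0(1)[of "snd h" e] smooth_step_eq_0(2)[of "fst h / e"] smooth_step_eq_1(2)[of "fst h / e"] by linarith
          qed
          then have "Q z (z + h) = 0" for z by (auto simp: Q_def)
          then show ?thesis by simp
        next
          case True
          have "norm h \<le> \<bar>fst h\<bar> + \<bar>snd h\<bar>" using norm_Pair_le[of "fst h" "snd h"] by simp
          also have "\<dots> < 5 * e" using True e by simp
          finally have nh: "norm h < d1" "norm h < d2" using e by auto
          define k where "k = pulse e (snd h) * (C0 * C2 * M / e)"
          have k0: "0 \<le> k" using pulse_nonneg C0 C2 M0 e by (simp add: k_def)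
          have pt: "Q z (z + h) * \<bar>FA (z + h) * B z - FB z * A (z + h)\<bar> \<le> k * (\<bar>G1 (z + h) - G1 z\<bar> + \<bar>G2 (z + h) - G2 z\<bar>)" for z
          proof (cases "snd z < T' \<and> y1 < fst z - lam * snd z \<and> fst (z + h) - mu * snd (z + h) < y2")
            case F: False
            have "c0 z = 0 \<or> c2 (z + h) = 0"
              using F unfolding c0_def c2_def by (auto simp: not_less trunc_pow_eq_0)
            then have "Q z (z + h) = 0" by (auto simp: Q_def)
            then show ?thesis using k0 by simp
          next
            case R: True
            have zK: "z \<in> K" "z + h \<in> K" using reg[of z h] R True e by auto
            \<comment> \<open>The subtracted products \<open>FA z * B z\<close> and
              \<open>FB z * A z\<close> are zero by \<open>disj\<close>; this turns the expression
              into increments of \<open>G1\<close> and \<open>G2\<close>.\<close>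
            have "FA (z + h) * B z - FB z * A (z + h) = (G1 (z + h) - G1 z) * B z - FB z * (G2 (z + h) - G2 z)"
              using zK disj[of z] by (auto simp: G1_def G2_def algebra_simps)
            then have "\<bar>FA (z + h) * B z - FB z * A (z + h)\<bar> \<le> \<bar>G1 (z + h) - G1 z\<bar> * B z + \<bar>FB z\<bar> * \<bar>G2 (z + h) - G2 z\<bar>"
              using B_nonneg[of z] abs_triangle_ineq4[of "(G1 (z + h) - G1 z) * B z" "FB z * (G2 (z + h) - G2 z)"] by (simp add: abs_mult)
            also have "\<dots> \<le> \<bar>G1 (z + h) - G1 z\<bar> * M + M * \<bar>G2 (z + h) - G2 z\<bar>"
              using B_le[of z] FB_le[of z] by (intro add_mono mult_mono) (auto simp: M0 B_nonneg)
            finally have b1: "\<bar>FA (z + h) * B z - FB z * A (z + h)\<bar> \<le> M * (\<bar>G1 (z + h) - G1 z\<bar> + \<bar>G2 (z + h) - G2 z\<bar>)" 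
              by (simp add: algebra_simps)
            have "Q z (z + h) \<le> C0 * pulse e (snd h) * (1 / e) * C2"
            proof -
              have "c0 z * pulse e (snd h) * (smooth_step' (fst h / e) / e) * c2 (z + h) \<le> C0 * pulse e (snd h) * (1 / e) * C2"
                using C0(1) C0(2)[OF zK(1)] C2(1) C2(2)[OF zK(2)] c_nonneg(2)[of "z + h"] c_nonneg(3)[of z] pulse_nonneg[of e "snd h"]
                  e(1) smooth_step'_bounds[of "fst h / e"]
                by (intro mult_mono mult_nonneg_nonneg divide_right_mono divide_nonneg_pos) auto
              then show ?thesis by (simp add: Q_def)
            qed
            then have "Q z (z + h) * \<bar>FA (z + h) * B z - FB z * A (z + h)\<bar> \<le> (C0 * pulse e (snd h) * (1 / e) * C2) * (M * (\<bar>G1 (z + h) - G1 z\<bar> + \<bar>G2 (z + h) - G2 z\<bar>))"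
              using b1 C0 C2 pulse_nonneg[of e "snd h"] e by (intro mult_mono) auto
            also have "\<dots> = k * (\<bar>G1 (z + h) - G1 z\<bar> + \<bar>G2 (z + h) - G2 z\<bar>)" by (simp add: k_def)
            finally show ?thesis .
          qed
          have "(\<lambda>z. z + h) \<in> borel \<rightarrow>\<^sub>M borel" by simp
          note [measurable] = measurable_compose[OF this Gm(1)] measurable_compose[OF this Gm(2)]
          have "(\<integral>\<^sup>+z. ennreal (Q z (z + h) * \<bar>FA (z + h) * B z - FB z * A (z + h)\<bar>) \<partial>lborel)
             \<le> (\<integral>\<^sup>+z. ennreal k * (ennreal \<bar>G1 (z + h) - G1 z\<bar> + ennreal \<bar>G2 (z + h) - G2 z\<bar>) \<partial>lborel)"
            using pt k0 by (intro nn_integral_mono) (simp add: ennreal_mult'[symmetric] ennreal_plus[symmetric] ennreal_leI del: ennreal_plus)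
          also have "\<dots> = ennreal k * ((\<integral>\<^sup>+z. ennreal \<bar>G1 (z + h) - G1 z\<bar> \<partial>lborel) + (\<integral>\<^sup>+z. ennreal \<bar>G2 (z + h) - G2 z\<bar> \<partial>lborel))"
            by (simp add: nn_integral_cmult nn_integral_add)
          also have "\<dots> \<le> ennreal k * (ennreal del + ennreal del)"
            using d1(2)[OF nh(1)] d2(2)[OF nh(2)] by (intro mult_left_mono add_mono) auto
          also have "\<dots> = ennreal (pulse e (snd h)) * ennreal (2 * C0 * C2 * M * del / e)"
            using del k0 pulse_nonneg[of e "snd h"] by (simp add: ennreal_plus[symmetric] ennreal_mult'[symmetric] k_def mult_ac del: ennreal_plus)
          finally show ?thesis using True by simp
        qed
        then have "(\<integral>\<^sup>+h. \<integral>\<^sup>+z. ennreal (Q z (z + h) * \<bar>FA (z + h) * B z - FB z * A (z + h)\<bar>) \<partial>lborel \<partial>lborel)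
          \<le> (\<integral>\<^sup>+h. (indicator {0..3 * e} (fst h) * ennreal (pulse e (snd h))) * ennreal (2 * C0 * C2 * M * del / e) \<partial>lborel)"
          by (rule nn_integral_mono)
        also have "\<dots> = (\<integral>\<^sup>+r. \<integral>\<^sup>+s. (indicator {0..3 * e} r * ennreal (pulse e s)) * ennreal (2 * C0 * C2 * M * del / e) \<partial>lborel \<partial>lborel)"
          by (subst nn_integral_lborel_split) auto
        also have "\<dots> = (\<integral>\<^sup>+r. indicator {0..3 * e} r * (m * ennreal (2 * C0 * C2 * M * del / e)) \<partial>lborel)"
          by (simp add: nn_integral_cmult nn_integral_multc m_def mult_ac)
        \<comment> \<open>The length of the ramp absorbs the factor \<open>1 / e\<close>, and only
          \<open>del\<close> remains as a small factor.\<close>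
        also have "\<dots> = ennreal (3 * e) * (m * ennreal (2 * C0 * C2 * M * del / e))"
          using e by (simp add: nn_integral_multc)
        also have "\<dots> = m * (ennreal (3 * e) * ennreal (2 * C0 * C2 * M * del / e))" by (simp only: mult_ac)
        also have "\<dots> = m * ennreal (6 * C0 * C2 * M * del)"
          using e by (simp add: ennreal_mult'[symmetric] mult_ac)
        finally show ?thesis .
      qed
      \<comment> \<open>The kernel sees displacements \<open>(r, s)\<close> with \<open>s\<close> in
        \<open>(0, e)\<close>; moving back to \<open>s = 0\<close> costs one translation of
        \<open>G3\<close> in the mean, uniformly in \<open>r\<close>.\<close>
      have shift: "Psi (r, 0) \<le> Psi (r, s) + ennreal (C1 * M * del)" if s: "0 < s" "s < e" for r s
      proof -
        have "(\<lambda>z. z + h) \<in> borel \<rightarrow>\<^sub>M borel" for h :: "real \<times> real" by simp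
        note [measurable] = measurable_compose[OF this Gm(3)]
        have "Psi (r, 0) \<le> (\<integral>\<^sup>+z. ennreal (q z * G3 (z + (r, s))) + ennreal (C1 * M) * ennreal \<bar>G3 (z + (r, s)) - G3 (z + (r, 0))\<bar> \<partial>lborel)"
          unfolding Psi_def
        proof (rule nn_integral_mono)
          fix z
          have "q z * G3 (z + (r, 0)) \<le> q z * G3 (z + (r, s)) + q z * \<bar>G3 (z + (r, s)) - G3 (z + (r, 0))\<bar>"
            using q0[of z] by (simp flip: distrib_left add: mult_left_mono)
          also have "\<dots> \<le> q z * G3 (z + (r, s)) + C1 * M * \<bar>G3 (z + (r, s)) - G3 (z + (r, 0))\<bar>"
            using qC[of z] by (intro add_left_mono mult_right_mono) auto
          finally show "ennreal (q z * G3 (z + (r, 0))) \<le> ennreal (q z * G3 (z + (r, s))) + ennreal (C1 * M) * ennreal \<bar>G3 (z + (r, s)) - G3 (z + (r, 0))\<bar>"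
            using q0 G30 C1 M0 by (simp add: ennreal_mult'[symmetric] ennreal_plus[symmetric] ennreal_leI del: ennreal_plus)
        qed
        also have "\<dots> = Psi (r, s) + ennreal (C1 * M) * (\<integral>\<^sup>+z. ennreal \<bar>G3 (z + (r, s)) - G3 (z + (r, 0))\<bar> \<partial>lborel)"
          by (simp add: nn_integral_add nn_integral_cmult Psi_def)
        also have "(\<integral>\<^sup>+z. ennreal \<bar>G3 (z + (r, s)) - G3 (z + (r, 0))\<bar> \<partial>lborel) = (\<integral>\<^sup>+z. ennreal \<bar>G3 (z + (0, s)) - G3 z\<bar> \<partial>lborel)"
          using nn_translation_lborel[of "\<lambda>z. ennreal \<bar>G3 (z + (0, s)) - G3 z\<bar>" "(r, 0)"] by (simp add: add_ac)
        also have "\<dots> \<le> ennreal del" using s e by (intro d3(2)) (simp add: norm_Pair)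
        finally show ?thesis using C1 M0 del by (simp add: ennreal_mult' mult_left_mono add_left_mono)
      qed
      have "m * (\<integral>\<^sup>+r. Psi (r, 0) * indicator {eta..R} r \<partial>lborel)
          = (\<integral>\<^sup>+r. \<integral>\<^sup>+s. indicator {eta..R} r * ennreal (pulse e s) * Psi (r, 0) \<partial>lborel \<partial>lborel)"
        by (simp add: nn_integral_cmult[symmetric] nn_integral_multc[symmetric] m_def mult_ac)
      also have "\<dots> \<le> (\<integral>\<^sup>+r. \<integral>\<^sup>+s. indicator {eta..R} r * ennreal (pulse e s) * (Psi (r, s) + ennreal (C1 * M * del)) \<partial>lborel \<partial>lborel)"
      proof (intro nn_integral_mono)
        fix r s
        show "indicator {eta..R} r * ennreal (pulse e s) * Psi (r, 0) \<le> indicator {eta..R} r * ennreal (pulse e s) * (Psi (r, s) + ennreal (C1 * M * del))"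
        proof (cases "0 < s \<and> s < e")
          case True then show ?thesis by (intro mult_left_mono shift) auto
        next
          case False then have "pulse e s = 0" by (intro pulse_eq_0) auto
          then show ?thesis by simp
        qed
      qed
      also have "\<dots> = (\<integral>\<^sup>+h. indicator {eta..R} (fst h) * ennreal (pulse e (snd h)) * (Psi h + ennreal (C1 * M * del)) \<partial>lborel)"
        by (subst nn_integral_lborel_split) auto
      also have "\<dots> = (\<integral>\<^sup>+h. indicator {eta..R} (fst h) * ennreal (pulse e (snd h)) * Psi h \<partial>lborel)
          + (\<integral>\<^sup>+h. indicator {eta..R} (fst h) * ennreal (pulse e (snd h)) * ennreal (C1 * M * del) \<partial>lborel)"
        by (simp add: distrib_left nn_integral_add)
      also have "(\<integral>\<^sup>+h. indicator {eta..R} (fst h) * ennreal (pulse e (snd h)) * ennreal (C1 * M * del) \<partial>lborel)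
          = (\<integral>\<^sup>+r. \<integral>\<^sup>+s. indicator {eta..R} r * ennreal (pulse e s) * ennreal (C1 * M * del) \<partial>lborel \<partial>lborel)"
        by (subst nn_integral_lborel_split) auto
      also have "\<dots> = (\<integral>\<^sup>+r. indicator {eta..R} r * (m * ennreal (C1 * M * del)) \<partial>lborel)"
        by (simp add: nn_integral_cmult nn_integral_multc m_def mult_ac)
      also have "\<dots> = m * (ennreal (R - eta) * ennreal (C1 * M * del))"
        using eta by (subst nn_integral_multc) (simp_all add: mult_ac)
      also have "\<dots> \<le> m * ennreal (C1 * M * R * del)"
        using eta C1 M0 del by (intro mult_left_mono) (auto simp: ennreal_mult'[symmetric] mult_ac intro!: ennreal_leI mult_left_mono)
      finally have "m * (\<integral>\<^sup>+r. Psi (r, 0) * indicator {eta..R} r \<partial>lborel) \<le>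
        (\<integral>\<^sup>+h. indicator {eta..R} (fst h) * ennreal (pulse e (snd h)) * Psi h \<partial>lborel) + m * ennreal (C1 * M * R * del)"
        by (simp add: add_left_mono)
      also have "\<dots> \<le> m * ennreal (6 * C0 * C2 * M * del) + m * ennreal (C1 * M * R * del)"
        using low D up by (intro add_right_mono) (meson order_trans)
      also have "\<dots> = m * ennreal ((6 * C0 * C2 * M + C1 * M * R) * del)"
        using C0 C1 C2 M0 del eta by (simp add: distrib_left[symmetric] ennreal_plus[symmetric] distrib_right del: ennreal_plus)
      \<comment> \<open>The mass \<open>m\<close> of the kernel stands on both sides and cancels,
        since it is neither 0 nor infinite.\<close>
      finally show ?thesis using ennreal_mult_le_mult_iff[OF m] by blast
    qed
    note small = this
    show ?thesis
    proof (rule ccontr)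
      assume "(\<integral>\<^sup>+r. Psi (r, 0) * indicator {eta..R} r \<partial>lborel) \<noteq> 0"
      then have pos: "0 < (\<integral>\<^sup>+r. Psi (r, 0) * indicator {eta..R} r \<partial>lborel)"
        unfolding zero_less_iff_neq_zero .
      obtain w where w: "0 < w" "w < (\<integral>\<^sup>+r. Psi (r, 0) * indicator {eta..R} r \<partial>lborel)"
        using dense[OF pos] by blast
      have "w < top" using w(2) top_greatest by (rule less_le_trans)
      then obtain x where "w = ennreal x" "0 \<le> x" by (cases w) auto
      with w have x: "0 < x" "ennreal x < (\<integral>\<^sup>+r. Psi (r, 0) * indicator {eta..R} r \<partial>lborel)" by auto
      define D where "D = 6 * C0 * C2 * M + C1 * M * R + 1"
      have D: "D > 0" using C0 C1 C2 M0 eta by (simp add: D_def add_nonneg_pos)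
      have "(6 * C0 * C2 * M + C1 * M * R) * (x / D) \<le> D * (x / D)"
        using x D by (intro mult_right_mono) (auto simp: D_def)
      then have "ennreal ((6 * C0 * C2 * M + C1 * M * R) * (x / D)) \<le> ennreal x" using D by (intro ennreal_leI) simp
      with small[of "x / D"] x D show False by (meson divide_pos_pos leD order_trans)
    qed
  qed
  \<comment> \<open>These intervals exhaust the positive half-line; the right end
    \<open>n + 2\<close> exceeds the left one already for \<open>n = 0\<close>.\<close>
  have "AE r in lborel. Psi (r, 0) * indicator {1 / Suc n .. real n + 2} r = 0" for n
  proof -
    have "1 / real (Suc n) \<le> 1" by simp
    then have "1 / real (Suc n) < real n + 2" by (rule le_less_trans) simp
    from main[OF _ this] have "(\<integral>\<^sup>+r. Psi (r, 0) * indicator {1 / Suc n .. real n + 2} r \<partial>lborel) = 0" by simp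
    then show ?thesis by (subst (asm) nn_integral_0_iff_AE) auto
  qed
  then have "AE r in lborel. \<forall>n. Psi (r, 0) * indicator {1 / Suc n .. real n + 2} r = 0"
    by (subst AE_all_countable) blast
  then show ?thesis
  proof (rule eventually_mono, intro impI)
    fix r :: real assume a: "\<forall>n. Psi (r, 0) * indicator {1 / Suc n .. real n + 2} r = 0" and r: "0 < r"
    obtain n1 where n1: "1 / Suc n1 < r" using r reals_Archimedean[of r] by (auto simp: inverse_eq_divide)
    obtain n2 where n2: "r < real n2" using reals_Archimedean2 by blast
    define n where "n = max n1 n2"
    have "1 / Suc n \<le> 1 / Suc n1" by (simp add: n_def frac_le)
    then have "r \<in> {1 / Suc n .. real n + 2}" using n1 n2 by (auto simp: n_def)
    then have "Psi (r, 0) = 0" using a[rule_format, of n] by simp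
    then have i0: "(\<integral>\<^sup>+z. ennreal (q z * G3 (z + (r, 0))) \<partial>lborel) = 0" by (simp add: Psi_def)
    have "(\<lambda>z. z + (r, 0::real)) \<in> borel \<rightarrow>\<^sub>M borel" by simp
    note [measurable] = measurable_compose[OF this Gm(3)]
    have "AE z in lborel. ennreal (q z * G3 (z + (r, 0))) = 0"
      using i0 by (subst (asm) nn_integral_0_iff_AE) simp_all
    then show "AE z in lborel. snd z < T' \<and> y1 < fst z - lam * snd z \<and> fst z + r - mu * snd z < y2 \<longrightarrow> A (z + (r, 0)) * B z = 0"
    proof (rule eventually_mono, intro impI)
      fix z assume 0: "ennreal (q z * G3 (z + (r, 0))) = 0" and s: "snd z < T' \<and> y1 < fst z - lam * snd z \<and> fst z + r - mu * snd z < y2"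
      have "q z * G3 (z + (r, 0)) = 0" using 0 q0[of z] G30[of "z + (r, 0)"] by (auto simp: ennreal_eq_0_iff mult_le_0_iff)
      moreover have "z \<in> K" "z + (r, 0) \<in> K" using reg[of z "(r, 0)"] s r e0 by auto
      \<comment> \<open>The weights are strictly positive inside the open cone, so the vanishing
        comes from \<open>A\<close> and \<open>B\<close> themselves.\<close>
      moreover have "c1 z \<noteq> 0" "c2 (z + (r, 0)) \<noteq> 0" using s by (auto simp: c1_def c2_def trunc_pow_def)
      ultimately show "A (z + (r, 0)) * B z = 0" by (auto simp: q_def G3_def)
    qed
  qed
qed

end

section \<open>Oleinik's inequality\<close>

lemma AE_lborel_uminus:
  fixes P :: "real \<Rightarrow> bool"
  assumes "AE x in lborel. P x" shows "AE x in lborel. P (- x)"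
  using AE_distrD[of uminus lborel "borel :: real measure" P, unfolded lborel_distr_uminus] assms by simp

lemma AE_lborel_translate:
  fixes P :: "real \<Rightarrow> bool"
  assumes "AE x in lborel. P x" shows "AE x in lborel. P (c + x)"
  using AE_distrD[of "(+) c" lborel "borel :: real measure" P, unfolded lborel_distr_plus] assms by simp

lemma AE_lborel_swap:
  fixes P :: "'a::euclidean_space \<times> 'b::euclidean_space \<Rightarrow> bool"
  assumes "AE p in lborel. P p" shows "AE y in lborel. AE x in lborel. P (x, y)"
proof -
  have "AE p in lborel \<Otimes>\<^sub>M lborel. P p" using assms by (subst lborel_prod)
  then have "AE p in distr (lborel \<Otimes>\<^sub>M lborel) (lborel \<Otimes>\<^sub>M lborel) (\<lambda>(x, y). (y, x)). P p"
    by (subst (asm) lborel_pair.distr_pair_swap)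
  then have "AE w in lborel \<Otimes>\<^sub>M lborel. P ((\<lambda>(x, y). (y, x)) w)"
    using AE_distrD[OF measurable_pair_swap'] by blast
  then have "AE y in lborel. AE x in lborel. P ((\<lambda>(x, y). (y, x)) (y, x))"
    by (rule lborel_pair.AE_pair)
  then show ?thesis by simp
qed

lemma distr_lborel_reflect_fst:
  "distr lborel borel (\<lambda>p. (- fst p, snd p)) = (lborel :: (real \<times> real) measure)"
proof (rule measure_eqI)
  fix A :: "(real \<times> real) set" assume "A \<in> sets (distr lborel borel (\<lambda>p. (- fst p, snd p)))"
  then have A [measurable]: "A \<in> sets borel" by simp
  have r [measurable]: "(\<lambda>p. (- fst p, snd p)) \<in> borel \<rightarrow>\<^sub>M (borel :: (real \<times> real) measure)"
    by (intro borel_measurable_continuous_onI continuous_intros)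
  have iA: "indicator A \<in> borel_measurable (borel :: (real \<times> real) measure)" by simp
  define f where "f = (\<lambda>x. \<integral>\<^sup>+t. indicator A (x, t :: real) \<partial>lborel :: ennreal)"
  have f: "f \<in> borel_measurable borel"
    unfolding f_def by (rule borel_nn_integral_section(1)[OF iA])
  have "emeasure (distr lborel borel (\<lambda>p. (- fst p, snd p))) A = (\<integral>\<^sup>+p. indicator A p \<partial>distr lborel borel (\<lambda>p. (- fst p, snd p)))"
    by simp
  also have "\<dots> = (\<integral>\<^sup>+p. indicator A (- fst p, snd p) \<partial>lborel)"
    by (rule nn_integral_distr) simp_all
  also have "\<dots> = (\<integral>\<^sup>+x. f (- x) \<partial>lborel)"
    unfolding f_def using nn_integral_lborel_split[of "\<lambda>p. indicator A (- fst p, snd p)"] measurable_compose[OF r iA] by simp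
  also have "\<dots> = (\<integral>\<^sup>+x. f x \<partial>distr lborel borel uminus)"
    using f by (subst nn_integral_distr) auto
  also have "\<dots> = (\<integral>\<^sup>+x. f x \<partial>lborel)" by (simp add: lborel_distr_uminus)
  also have "\<dots> = (\<integral>\<^sup>+p. indicator A p \<partial>lborel)"
    unfolding f_def by (rule nn_integral_lborel_split[OF iA, symmetric])
  also have "\<dots> = emeasure lborel A" by simp
  finally show "emeasure (distr lborel borel (\<lambda>p. (- fst p, snd p))) A = emeasure lborel A" .
qed simp

text \<open>Reflection in space preserves Lebesgue measure and reverses the sign of the space
  derivative; the flux therefore changes sign.\<close>

lemma subconserved_reflect:
  assumes S: "subconserved T A F" and [measurable]: "A \<in> borel_measurable borel" "F \<in> borel_measurable borel"
  shows "subconserved T (\<lambda>p. A (- fst p, snd p)) (\<lambda>p. - F (- fst p, snd p))"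
  unfolding subconserved_def
proof (intro allI impI, elim conjE)
  fix g gt gx assume t: "test_fn T g gt gx" and g0: "\<forall>p. 0 \<le> g p"
  let ?r = "\<lambda>p::real \<times> real. (- fst p, snd p)"
  have r: "continuous_on UNIV ?r" by (intro continuous_intros)
  have r [measurable]: "?r \<in> borel \<rightarrow>\<^sub>M borel" using r by (rule borel_measurable_continuous_onI)
  have [measurable]: "gt \<in> borel_measurable borel" "gx \<in> borel_measurable borel"
    using test_fn_test_function(5,6)[OF t] by (auto intro: borel_measurable_continuous_onI)
  have t': "test_fn T (\<lambda>p. g (?r p)) (\<lambda>p. gt (?r p)) (\<lambda>p. - gx (?r p))"
  proof -
    obtain gtx K where c: "continuous_on UNIV g" "continuous_on UNIV gt" "continuous_on UNIV gx" "continuous_on UNIV gtx"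
      and d: "\<And>x t. ((\<lambda>s. g (x, s)) has_real_derivative gt (x, t)) (at t)"
              "\<And>x t. ((\<lambda>y. g (y, t)) has_real_derivative gx (x, t)) (at x)"
              "\<And>x t. ((\<lambda>y. gt (y, t)) has_real_derivative gtx (x, t)) (at x)"
      and K: "compact K" "K \<subseteq> strip T" "\<And>p. p \<notin> K \<Longrightarrow> g p = 0"
      using t unfolding test_fn_def by metis
    have c': "continuous_on UNIV (\<lambda>p. f (?r p))" if "continuous_on UNIV f" for f :: "real \<times> real \<Rightarrow> real"
      by (rule continuous_on_compose2[OF that]) (auto intro!: continuous_intros)
    have um: "((\<lambda>y. - y) has_real_derivative - 1) (at x)" for x :: real
      by (rule derivative_eq_intros refl)+
    have "compact (?r ` K)" using K(1) by (intro compact_continuous_image continuous_intros)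
    moreover have "?r ` K \<subseteq> strip T" using K(2) by (auto simp: strip_def)
    moreover have "g (?r p) = 0" if "p \<notin> ?r ` K" for p
    proof (rule K(3))
      show "?r p \<notin> K"
      proof
        assume "?r p \<in> K"
        then have "?r (?r p) \<in> ?r ` K" by (rule imageI)
        then show False using that by simp
      qed
    qed
    moreover have "((\<lambda>y. g (- y, t)) has_real_derivative - gx (- x, t)) (at x)" for x t
      using DERIV_chain2[OF d(2) um, of t x] by simp
    moreover have "((\<lambda>y. gt (- y, t)) has_real_derivative - gtx (- x, t)) (at x)" for x t
      using DERIV_chain2[OF d(3) um, of t x] by simp
    ultimately show ?thesis
      unfolding test_fn_def using c'[OF c(1)] c'[OF c(2)] continuous_on_minus[OF c'[OF c(3)]] continuous_on_minus[OF c'[OF c(4)]] d(1)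
      by (intro exI[of _ "\<lambda>p. - gtx (?r p)"] exI[of _ "?r ` K"]) simp
  qed
  have "0 \<le> (\<integral>p. A p * gt (?r p) + F p * (- gx (?r p)) \<partial>lborel)"
    using S t' g0 unfolding subconserved_def by blast
  also have "\<dots> = (\<integral>p. A p * gt (?r p) + F p * (- gx (?r p)) \<partial>distr lborel borel ?r)"
    by (simp only: distr_lborel_reflect_fst)
  also have "\<dots> = (\<integral>p. A (?r p) * gt p + (- F (?r p)) * gx p \<partial>lborel)"
    by (subst integral_distr) auto
  finally show "0 \<le> (\<integral>p. A (?r p) * gt p + - F (?r p) * gx p \<partial>lborel)" .
qed

section \<open>Oleinik's inequality for concave and convex fluxes\<close>

lemma continuous_on_halflineI:
  fixes g :: "real \<Rightarrow> real"
  assumes "\<And>w. 0 \<le> w \<Longrightarrow> (g has_real_derivative g' w) (at w within {0..})"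
  shows "continuous_on {0..} g"
  using assms by (auto simp: continuous_on_eq_continuous_within intro: DERIV_continuous)

lemma halfline_mvt:
  fixes g :: "real \<Rightarrow> real"
  assumes g: "\<And>w. 0 \<le> w \<Longrightarrow> (g has_real_derivative g' w) (at w within {0..})" and vw: "0 \<le> v" "v < w"
  shows "\<exists>z. v < z \<and> z < w \<and> g w - g v = (w - v) * g' z"
proof -
  have d: "(g has_real_derivative g' x) (at x)" if "v < x" for x
  proof -
    have i: "x \<in> interior {0..}" using that vw by simp
    have "0 \<le> x" using that vw by simp
    from g[OF this] show ?thesis unfolding at_within_interior[OF i] .
  qed
  have "\<exists>l z. v < z \<and> z < w \<and> (g has_real_derivative l) (at z) \<and> g w - g v = (w - v) * l"
  proof (rule MVT[OF vw(2)])
    show "continuous_on {v..w} g" by (rule continuous_on_subset[OF continuous_on_halflineI[OF g]]) (use vw in auto)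
    show "g differentiable (at x)" if "v < x" for x using d[OF that] real_differentiable_def by blast
  qed
  then show ?thesis using d DERIV_unique by blast
qed

text \<open>The cones x1 > y1 + f'(j) t and x2 < y2 + f'(k) t with rational y2 < y1 exhaust the
  pairs with x2 - x1 < (f'(k) - f'(j)) t, so countably many applications of
  \<open>disjoint_supports\<close> suffice. The speed bounds on the fluxes come from the mean value
  theorem and the monotonicity of f'.\<close>

lemma concave_oleinik:
  fixes f f' :: "real \<Rightarrow> real" and u :: "real \<times> real \<Rightarrow> real"
  assumes T: "0 < T" and u [measurable]: "u \<in> borel_measurable borel" and u0: "\<And>p. 0 \<le> u p" and uU: "\<And>p. u p \<le> U"
    and f': "\<And>w. 0 \<le> w \<Longrightarrow> (f has_real_derivative f' w) (at w within {0..})"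
    and dec: "\<And>v w. 0 \<le> v \<Longrightarrow> v < w \<Longrightarrow> f' w < f' v"
    and sub1: "\<And>k. 0 \<le> k \<Longrightarrow> subconserved T (\<lambda>p. max 0 (k - u p)) (\<lambda>p. f k - f (min (u p) k))"
    and sub2: "\<And>k. 0 \<le> k \<Longrightarrow> subconserved T (\<lambda>p. max 0 (u p - k)) (\<lambda>p. f (max (u p) k) - f k)"
    and kj: "0 \<le> k" "k < j"
  shows "AE t in lborel. 0 < t \<and> t < T \<longrightarrow> (AE x1 in lborel. AE x2 in lborel.
    0 < x2 - x1 \<and> x2 - x1 < (f' k - f' j) * t \<longrightarrow> \<not> (j < u (x1, t) \<and> u (x2, t) < k))"
proof -
  have cf: "continuous_on {0..} f" by (rule continuous_on_halflineI[OF f'])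
  note mvt = halfline_mvt[of f, OF f']
  have U0: "0 \<le> U" using u0[of 0] uU[of 0] by linarith
  have bf: "\<exists>C. \<forall>w\<in>{0..b}. \<bar>f w\<bar> \<le> C" for b
  proof -
    have "compact (f ` {0..b})" by (intro compact_continuous_image continuous_on_subset[OF cf]) auto
    then show ?thesis by (metis (no_types) bounded_real compact_imp_bounded imageI)
  qed
  obtain C where C: "\<And>w. 0 \<le> w \<Longrightarrow> w \<le> max U j \<Longrightarrow> \<bar>f w\<bar> \<le> C" using bf[of "max U j"] unfolding Ball_def atLeastAtMost_iff by blast
  define fe where "fe = (\<lambda>w. f (max 0 w))"
  have fe: "continuous_on UNIV fe" unfolding fe_def
    by (rule continuous_on_compose2[OF cf]) (auto intro!: continuous_intros)
  have [measurable]: "fe \<in> borel_measurable borel" using fe by (rule borel_measurable_continuous_onI)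
  define A B FA FB where "A = (\<lambda>p. max 0 (k - u p))" and "B = (\<lambda>p. max 0 (u p - j))"
    and "FA = (\<lambda>p. f k - f (min (u p) k))" and "FB = (\<lambda>p. f (max (u p) j) - f j)"
  have FF: "FA = (\<lambda>p. f k - fe (min (u p) k))" "FB = (\<lambda>p. fe (max (u p) j) - f j)"
    using u0 kj by (auto simp: FA_def FB_def fe_def max_def min_def)
  interpret two_fluxes T "f' j" "f' k" "max (max U j) (2 * C)" A B FA FB
  proof
    show "A \<in> borel_measurable borel" "B \<in> borel_measurable borel" unfolding A_def B_def by measurable
    show "FA \<in> borel_measurable borel" "FB \<in> borel_measurable borel" unfolding FF by measurable
    show "subconserved T A FA" "subconserved T B FB" unfolding A_def B_def FA_def FB_def using sub1[of k] sub2[of j] kj by auto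
    show "0 < T" by (rule T)
    show "f' j < f' k" using dec kj by blast
    fix p
    show "0 \<le> A p" "0 \<le> B p" by (auto simp: A_def B_def)
    show "A p \<le> max (max U j) (2 * C)" "B p \<le> max (max U j) (2 * C)"
      using u0[of p] uU[of p] kj U0 by (auto simp: A_def B_def)
    have "\<bar>f k\<bar> \<le> C" "\<bar>f j\<bar> \<le> C" "\<bar>f (min (u p) k)\<bar> \<le> C" "\<bar>f (max (u p) j)\<bar> \<le> C"
      by (rule C; use u0[of p] uU[of p] kj in force)+
    then show "\<bar>FA p\<bar> \<le> max (max U j) (2 * C)" "\<bar>FB p\<bar> \<le> max (max U j) (2 * C)"
      unfolding FA_def FB_def by linarith+
    show "A p * B p = 0" "FA p * B p = 0" "A p * FB p = 0"
      using kj by (auto simp: A_def B_def FA_def FB_def max_def min_def)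
    show "FB p \<le> f' j * B p"
    proof (cases "j < u p")
      case True
      then obtain z where z: "j < z" "f (u p) - f j = (u p - j) * f' z" using mvt[of j "u p"] kj by auto
      have "(u p - j) * f' z \<le> (u p - j) * f' j" using True dec[of j z] z kj by (intro mult_left_mono) auto
      then show ?thesis using True z by (simp add: FB_def B_def mult.commute)
    qed (simp add: FB_def B_def)
    show "f' k * A p \<le> FA p"
    proof (cases "u p < k")
      case True
      then obtain z where z: "u p < z" "z < k" "f k - f (u p) = (k - u p) * f' z" using mvt[of "u p" k] u0[of p] by auto
      have "(k - u p) * f' k \<le> (k - u p) * f' z" using True dec[of z k] z u0[of p] by (intro mult_left_mono) auto
      then show ?thesis using True z by (simp add: FA_def A_def mult.commute)
    qed (simp add: FA_def A_def)
  qed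
  define P where "P = (\<lambda>r z. 0 < r \<and> 0 < snd z \<and> snd z < T \<and> r < (f' k - f' j) * snd z \<longrightarrow> A (z + (r, 0)) * B z = 0)"
  \<comment> \<open>The final times T (1 - 1/(n + 2)) lie strictly between 0 and T, also for n = 0,
    and increase to T.\<close>
  have "AE r in lborel. 0 < r \<longrightarrow> (AE z in lborel. snd z < T * (1 - 1 / (real n + 2)) \<and> of_rat y1 < fst z - f' j * snd z \<and>
     fst z + r - f' k * snd z < of_rat y2 \<longrightarrow> A (z + (r, 0)) * B z = 0)" if "y2 < y1" for n y1 y2
  proof (rule disjoint_supports)
    have q: "0 < 1 / (real n + 2)" "1 / (real n + 2) < 1" by (auto simp: divide_less_eq)
    show "0 < T * (1 - 1 / (real n + 2))" using T q by (intro mult_pos_pos) auto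
    have "T * (1 - 1 / (real n + 2)) < T * 1" using T q by (intro mult_strict_left_mono) auto
    then show "T * (1 - 1 / (real n + 2)) < T" by simp
  qed (use that in \<open>simp add: of_rat_less\<close>)
  then have "AE r in lborel. \<forall>n y1 y2. y2 < y1 \<longrightarrow> 0 < r \<longrightarrow> (AE z in lborel. snd z < T * (1 - 1 / (real n + 2)) \<and> of_rat y1 < fst z - f' j * snd z \<and>
     fst z + r - f' k * snd z < of_rat y2 \<longrightarrow> A (z + (r, 0)) * B z = 0)"
    unfolding AE_all_countable by (intro allI) (auto intro: AE_I2 AE_mp)
  then have "AE r in lborel. AE z in lborel. P r z"
  proof (rule eventually_mono)
    fix r :: real
    assume a: "\<forall>n y1 y2. y2 < y1 \<longrightarrow> 0 < r \<longrightarrow> (AE z in lborel. snd z < T * (1 - 1 / (real n + 2)) \<and> of_rat y1 < fst z - f' j * snd z \<and>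
     fst z + r - f' k * snd z < of_rat y2 \<longrightarrow> A (z + (r, 0)) * B z = 0)"
    show "AE z in lborel. P r z"
    proof (cases "0 < r")
      case r: True
      have "AE z in lborel. \<forall>n y1 y2. y2 < y1 \<longrightarrow> snd z < T * (1 - 1 / (real n + 2)) \<and> of_rat y1 < fst z - f' j * snd z \<and>
         fst z + r - f' k * snd z < of_rat y2 \<longrightarrow> A (z + (r, 0)) * B z = 0"
        unfolding AE_all_countable using a r by (intro allI) (auto intro: AE_I2 AE_mp)
      then show ?thesis
      proof (rule eventually_mono)
        fix z :: "real \<times> real"
        assume b: "\<forall>n y1 y2. y2 < y1 \<longrightarrow> snd z < T * (1 - 1 / (real n + 2)) \<and> of_rat y1 < fst z - f' j * snd z \<and>
           fst z + r - f' k * snd z < of_rat y2 \<longrightarrow> A (z + (r, 0)) * B z = 0"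
        show "P r z"
          unfolding P_def
        proof
          assume c: "0 < r \<and> 0 < snd z \<and> snd z < T \<and> r < (f' k - f' j) * snd z"
          then have "fst z + r - f' k * snd z < fst z - f' j * snd z" by (simp add: left_diff_distrib)
          then obtain y2 where y2: "fst z + r - f' k * snd z < of_rat y2" "of_rat y2 < fst z - f' j * snd z" using of_rat_dense by blast
          then obtain y1 where y1: "of_rat y2 < (of_rat y1 :: real)" "of_rat y1 < fst z - f' j * snd z" using of_rat_dense by blast
          obtain n where n: "inverse (real (Suc n)) < (T - snd z) / T" using reals_Archimedean[of "(T - snd z) / T"] c T by auto
          have "1 / (real n + 2) \<le> inverse (real (Suc n))" by (simp add: inverse_eq_divide frac_le)
          then have "1 / (real n + 2) < (T - snd z) / T" using n by linarith
          then have "snd z < T * (1 - 1 / (real n + 2))" using T by (simp add: field_simps)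
          with b y1 y2 show "A (z + (r, 0)) * B z = 0" by (auto simp: of_rat_less)
        qed
      qed
    qed (simp add: P_def)
  qed
  \<comment> \<open>So far the distance \<open>r\<close> is quantified outermost. Measurability of
    the predicate permits exchanging the almost-everywhere quantifiers, after which time can be
    moved to the front.\<close>
  moreover have "{p \<in> space (lborel \<Otimes>\<^sub>M lborel). P (fst p) (snd p)} \<in> sets (lborel \<Otimes>\<^sub>M lborel :: (real \<times> (real \<times> real)) measure)"
  proof -
    have "(\<lambda>p. snd p + (fst p, 0)) \<in> borel_measurable (borel :: (real \<times> (real \<times> real)) measure)"
      by (intro borel_measurable_continuous_onI continuous_intros)
    note [measurable] = measurable_compose[OF this A_meas]
    show ?thesis unfolding lborel_prod P_def by measurable
  qed
  ultimately have "AE z in lborel. AE r in lborel. P r z"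
    by (subst (asm) lborel_pair.AE_commute) auto
  then have "AE t in lborel. AE x in lborel. AE r in lborel. P r (x, t)"
    by (rule AE_lborel_swap)
  then show ?thesis
  proof (rule eventually_mono, intro impI)
    fix t :: real assume a: "AE x in lborel. AE r in lborel. P r (x, t)" and t: "0 < t \<and> t < T"
    show "AE x1 in lborel. AE x2 in lborel. 0 < x2 - x1 \<and> x2 - x1 < (f' k - f' j) * t \<longrightarrow> \<not> (j < u (x1, t) \<and> u (x2, t) < k)"
      using a
    proof (rule eventually_mono)
      fix x1 :: real assume "AE r in lborel. P r (x1, t)"
      from AE_lborel_translate[OF this, of "- x1"]
      show "AE x2 in lborel. 0 < x2 - x1 \<and> x2 - x1 < (f' k - f' j) * t \<longrightarrow> \<not> (j < u (x1, t) \<and> u (x2, t) < k)"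
      proof (rule eventually_mono, intro impI)
        fix x2 assume "P (- x1 + x2) (x1, t)" "0 < x2 - x1 \<and> x2 - x1 < (f' k - f' j) * t"
        then have "A (x2, t) * B (x1, t) = 0" using t by (simp add: P_def)
        then show "\<not> (j < u (x1, t) \<and> u (x2, t) < k)" by (auto simp: A_def B_def max_def split: if_splits)
      qed
    qed
  qed
qed

text \<open>The sign \<open>sg\<close> is 1 for a concave and -1 for a convex flux. In the second
  case the concave statement is applied to u(-x, t), which has the concave flux -f.\<close>

lemma oleinik:
  fixes f f' :: "real \<Rightarrow> real" and u :: "real \<times> real \<Rightarrow> real"
  assumes sg: "sg = 1 \<or> sg = - 1"
    and T: "0 < T" and u [measurable]: "u \<in> borel_measurable borel" and u0: "\<And>p. 0 \<le> u p" and uU: "\<And>p. u p \<le> U"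
    and f': "\<And>w. 0 \<le> w \<Longrightarrow> (f has_real_derivative f' w) (at w within {0..})"
    and dec: "\<And>v w. 0 \<le> v \<Longrightarrow> v < w \<Longrightarrow> sg * f' w < sg * f' v"
    and sub1: "\<And>k. 0 \<le> k \<Longrightarrow> subconserved T (\<lambda>p. max 0 (k - u p)) (\<lambda>p. f k - f (min (u p) k))"
    and sub2: "\<And>k. 0 \<le> k \<Longrightarrow> subconserved T (\<lambda>p. max 0 (u p - k)) (\<lambda>p. f (max (u p) k) - f k)"
    and kj: "0 \<le> k" "k < j"
  shows "AE t in lborel. 0 < t \<and> t < T \<longrightarrow> (AE x1 in lborel. AE x2 in lborel.
    0 < sg * (x2 - x1) \<and> sg * (x2 - x1) < sg * (f' k - f' j) * t \<longrightarrow> \<not> (j < u (x1, t) \<and> u (x2, t) < k))"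
proof (cases "sg = 1")
  case True
  then show ?thesis using concave_oleinik[OF T u u0 uU f' _ sub1 sub2 kj] dec by simp
next
  case False
  with sg have sg: "sg = - 1" by simp
  have cf: "continuous_on {0..} f" by (rule continuous_on_halflineI[OF f'])
  define fe where "fe = (\<lambda>w. f (max 0 w))"
  have fe: "continuous_on UNIV fe" unfolding fe_def
    by (rule continuous_on_compose2[OF cf]) (auto intro!: continuous_intros)
  have [measurable]: "fe \<in> borel_measurable borel" using fe by (rule borel_measurable_continuous_onI)
  have r: "(\<lambda>p::real\<times>real. (- fst p, snd p)) \<in> borel \<rightarrow>\<^sub>M borel"
    by (intro borel_measurable_continuous_onI continuous_intros)
  have "AE t in lborel. 0 < t \<and> t < T \<longrightarrow> (AE x1 in lborel. AE x2 in lborel.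
    0 < x2 - x1 \<and> x2 - x1 < ((\<lambda>w. - f' w) k - (\<lambda>w. - f' w) j) * t \<longrightarrow>
    \<not> (j < (\<lambda>p. u (- fst p, snd p)) (x1, t) \<and> (\<lambda>p. u (- fst p, snd p)) (x2, t) < k))"
  proof (rule concave_oleinik[where f = "\<lambda>w. - f w", OF T _ _ _ _ _ _ _ kj])
    show "(\<lambda>p. u (- fst p, snd p)) \<in> borel_measurable borel" by (rule measurable_compose[OF r u])
    show "0 \<le> u (- fst p, snd p)" "u (- fst p, snd p) \<le> U" for p by (rule u0, rule uU)
    show "((\<lambda>w. - f w) has_real_derivative - f' w) (at w within {0..})" if "0 \<le> w" for w
      using f'[OF that] by (rule DERIV_minus)
    show "- f' w < - f' v" if "0 \<le> v" "v < w" for v w using dec[OF that] sg by simp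
    fix k :: real assume k: "0 \<le> k"
    have FF: "(\<lambda>p. f k - f (min (u p) k)) = (\<lambda>p. f k - fe (min (u p) k))" "(\<lambda>p. f (max (u p) k) - f k) = (\<lambda>p. fe (max (u p) k) - f k)"
      using u0 k by (auto simp: fe_def max_def min_def)
    have "subconserved T (\<lambda>p. max 0 (k - u (- fst p, snd p))) (\<lambda>p. - (f k - f (min (u (- fst p, snd p)) k)))"
      by (rule subconserved_reflect[OF sub1[OF k]]) (simp_all add: FF)
    then show "subconserved T (\<lambda>p. max 0 (k - u (- fst p, snd p))) (\<lambda>p. - f k - (- f (min (u (- fst p, snd p)) k)))"
      by simp
    have "subconserved T (\<lambda>p. max 0 (u (- fst p, snd p) - k)) (\<lambda>p. - (f (max (u (- fst p, snd p)) k) - f k))"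
      by (rule subconserved_reflect[OF sub2[OF k]]) (simp_all add: FF)
    then show "subconserved T (\<lambda>p. max 0 (u (- fst p, snd p) - k)) (\<lambda>p. - f (max (u (- fst p, snd p)) k) - (- f k))"
      by simp
  qed
  then show ?thesis
  proof (rule eventually_mono, intro impI)
    fix t assume "0 < t \<and> t < T" and a: "0 < t \<and> t < T \<longrightarrow> (AE x1 in lborel. AE x2 in lborel.
    0 < x2 - x1 \<and> x2 - x1 < ((\<lambda>w. - f' w) k - (\<lambda>w. - f' w) j) * t \<longrightarrow>
    \<not> (j < (\<lambda>p. u (- fst p, snd p)) (x1, t) \<and> (\<lambda>p. u (- fst p, snd p)) (x2, t) < k))"
    then have "AE x1 in lborel. AE x2 in lborel. 0 < x2 - x1 \<and> x2 - x1 < (- f' k + f' j) * t \<longrightarrow> \<not> (j < u (- x1, t) \<and> u (- x2, t) < k)"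
      by simp
    from AE_lborel_uminus[OF this]
    show "AE x1 in lborel. AE x2 in lborel. 0 < sg * (x2 - x1) \<and> sg * (x2 - x1) < sg * (f' k - f' j) * t \<longrightarrow> \<not> (j < u (x1, t) \<and> u (x2, t) < k)"
    proof (rule eventually_mono)
      fix x1 assume "AE x2 in lborel. 0 < x2 - (- x1) \<and> x2 - (- x1) < (- f' k + f' j) * t \<longrightarrow> \<not> (j < u (- (- x1), t) \<and> u (- x2, t) < k)"
      from AE_lborel_uminus[OF this]
      show "AE x2 in lborel. 0 < sg * (x2 - x1) \<and> sg * (x2 - x1) < sg * (f' k - f' j) * t \<longrightarrow> \<not> (j < u (x1, t) \<and> u (x2, t) < k)"
        by (rule AE_mp) (auto intro!: AE_I2 simp: sg)
    qed
  qed
qed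

section \<open>Kruzkov entropies\<close>

text \<open>Solutions are Lebesgue measurable only. Passing to a Borel representative on the plane
  makes product measures and changes of variables available.\<close>

lemma integral_lebesgue_on_eq_lborel:
  fixes f h :: "'a::euclidean_space \<Rightarrow> real"
  assumes S: "S \<in> sets borel" and [measurable]: "h \<in> borel_measurable borel"
    and eq: "AE p in lborel. p \<in> S \<longrightarrow> f p = h p" and z: "\<And>p. p \<notin> S \<Longrightarrow> h p = 0"
    and f: "f \<in> borel_measurable (lebesgue_on S)"
  shows "(\<integral>p. f p \<partial>lebesgue_on S) = (\<integral>p. h p \<partial>lborel)"
proof -
  have SL: "S \<in> sets lebesgue" using S by simp
  have "(\<integral>p. f p \<partial>lebesgue_on S) = (\<integral>p. indicator S p *\<^sub>R f p \<partial>lebesgue)"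
    by (rule integral_restrict_space) (use SL in simp)
  also have "\<dots> = (\<integral>p. h p \<partial>lebesgue)"
  proof (rule integral_cong_AE)
    have "(\<lambda>p. if p \<in> S then f p else 0) \<in> borel_measurable lebesgue"
      using f SL by (simp add: borel_measurable_if)
    also have "(\<lambda>p. if p \<in> S then f p else 0) = (\<lambda>p. indicator S p *\<^sub>R f p)" by (auto simp: indicator_def)
    finally show "(\<lambda>p. indicator S p *\<^sub>R f p) \<in> borel_measurable lebesgue" .
    show "h \<in> borel_measurable lebesgue" by (intro measurable_completion) simp
    have "AE p in lborel. indicator S p *\<^sub>R f p = h p"
      using eq by (rule eventually_mono) (use z in \<open>auto simp: indicator_def\<close>)
    then show "AE p in lebesgue. indicator S p *\<^sub>R f p = h p" by (rule AE_completion)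
  qed
  also have "\<dots> = (\<integral>p. h p \<partial>lborel)" by (rule integral_completion) simp
  finally show ?thesis .
qed

lemma integrable_lebesgue_on_interval:
  fixes g h :: "real \<Rightarrow> real"
  assumes [measurable]: "h \<in> borel_measurable borel" and eq: "\<And>w. 0 \<le> w \<Longrightarrow> g w = h w"
    and bd: "\<And>w. 0 \<le> w \<Longrightarrow> w \<le> b \<Longrightarrow> \<bar>h w\<bar> \<le> C"
  shows "integrable (lebesgue_on {0..b}) g"
proof -
  have "integrable lborel (\<lambda>w. C * indicator {0..b} w :: real)"
    by (intro integrable_mult_right integrable_real_indicator) (auto simp: emeasure_lborel_Icc_eq)
  then have "integrable lborel (\<lambda>w. indicator {0..b} w *\<^sub>R h w)"
  proof (rule Bochner_Integration.integrable_bound)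
    show "AE w in lborel. norm (indicator {0..b} w *\<^sub>R h w) \<le> norm (C * indicator {0..b} w)"
      using bd by (intro AE_I2) (force simp: indicator_def)
  qed simp
  then have "integrable lebesgue (\<lambda>w. indicator {0..b} w *\<^sub>R h w)"
    by (subst integrable_completion) simp_all
  then have "integrable (lebesgue_on {0..b}) h"
    by (subst integrable_restrict_space) simp_all
  then show ?thesis
    by (rule Bochner_Integration.integrable_cong[THEN iffD1, rotated -1]) (use eq in auto)
qed

text \<open>The fundamental theorem of calculus with finitely many exceptional points, enough for
  the corner of a Kruzkov entropy. \<open>h\<close> is a Borel substitute for \<open>g\<close>,
  whose values at negative arguments are arbitrary.\<close>

lemma has_ae_derivativeI:
  fixes f g h :: "real \<Rightarrow> real"
  assumes cf: "continuous_on {0..} f" and S: "finite S"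
    and d: "\<And>w. 0 < w \<Longrightarrow> w \<notin> S \<Longrightarrow> (f has_real_derivative g w) (at w)"
    and h: "h \<in> borel_measurable borel" and eq: "\<And>w. 0 \<le> w \<Longrightarrow> g w = h w"
    and bd: "\<And>b. \<exists>C. \<forall>w\<in>{0..b}. \<bar>h w\<bar> \<le> C"
  shows "has_ae_derivative f g"
  unfolding has_ae_derivative_def
proof (intro allI impI conjI)
  fix b :: real assume b: "0 \<le> b"
  obtain C where C: "\<forall>w\<in>{0..b}. \<bar>h w\<bar> \<le> C" using bd by blast
  show i: "integrable (lebesgue_on {0..b}) g"
    by (rule integrable_lebesgue_on_interval[OF h eq, of b C]) (use C in auto)
  have "(g has_integral f b - f 0) {0..b}"
  proof (rule fundamental_theorem_of_calculus_interior_strong[OF S b])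
    show "continuous_on {0..b} f" by (rule continuous_on_subset[OF cf]) auto
    show "(f has_vector_derivative g x) (at x)" if "x \<in> {0<..<b} - S" for x
      using d[of x] that by (simp add: has_real_derivative_iff_has_vector_derivative)
  qed
  then have "integral {0..b} g = f b - f 0" by (rule integral_unique)
  moreover have "(\<integral>u. g u \<partial>lebesgue_on {0..b}) = integral {0..b} g"
    by (rule lebesgue_integral_eq_integral[OF i]) simp
  ultimately show "f b - f 0 = (\<integral>u. g u \<partial>lebesgue_on {0..b})" by simp
qed

lemma convex_on_max_0:
  fixes f :: "real \<Rightarrow> real"
  assumes "convex_on S f" shows "convex_on S (\<lambda>w. max 0 (f w))"
  unfolding convex_on_def
proof (intro conjI ballI allI impI)
  show "convex S" using assms by (simp add: convex_on_def)
  fix x y u v :: real assume *: "0 \<le> u" "0 \<le> v" "u + v = 1" and xy: "x \<in> S" "y \<in> S"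
  have "f (u *\<^sub>R x + v *\<^sub>R y) \<le> u * f x + v * f y" using assms * xy unfolding convex_on_def by blast
  also have "\<dots> \<le> u * max 0 (f x) + v * max 0 (f y)" using * by (intro add_mono mult_left_mono) auto
  finally show "max 0 (f (u *\<^sub>R x + v *\<^sub>R y)) \<le> u * max 0 (f x) + v * max 0 (f y)" using * by simp
qed

text \<open>\<open>fe\<close> replaces \<open>f\<close> since the values of \<open>f\<close> at negative arguments are arbitrary.\<close>

locale halfline_C1 =
  fixes f :: "real \<Rightarrow> real"
  assumes f_deriv: "\<And>w. 0 \<le> w \<Longrightarrow> (f has_real_derivative hderiv f w) (at w within {0..})"
    and f'_cont: "continuous_on {0..} (hderiv f)"
begin

definition fe :: "real \<Rightarrow> real" where "fe w = f (max 0 w)"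
definition fe' :: "real \<Rightarrow> real" where "fe' w = hderiv f (max 0 w)"

lemma f_cont: "continuous_on {0..} f"
  by (rule continuous_on_halflineI[OF f_deriv])

lemma fe_cont: "continuous_on S fe" "continuous_on S fe'"
  unfolding fe_def fe'_def
  by (rule continuous_on_compose2[OF f_cont] continuous_on_compose2[OF f'_cont]; force intro!: continuous_intros)+

lemma fe_meas [measurable]: "fe \<in> borel_measurable borel" "fe' \<in> borel_measurable borel"
  using fe_cont by (auto intro: borel_measurable_continuous_onI)

lemma fe_eq: "0 \<le> w \<Longrightarrow> fe w = f w" "0 \<le> w \<Longrightarrow> fe' w = hderiv f w"
  by (simp_all add: fe_def fe'_def)

lemma fe_deriv: "0 < w \<Longrightarrow> (fe has_real_derivative hderiv f w) (at w)"
proof -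
  assume w: "0 < w"
  then have "w \<in> interior {0..}" by simp
  from at_within_interior[OF this] have "(f has_real_derivative hderiv f w) (at w)"
    using f_deriv[of w] w by (metis less_eq_real_def)
  then show ?thesis
    by (rule has_field_derivative_transform_within_open[where S = "{0<..}"]) (use w in \<open>auto simp: fe_def\<close>)
qed

lemma fe'_bounded: "\<exists>C. \<forall>w\<in>{0..b}. \<bar>fe' w\<bar> \<le> C"
proof -
  have "compact (fe' ` {0..b})" by (intro compact_continuous_image fe_cont) auto
  then show ?thesis by (metis (no_types) bounded_real compact_imp_bounded imageI)
qed

text \<open>The flux is determined up to a constant; the constant is chosen so that it vanishes for
  w \<ge> k, together with the entropy. The disjointness required in \<open>two_fluxes\<close> rests
  on this choice.\<close>

lemma entropy_pair_below:
  assumes k: "0 \<le> k"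
  shows "convex_on {0..} (\<lambda>w. max 0 (k - w))"
    "has_ae_derivative (\<lambda>w. max 0 (k - w)) (\<lambda>w. if w < k then - 1 else 0)"
    "has_ae_derivative (\<lambda>w. f k - fe (min w k)) (\<lambda>w. (if w < k then - 1 else 0) * hderiv f w)"
proof -
  show "convex_on {0..} (\<lambda>w. max 0 (k - w))"
    by (rule convex_on_max_0) (auto simp: convex_on_def algebra_simps simp flip: distrib_right)
  show "has_ae_derivative (\<lambda>w. max 0 (k - w)) (\<lambda>w. if w < k then - 1 else 0)"
  proof (rule has_ae_derivativeI[where S = "{k}"])
    fix w :: real assume w: "0 < w" "w \<notin> {k}"
    show "((\<lambda>w. max 0 (k - w)) has_real_derivative (if w < k then - 1 else 0)) (at w)"
    proof (cases "w < k")
      case True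
      have "((\<lambda>w. k - w) has_real_derivative - 1) (at w)" by (auto intro!: derivative_eq_intros)
      then have "((\<lambda>w. max 0 (k - w)) has_real_derivative - 1) (at w)"
        by (rule has_field_derivative_transform_within_open[where S = "{..<k}"]) (use True in auto)
      then show ?thesis using True by simp
    next
      case False
      have "((\<lambda>w. max 0 (k - w)) has_real_derivative 0) (at w)"
        by (rule has_field_derivative_transform_within_open[OF DERIV_const, where S = "{k<..}"]) (use False w in auto)
      then show ?thesis using False by simp
    qed
  qed (auto intro!: continuous_intros exI[of _ 1])
  show "has_ae_derivative (\<lambda>w. f k - fe (min w k)) (\<lambda>w. (if w < k then - 1 else 0) * hderiv f w)"
  proof (rule has_ae_derivativeI[where S = "{k}" and h = "\<lambda>w. (if w < k then - 1 else 0) * fe' w"])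
    fix w :: real assume w: "0 < w" "w \<notin> {k}"
    show "((\<lambda>w. f k - fe (min w k)) has_real_derivative (if w < k then - 1 else 0) * hderiv f w) (at w)"
    proof (cases "w < k")
      case True
      have "((\<lambda>w. f k - fe w) has_real_derivative 0 - hderiv f w) (at w)"
        by (rule DERIV_diff[OF DERIV_const fe_deriv[OF w(1)]])
      then have "((\<lambda>w. f k - fe (min w k)) has_real_derivative 0 - hderiv f w) (at w)"
        by (rule has_field_derivative_transform_within_open[where S = "{..<k}"]) (use True in auto)
      then show ?thesis using True by simp
    next
      case False
      have "((\<lambda>w. f k - fe (min w k)) has_real_derivative 0) (at w)"
        by (rule has_field_derivative_transform_within_open[OF DERIV_const, where S = "{k<..}"]) (use False w in auto)
      then show ?thesis using False by simp
    qed
  next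
    show "\<exists>C. \<forall>w\<in>{0..b}. \<bar>(if w < k then - 1 else 0) * fe' w\<bar> \<le> C" for b
    proof -
      obtain C where "\<forall>w\<in>{0..b}. \<bar>fe' w\<bar> \<le> C" using fe'_bounded by blast
      then show ?thesis by (intro exI[of _ "\<bar>C\<bar>"]) force
    qed
    show "continuous_on {0..} (\<lambda>w. f k - fe (min w k))"
      by (intro continuous_intros continuous_on_compose2[OF fe_cont(1)[of UNIV]]) auto
  qed (auto simp: fe_eq)
qed

lemma entropy_pair_above:
  assumes k: "0 \<le> k"
  shows "convex_on {0..} (\<lambda>w. max 0 (w - k))"
    "has_ae_derivative (\<lambda>w. max 0 (w - k)) (\<lambda>w. if k < w then 1 else 0)"
    "has_ae_derivative (\<lambda>w. fe (max w k) - f k) (\<lambda>w. (if k < w then 1 else 0) * hderiv f w)"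
proof -
  show "convex_on {0..} (\<lambda>w. max 0 (w - k))"
    by (rule convex_on_max_0) (auto simp: convex_on_def algebra_simps simp flip: distrib_right)
  show "has_ae_derivative (\<lambda>w. max 0 (w - k)) (\<lambda>w. if k < w then 1 else 0)"
  proof (rule has_ae_derivativeI[where S = "{k}"])
    fix w :: real assume w: "0 < w" "w \<notin> {k}"
    show "((\<lambda>w. max 0 (w - k)) has_real_derivative (if k < w then 1 else 0)) (at w)"
    proof (cases "k < w")
      case True
      have "((\<lambda>w. w - k) has_real_derivative 1) (at w)" by (auto intro!: derivative_eq_intros)
      then have "((\<lambda>w. max 0 (w - k)) has_real_derivative 1) (at w)"
        by (rule has_field_derivative_transform_within_open[where S = "{k<..}"]) (use True in auto)
      then show ?thesis using True by simp
    next
      case False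
      have "((\<lambda>w. max 0 (w - k)) has_real_derivative 0) (at w)"
        by (rule has_field_derivative_transform_within_open[OF DERIV_const, where S = "{..<k}"]) (use False w in auto)
      then show ?thesis using False by simp
    qed
  qed (auto intro!: continuous_intros exI[of _ 1])
  show "has_ae_derivative (\<lambda>w. fe (max w k) - f k) (\<lambda>w. (if k < w then 1 else 0) * hderiv f w)"
  proof (rule has_ae_derivativeI[where S = "{k}" and h = "\<lambda>w. (if k < w then 1 else 0) * fe' w"])
    fix w :: real assume w: "0 < w" "w \<notin> {k}"
    show "((\<lambda>w. fe (max w k) - f k) has_real_derivative (if k < w then 1 else 0) * hderiv f w) (at w)"
    proof (cases "k < w")
      case True
      have "((\<lambda>w. fe w - f k) has_real_derivative hderiv f w - 0) (at w)"
        by (rule DERIV_diff[OF fe_deriv[OF w(1)] DERIV_const])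
      then have "((\<lambda>w. fe (max w k) - f k) has_real_derivative hderiv f w - 0) (at w)"
        by (rule has_field_derivative_transform_within_open[where S = "{k<..}"]) (use True in auto)
      then show ?thesis using True by simp
    next
      case False
      have "((\<lambda>w. fe (max w k) - f k) has_real_derivative 0) (at w)"
        by (rule has_field_derivative_transform_within_open[OF DERIV_const, where S = "{..<k}"]) (use False w in auto)
      then show ?thesis using False by simp
    qed
  next
    show "\<exists>C. \<forall>w\<in>{0..b}. \<bar>(if k < w then 1 else 0) * fe' w\<bar> \<le> C" for b
    proof -
      obtain C where "\<forall>w\<in>{0..b}. \<bar>fe' w\<bar> \<le> C" using fe'_bounded by blast
      then show ?thesis by (intro exI[of _ "\<bar>C\<bar>"]) force
    qed
    show "continuous_on {0..} (\<lambda>w. fe (max w k) - f k)"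
      by (intro continuous_intros continuous_on_compose2[OF fe_cont(1)[of UNIV]]) auto
  qed (auto simp: fe_eq)
qed

text \<open>Linear functions are convex for either sign of \<open>s\<close>, and the two resulting
  inequalities together are the conservation law itself.\<close>

lemma entropy_pair_linear:
  shows "convex_on {0..} (\<lambda>w. s * w)" "has_ae_derivative (\<lambda>w. s * w) (\<lambda>_. s)"
    "has_ae_derivative (\<lambda>w. s * fe w) (\<lambda>w. s * hderiv f w)"
proof -
  show "convex_on {0..} (\<lambda>w. s * w)" by (auto simp: convex_on_def algebra_simps)
  show "has_ae_derivative (\<lambda>w. s * w) (\<lambda>_. s)"
    by (rule has_ae_derivativeI[where S = "{}"]) (auto intro!: continuous_intros derivative_eq_intros exI[of _ "\<bar>s\<bar>"])
  show "has_ae_derivative (\<lambda>w. s * fe w) (\<lambda>w. s * hderiv f w)"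
  proof (rule has_ae_derivativeI[where S = "{}" and h = "\<lambda>w. s * fe' w"])
    show "((\<lambda>w. s * fe w) has_real_derivative s * hderiv f w) (at w)" if "0 < w" for w
      by (rule DERIV_cmult[OF fe_deriv[OF that]])
    show "\<exists>C. \<forall>w\<in>{0..b}. \<bar>s * fe' w\<bar> \<le> C" for b
    proof -
      obtain C where "\<forall>w\<in>{0..b}. \<bar>fe' w\<bar> \<le> C" using fe'_bounded by blast
      then show ?thesis by (intro exI[of _ "\<bar>s\<bar> * C"]) (auto simp: abs_mult intro: mult_left_mono)
    qed
    show "continuous_on {0..} (\<lambda>w. s * fe w)" by (intro continuous_intros fe_cont)
  qed (auto simp: fe_eq)
qed

text \<open>A Borel representative, truncated to values in [0, |U|], satisfies the bounds everywhere
  and leaves all integrals unchanged. The initial datum disappears because the tests vanish at t =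
  0.\<close>

lemma kruzkov_borel_version:
  assumes K: "kruzkov_solution T f v0 v"
  obtains u U where "u \<in> borel_measurable borel" "\<And>p. 0 \<le> u p" "\<And>p. u p \<le> U"
    "AE p in lborel. p \<in> strip T \<longrightarrow> v p = u p" "v \<in> borel_measurable (lebesgue_on (strip T))"
    "\<And>k. 0 \<le> k \<Longrightarrow> subconserved T (\<lambda>p. max 0 (k - u p)) (\<lambda>p. f k - f (min (u p) k))"
    "\<And>k. 0 \<le> k \<Longrightarrow> subconserved T (\<lambda>p. max 0 (u p - k)) (\<lambda>p. f (max (u p) k) - f k)"
    "\<And>s. subconserved T (\<lambda>p. s * u p) (\<lambda>p. s * f (u p))"
proof -
  have SB: "strip T \<in> sets borel" by (simp add: strip_def borel_open open_Times)
  then have SL: "strip T \<in> sets lebesgue" by simp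
  obtain U where vm: "v \<in> borel_measurable (lebesgue_on (strip T))" and vU: "AE p in lebesgue_on (strip T). \<bar>v p\<bar> \<le> U"
    using K unfolding kruzkov_solution_def Linf_def by blast
  have v0: "AE p in lebesgue_on (strip T). 0 \<le> v p" using K unfolding kruzkov_solution_def by blast
  have "(\<lambda>p. if p \<in> strip T then v p else 0) \<in> borel_measurable lebesgue" using vm SL by (simp add: borel_measurable_if)
  then obtain w where w [measurable]: "w \<in> borel_measurable lborel" and wv: "AE p in lborel. (if p \<in> strip T then v p else 0) = w p"
    using completion_ex_borel_measurable_real by blast
  define u where "u p = max 0 (min \<bar>U\<bar> (w p))" for p
  have um [measurable]: "u \<in> borel_measurable borel" unfolding u_def using w by simp
  have u0: "0 \<le> u p" and uU: "u p \<le> \<bar>U\<bar>" for p by (auto simp: u_def)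
  have "AE p in lborel. p \<in> strip T \<longrightarrow> \<bar>v p\<bar> \<le> U" "AE p in lborel. p \<in> strip T \<longrightarrow> 0 \<le> v p"
    using vU v0 SL by (simp_all add: AE_restrict_space_iff AE_completion_iff)
  then have uv: "AE p in lborel. p \<in> strip T \<longrightarrow> v p = u p"
    using wv by eventually_elim (auto simp: u_def)
  have main: "subconserved T (\<lambda>p. E (u p)) (\<lambda>p. F (u p))"
    if c: "convex_on {0..} E" and E: "has_ae_derivative E E'" and F: "has_ae_derivative F (\<lambda>w. E' w * hderiv f w)"
      and m [measurable]: "E \<in> borel_measurable borel" "F \<in> borel_measurable borel" for E E' F
    unfolding subconserved_def
  proof (intro allI impI, elim conjE)
    fix g gt gx assume t: "test_fn T g gt gx" and g0: "\<forall>p. 0 \<le> g p"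
    obtain G where G: "G \<subseteq> strip T" "\<And>p. p \<notin> G \<Longrightarrow> gt p = 0 \<and> gx p = 0"
      using test_fn_test_function(4)[OF t] by blast
    have [measurable]: "gt \<in> borel_measurable borel" "gx \<in> borel_measurable borel"
      using test_fn_test_function(5,6)[OF t] by (auto intro: borel_measurable_continuous_onI)
    have "- (\<integral>x. E (v0 x) * g (x, 0) \<partial>lebesgue) \<le> (\<integral>p. E (v p) * gt p + F (v p) * gx p \<partial>lebesgue_on (strip T))"
      using K t g0 test_fn_test_function(1,3)[OF t] c E F unfolding kruzkov_solution_def by blast
    also have "(\<integral>p. E (v p) * gt p + F (v p) * gx p \<partial>lebesgue_on (strip T)) = (\<integral>p. E (u p) * gt p + F (u p) * gx p \<partial>lborel)"
    proof (rule integral_lebesgue_on_eq_lborel[OF SB])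
      show "AE p in lborel. p \<in> strip T \<longrightarrow> E (v p) * gt p + F (v p) * gx p = E (u p) * gt p + F (u p) * gx p"
        using uv by eventually_elim auto
      show "E (u p) * gt p + F (u p) * gx p = 0" if "p \<notin> strip T" for p
      proof -
        have "p \<notin> G" using that G(1) by blast
        then show ?thesis using G(2)[of p] by simp
      qed
      have "gt \<in> borel_measurable (lebesgue_on (strip T))" "gx \<in> borel_measurable (lebesgue_on (strip T))"
        by (intro measurable_restrict_space1 measurable_completion; simp)+
      then show "(\<lambda>p. E (v p) * gt p + F (v p) * gx p) \<in> borel_measurable (lebesgue_on (strip T))"
        using measurable_compose[OF vm m(1)] measurable_compose[OF vm m(2)] by simp
    qed simp
    finally show "0 \<le> (\<integral>p. E (u p) * gt p + F (u p) * gx p \<partial>lborel)"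
      using test_fn_test_function(2)[OF t] by simp
  qed
  show ?thesis
  proof (rule that[OF um u0 uU uv vm])
    fix k :: real assume k: "0 \<le> k"
    have "subconserved T (\<lambda>p. max 0 (k - u p)) (\<lambda>p. f k - fe (min (u p) k))"
      by (rule main[OF entropy_pair_below[OF k]]) measurable
    then show "subconserved T (\<lambda>p. max 0 (k - u p)) (\<lambda>p. f k - f (min (u p) k))"
      using k u0 by (simp add: fe_def)
    have "subconserved T (\<lambda>p. max 0 (u p - k)) (\<lambda>p. fe (max (u p) k) - f k)"
      by (rule main[OF entropy_pair_above[OF k]]) measurable
    then show "subconserved T (\<lambda>p. max 0 (u p - k)) (\<lambda>p. f (max (u p) k) - f k)"
      using k u0 by (simp add: fe_def)
  next
    fix s
    have "subconserved T (\<lambda>p. s * u p) (\<lambda>p. s * fe (u p))"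
      by (rule main[OF entropy_pair_linear]) measurable
    then show "subconserved T (\<lambda>p. s * u p) (\<lambda>p. s * f (u p))"
      using u0 by (simp add: fe_def)
  qed
qed

end

section \<open>Decomposition and comparison of measures\<close>

text \<open>The singular part is the restriction of \<open>mu\<close> to an \<open>M\<close>-null
  set \<open>Z\<close> of largest possible \<open>mu\<close>-measure, a union of nearly maximal null
  sets. Any null set charged by \<open>mu\<close> outside \<open>Z\<close> would enlarge it, so the
  rest is absolutely continuous.\<close>

lemma lebesgue_decomposition_exists:
  assumes fin: "finite_measure mu" and s: "sets mu = sets M"
  shows "\<exists>a b. lebesgue_decomposition M mu a b"
proof -
  interpret finite_measure mu by (rule fin)
  define S where "S = measure mu ` null_sets M"
  have ne: "S \<noteq> {}" unfolding S_def by blast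
  have bdd: "bdd_above S" unfolding S_def by (rule bdd_aboveI[where M = "measure mu (space mu)"]) (auto simp: bounded_measure)
  have "\<exists>N\<in>null_sets M. Sup S - 1 / Suc n < measure mu N" for n
    using less_cSup_iff[OF ne bdd, of "Sup S - 1 / Suc n"] by (auto simp: S_def)
  then obtain N where N: "\<And>n. N n \<in> null_sets M" "\<And>n. Sup S - 1 / Suc n < measure mu (N n)" by metis
  define Z where "Z = (\<Union>n. N n)"
  have Z: "Z \<in> null_sets M" unfolding Z_def using N(1) by (intro null_sets_UN) auto
  have Zs: "Z \<in> sets M" "Z \<in> sets mu" using Z s by auto
  have "Sup S \<le> measure mu Z"
  proof (rule field_le_epsilon)
    fix e :: real assume "0 < e"
    then obtain n where n: "1 / Suc n < e" using reals_Archimedean[of e] by (auto simp: inverse_eq_divide)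
    have "measure mu (N n) \<le> measure mu Z" using Zs by (intro finite_measure_mono) (auto simp: Z_def)
    then show "Sup S \<le> measure mu Z + e" using N(2)[of n] n by linarith
  qed
  have max: "emeasure mu (A - Z) = 0" if A: "A \<in> null_sets M" for A
  proof -
    have AZ: "A \<union> Z \<in> null_sets M" using A Z by auto
    then have "measure mu (A \<union> Z) \<le> Sup S" using bdd by (intro cSup_upper) (auto simp: S_def)
    also have "\<dots> \<le> measure mu Z" by fact
    finally have "measure mu (A \<union> Z) \<le> measure mu Z" .
    moreover have "measure mu (A \<union> Z) = measure mu Z + measure mu (A - Z)"
      using A Zs s by (intro finite_measure_Union'[of Z "A", simplified Un_commute]) auto
    ultimately show ?thesis by (simp add: emeasure_eq_measure measure_le_0_iff)
  qed
  define a where "a = density mu (indicator (space M - Z))"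
  define b where "b = density mu (indicator Z)"
  have sp: "space mu = space M" using s by (rule sets_eq_imp_space_eq)
  have em: "emeasure a A = emeasure mu (A - Z)" "emeasure b A = emeasure mu (A \<inter> Z)" if "A \<in> sets M" for A
  proof -
    have "(space M - Z) \<inter> A = A - Z" using that sets.sets_into_space by blast
    then show "emeasure a A = emeasure mu (A - Z)"
      unfolding a_def using that Zs s sp by (subst emeasure_restricted) auto
    show "emeasure b A = emeasure mu (A \<inter> Z)"
      unfolding b_def using that Zs s by (subst emeasure_restricted) (auto simp: Int_commute)
  qed
  have "lebesgue_decomposition M mu a b"
    unfolding lebesgue_decomposition_def
  proof (intro conjI ballI)
    show "sets a = sets M" "sets b = sets M" by (simp_all add: a_def b_def s)
    show "absolutely_continuous M a"
      unfolding absolutely_continuous_def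
    proof
      fix A assume A: "A \<in> null_sets M"
      then show "A \<in> null_sets a" using em(1)[of A] max[OF A] by (auto simp: null_sets_def a_def s)
    qed
    show "mutually_singular M b"
      unfolding mutually_singular_def
      by (rule bexI[of _ Z]) (use Z Zs em(2)[of "space M - Z"] in \<open>auto simp: Diff_Int_distrib2\<close>)
    fix A assume A: "A \<in> sets M"
    have "emeasure mu A = emeasure mu (A - Z) + emeasure mu (A \<inter> Z)"
      using A Zs s by (subst plus_emeasure) (auto intro!: arg_cong[where f = "emeasure mu"])
    then show "emeasure mu A = emeasure a A + emeasure b A" using em[OF A] by simp
  qed
  then show ?thesis by blast
qed

lemma lebesgue_decomposition_null_set:
  assumes "lebesgue_decomposition M mu a b"
  obtains Z where "Z \<in> null_sets M" "\<And>A. A \<in> sets M \<Longrightarrow> emeasure b (A - Z) = 0"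
proof -
  have sb: "sets b = sets M" using assms by (simp add: lebesgue_decomposition_def)
  obtain Z where Z: "Z \<in> sets M" "emeasure M Z = 0" "emeasure b (space M - Z) = 0"
    using assms unfolding lebesgue_decomposition_def mutually_singular_def by blast
  show ?thesis
  proof (rule that)
    show "Z \<in> null_sets M" using Z by auto
    fix A assume A: "A \<in> sets M"
    then have "emeasure b (A - Z) \<le> emeasure b (space M - Z)"
      using Z sb sets.sets_into_space[OF A] by (intro emeasure_mono) auto
    then show "emeasure b (A - Z) = 0" using Z by simp
  qed
qed

text \<open>Every null set \<open>Z\<close> carrying \<open>b\<close> recovers both parts from
  \<open>mu\<close> alone. Uniqueness follows, since the union of two such sets serves two
  decompositions at once.\<close>

lemma lebesgue_decomposition_formula:
  assumes D: "lebesgue_decomposition M mu a b" and Z: "Z \<in> null_sets M" "\<And>A. A \<in> sets M \<Longrightarrow> emeasure b (A - Z) = 0"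
    and A: "A \<in> sets M"
  shows "emeasure a A = emeasure mu (A - Z)" "emeasure b A = emeasure mu (A \<inter> Z)"
proof -
  have sab: "sets a = sets M" "sets b = sets M" and ac: "absolutely_continuous M a"
    and sum: "\<And>A. A \<in> sets M \<Longrightarrow> emeasure mu A = emeasure a A + emeasure b A"
    using D by (auto simp: lebesgue_decomposition_def)
  have Zs: "Z \<in> sets M" using Z by auto
  have split: "emeasure x A = emeasure x (A - Z) + emeasure x (A \<inter> Z)" if "sets x = sets M" for x :: "'a measure"
    using A Zs that by (subst plus_emeasure) (auto intro!: arg_cong[where f = "emeasure x"])
  have "A \<inter> Z \<in> null_sets M" using A Z(1) by (rule null_set_Int1[rotated])
  then have a0: "emeasure a (A \<inter> Z) = 0" using ac by (auto simp: absolutely_continuous_def null_sets_def)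
  show "emeasure a A = emeasure mu (A - Z)" using split[OF sab(1)] a0 sum[of "A - Z"] Z(2)[OF A] A Zs by simp
  show "emeasure b A = emeasure mu (A \<inter> Z)" using split[OF sab(2)] a0 sum[of "A \<inter> Z"] Z(2)[OF A] A Zs by simp
qed

lemma lebesgue_decomposition_unique:
  assumes D: "lebesgue_decomposition M mu a b" and D': "lebesgue_decomposition M mu a' b'"
  shows "a = a'" "b = b'"
proof -
  obtain Y where Y: "Y \<in> null_sets M" "\<And>A. A \<in> sets M \<Longrightarrow> emeasure b (A - Y) = 0"
    using lebesgue_decomposition_null_set[OF D] by blast
  obtain Y' where Y': "Y' \<in> null_sets M" "\<And>A. A \<in> sets M \<Longrightarrow> emeasure b' (A - Y') = 0"
    using lebesgue_decomposition_null_set[OF D'] by blast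
  define Z where "Z = Y \<union> Y'"
  have Z: "Z \<in> null_sets M" unfolding Z_def using Y Y' by auto
  have Zb: "emeasure b (A - Z) = 0" "emeasure b' (A - Z) = 0" if "A \<in> sets M" for A
    using Y(2)[of "A - Y'"] Y'(2)[of "A - Y"] that Y(1) Y'(1) by (auto simp: Z_def Diff_Diff_Int set_diff_eq conj_commute conj_left_commute)
  note s = D[unfolded lebesgue_decomposition_def] D'[unfolded lebesgue_decomposition_def]
  show "a = a'"
    by (rule measure_eqI) (use s lebesgue_decomposition_formula(1)[OF D Z Zb(1)] lebesgue_decomposition_formula(1)[OF D' Z Zb(2)] in auto)
  show "b = b'"
    by (rule measure_eqI) (use s lebesgue_decomposition_formula(2)[OF D Z Zb(1)] lebesgue_decomposition_formula(2)[OF D' Z Zb(2)] in auto)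
qed

text \<open>Existence and uniqueness together give the definite descriptions \<open>ac_part\<close>
  and \<open>sing_part\<close> their meaning.\<close>

lemma lebesgue_decomposition_parts:
  assumes fin: "finite_measure mu" and s: "sets mu = sets M"
  shows "lebesgue_decomposition M mu (ac_part M mu) (sing_part M mu)"
proof -
  obtain a b where D: "lebesgue_decomposition M mu a b" using lebesgue_decomposition_exists[OF fin s] by blast
  have "ac_part M mu = a" unfolding ac_part_def
    by (rule the_equality) (use D lebesgue_decomposition_unique(1)[OF _ D] in blast)+
  moreover have "sing_part M mu = b" unfolding sing_part_def
    by (rule the_equality) (use D lebesgue_decomposition_unique(2)[OF _ D] in blast)+
  ultimately show ?thesis using D by simp
qed

text \<open>Let \<open>B\<close> be the part of \<open>R\<close> where the density is below some q <
  k. Off the null set carrying the singular part \<open>mu\<close> agrees with its absolutely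
  continuous part, so k times the measure of \<open>B\<close> is at most q times it. As
  \<open>R\<close> has finite measure, \<open>B\<close> is null; q then increases to k along k -
  1/(n + 1).\<close>

lemma ac_density_ge:
  assumes fin: "finite_measure mu" and s: "sets mu = sets M" and sf: "sigma_finite_measure M"
    and R: "R \<in> sets M" "emeasure M R < \<infinity>"
    and ge: "\<And>A. A \<in> sets M \<Longrightarrow> A \<subseteq> R \<Longrightarrow> ennreal k * emeasure M A \<le> emeasure mu A"
  shows "AE x in M. x \<in> R \<longrightarrow> k \<le> ac_density M mu x"
proof -
  interpret sigma_finite_measure M by (rule sf)
  define a where "a = ac_part M mu"
  have D: "lebesgue_decomposition M mu a (sing_part M mu)"
    unfolding a_def using lebesgue_decomposition_parts[OF fin s] .
  obtain Z where Z: "Z \<in> null_sets M" "\<And>A. A \<in> sets M \<Longrightarrow> emeasure (sing_part M mu) (A - Z) = 0"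
    using lebesgue_decomposition_null_set[OF D] by blast
  have sa: "sets a = sets M" and ac: "absolutely_continuous M a" using D by (auto simp: lebesgue_decomposition_def)
  define f where "f = RN_deriv M a"
  have f [measurable]: "f \<in> borel_measurable M" by (simp add: f_def)
  have df: "density M f = a" unfolding f_def by (rule density_RN_deriv[OF ac sa])
  have finA: "finite_measure a"
  proof
    have "emeasure a (space a) = emeasure mu (space M - Z)"
      using lebesgue_decomposition_formula(1)[OF D Z, of "space M"] sets_eq_imp_space_eq[OF sa] by simp
    also have "\<dots> < \<infinity>" using finite_measure.emeasure_finite[OF fin] by (simp add: less_top)
    finally show "emeasure a (space a) \<noteq> \<infinity>" by simp
  qed
  \<comment> \<open>Finiteness has to be secured because \<open>enn2real\<close> sends infinity to
    0, which would destroy a lower bound.\<close>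
  have "AE x in M. f x \<noteq> \<infinity>" unfolding f_def
  proof (rule RN_deriv_finite[OF _ ac sa])
    interpret a: finite_measure a by (rule finA)
    show "sigma_finite_measure a" by unfold_locales
  qed
  moreover have "AE x in M. x \<in> R \<longrightarrow> ennreal k \<le> f x"
  proof -
    have "AE x in M. x \<in> R \<longrightarrow> ennreal (k - 1 / Suc n) \<le> f x" for n
    proof (cases "0 < k")
      case False
      then have "ennreal (k - 1 / Suc n) = 0" 
      proof (intro ennreal_neg)
        have "0 \<le> 1 / real (Suc n)" by simp
        then show "k - 1 / real (Suc n) \<le> 0" using False by linarith
      qed
      then show ?thesis by simp
    next
      case True
      define q where "q = max 0 (k - 1 / Suc n)"
      have q: "0 \<le> q" "q < k" using True by (auto simp: q_def)
      have eq: "ennreal (k - 1 / Suc n) = ennreal q" by (simp add: q_def max_def ennreal_neg)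
      define B where "B = {x \<in> space M. f x < ennreal q} \<inter> R"
      have B: "B \<in> sets M" using R(1) unfolding B_def by measurable
      have BZ: "B - Z \<in> sets M" using B Z(1) by auto
      have "ennreal k * emeasure M (B - Z) \<le> emeasure mu (B - Z)" by (rule ge[OF BZ]) (auto simp: B_def)
      also have "\<dots> = emeasure a B" using lebesgue_decomposition_formula(1)[OF D Z B] by simp
      also have "\<dots> = (\<integral>\<^sup>+x. f x * indicator B x \<partial>M)"
        using B by (subst df[symmetric]) (simp add: emeasure_density)
      also have "\<dots> \<le> (\<integral>\<^sup>+x. ennreal q * indicator B x \<partial>M)"
        by (intro nn_integral_mono) (auto simp: B_def indicator_def)
      also have "\<dots> = ennreal q * emeasure M B" using B by (simp add: nn_integral_cmult_indicator)
      also have "emeasure M B = emeasure M (B - Z)" using B Z(1) by (simp add: emeasure_Diff_null_set)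
      finally have le: "ennreal k * emeasure M (B - Z) \<le> ennreal q * emeasure M (B - Z)" .
      have fB: "emeasure M (B - Z) < \<infinity>"
      proof (rule le_less_trans[OF _ R(2)])
        show "emeasure M (B - Z) \<le> emeasure M R" using R(1) by (intro emeasure_mono) (auto simp: B_def)
      qed
      then obtain m where m: "emeasure M (B - Z) = ennreal m" "0 \<le> m" by (cases "emeasure M (B - Z)") auto
      have "k * m \<le> q * m" using le m q True by (simp add: ennreal_mult'[symmetric])
      then have "m = 0" using q m(2) by (simp add: mult_le_cancel_right)
      then have "emeasure M B = 0" using m \<open>emeasure M B = emeasure M (B - Z)\<close> by simp
      then have "AE x in M. x \<notin> B" using B by (intro AE_not_in) auto
      then show ?thesis unfolding eq
        by (rule AE_mp) (auto intro!: AE_I2 simp: B_def not_less)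
    qed
    then have "AE x in M. \<forall>n. x \<in> R \<longrightarrow> ennreal (k - 1 / Suc n) \<le> f x" by (subst AE_all_countable) blast
    then show ?thesis
    proof (rule eventually_mono, intro impI)
      fix x assume a: "\<forall>n. x \<in> R \<longrightarrow> ennreal (k - 1 / Suc n) \<le> f x" and x: "x \<in> R"
      have "(\<lambda>n. ennreal (k - 1 / Suc n)) \<longlonglongrightarrow> ennreal (k - 0)"
        by (intro tendsto_ennrealI tendsto_diff tendsto_const LIMSEQ_Suc[OF lim_1_over_n])
      then show "ennreal k \<le> f x" using a x by (intro LIMSEQ_le_const2[of _ "ennreal k" "f x"]) auto
    qed
  qed
  ultimately show ?thesis
  proof eventually_elim
    case (elim x)
    show ?case
    proof
      assume "x \<in> R"
      with elim have "ennreal k \<le> f x" "f x \<noteq> \<infinity>" by auto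
      then show "k \<le> ac_density M mu x"
        unfolding ac_density_def a_def[symmetric] f_def[symmetric]
        by (cases "f x") (auto simp: ennreal_le_iff2)
    qed
  qed
qed

section \<open>Comparison of measures through continuous test functions\<close>

lemma continuous_approx_open:
  fixes V :: "'a::euclidean_space set"
  assumes V: "open V" "bounded V"
  obtains z :: "nat \<Rightarrow> 'a \<Rightarrow> real"
  where "\<And>n. continuous_on UNIV (z n)" "\<And>n x. 0 \<le> z n x" "\<And>n x. z n x \<le> 1" "incseq z"
    "\<And>n. \<exists>K. compact K \<and> K \<subseteq> V \<and> (\<forall>x. x \<notin> K \<longrightarrow> z n x = 0)"
    "\<And>x. (SUP n. ennreal (z n x)) = indicator V x"
proof -
  \<comment> \<open>Subtracting 1 confines the support to the points with n times the distance from
    the complement at least 1, a closed and bounded subset of \<open>V\<close>.\<close>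
  define z where "z = (\<lambda>n x. min 1 (max 0 (real n * infdist x (- V) - 1)))"
  have ne: "- V \<noteq> {}" using V(2) by (metis Compl_UNIV_eq double_compl not_bounded_UNIV)
  have cl: "closed (- V)" by (rule closed_Compl[OF V(1)])
  have out: "infdist x (- V) = 0" if "x \<notin> V" for x using that by simp
  show ?thesis
  proof (rule that[of z])
    show "continuous_on UNIV (z n)" for n unfolding z_def by (intro continuous_intros)
    show "0 \<le> z n x" "z n x \<le> 1" for n x by (auto simp: z_def)
    show "incseq z"
      unfolding z_def incseq_def le_fun_def
      by (intro allI impI min.mono max.mono diff_mono mult_right_mono order_refl) (auto simp: infdist_nonneg)
    show "\<exists>K. compact K \<and> K \<subseteq> V \<and> (\<forall>x. x \<notin> K \<longrightarrow> z n x = 0)" for n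
    proof (intro exI conjI allI impI)
      let ?K = "{x. 1 \<le> real n * infdist x (- V)}"
      show KV: "?K \<subseteq> V"
      proof
        fix x assume "x \<in> ?K"
        then show "x \<in> V" using out[of x] by (cases "x \<in> V") simp_all
      qed
      have "closed ?K" by (intro closed_Collect_le continuous_intros)
      then show "compact ?K" using bounded_subset[OF V(2) KV] by (simp add: compact_eq_bounded_closed)
      fix x assume "x \<notin> ?K"
      then show "z n x = 0" by (auto simp: z_def)
    qed
    show "(SUP n. ennreal (z n x)) = indicator V x" for x
    proof (cases "x \<in> V")
      case True
      then have "0 < infdist x (- V)" using in_closed_iff_infdist_zero[OF cl ne] infdist_nonneg[of x "- V"] by force
      then obtain n where n: "2 < real n * infdist x (- V)" using reals_Archimedean3 by blast
      have "z n x = 1" using n by (simp add: z_def)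
      then have "1 \<le> (SUP n. ennreal (z n x))" by (intro SUP_upper2[of n]) auto
      moreover have "(SUP n. ennreal (z n x)) \<le> 1" by (intro SUP_least) (simp add: z_def)
      ultimately have "(SUP n. ennreal (z n x)) = 1" by (intro antisym)
      then show ?thesis using True by simp
    next
      case False
      then have "z n x = 0" for n by (simp add: z_def)
      then show ?thesis using False by simp
    qed
  qed
qed

text \<open>Open subsets of \<open>R\<close> are reached by monotone approximation with test
  functions, Borel subsets by outer regularity of the finite measure \<open>nu\<close>, with every
  open superset cut down to \<open>R\<close>.\<close>

lemma measure_le_from_test:
  fixes R :: "'a::euclidean_space set"
  assumes s: "sets mu = sets borel" "sets nu = sets borel" and fin: "finite_measure nu" and R: "open R" "bounded R"
    and le: "\<And>z K. continuous_on UNIV z \<Longrightarrow> (\<forall>x. 0 \<le> z x \<and> z x \<le> 1) \<Longrightarrow> compact K \<Longrightarrow> K \<subseteq> R \<Longrightarrow> (\<forall>x. x \<notin> K \<longrightarrow> z x = 0)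
      \<Longrightarrow> (\<integral>\<^sup>+x. ennreal (z x) \<partial>mu) \<le> (\<integral>\<^sup>+x. ennreal (z x) \<partial>nu)"
    and A: "A \<in> sets borel" "A \<subseteq> R"
  shows "emeasure mu A \<le> emeasure nu A"
proof -
  have opn: "emeasure mu V \<le> emeasure nu V" if V: "open V" "V \<subseteq> R" for V
  proof -
    obtain z :: "nat \<Rightarrow> 'a \<Rightarrow> real" where z: "\<And>n. continuous_on UNIV (z n)" "\<And>n x. 0 \<le> z n x" "\<And>n x. z n x \<le> 1" "incseq z"
      "\<And>n. \<exists>K. compact K \<and> K \<subseteq> V \<and> (\<forall>x. x \<notin> K \<longrightarrow> z n x = 0)"
      "\<And>x. (SUP n. ennreal (z n x)) = indicator V x"
      using continuous_approx_open[OF V(1) bounded_subset[OF R(2) V(2)]] by blast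
    have zm: "z n \<in> borel_measurable borel" for n using z(1) by (rule borel_measurable_continuous_onI)
    have inc: "incseq (\<lambda>n x. ennreal (z n x))" using z(4) by (auto simp: incseq_def le_fun_def ennreal_leI)
    have e: "emeasure m V = (SUP n. \<integral>\<^sup>+x. ennreal (z n x) \<partial>m)" if "sets m = sets borel" for m
    proof -
      have Vm: "V \<in> sets m" using V(1) that by simp
      have "(\<integral>\<^sup>+x. (SUP n. ennreal (z n x)) \<partial>m) = (SUP n. \<integral>\<^sup>+x. ennreal (z n x) \<partial>m)"
        using zm that by (intro nn_integral_monotone_convergence_SUP[OF inc]) (simp add: measurable_cong_sets[OF that refl])
      then show ?thesis using Vm by (simp add: z(6))
    qed
    show ?thesis unfolding e[OF s(1)] e[OF s(2)]
    proof (rule SUP_mono')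
      fix n
      obtain K where "compact K" "K \<subseteq> V" "\<forall>x. x \<notin> K \<longrightarrow> z n x = 0" using z(5) by blast
      then show "(\<integral>\<^sup>+x. ennreal (z n x) \<partial>mu) \<le> (\<integral>\<^sup>+x. ennreal (z n x) \<partial>nu)"
        using z(1-3) V(2) by (intro le[of "z n" K]) auto
    qed
  qed
  have "emeasure nu A = (INF U \<in> {U. A \<subseteq> U \<and> open U}. emeasure nu U)"
    using finite_measure.emeasure_finite[OF fin] by (intro outer_regular[OF s(2) _ A(1)]) auto
  moreover have "emeasure mu A \<le> emeasure nu U" if U: "A \<subseteq> U" "open U" for U
  proof -
    have "emeasure mu A \<le> emeasure mu (U \<inter> R)" using A U R s by (intro emeasure_mono) auto
    also have "\<dots> \<le> emeasure nu (U \<inter> R)" using U R by (intro opn) auto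
    also have "\<dots> \<le> emeasure nu U" using U s by (intro emeasure_mono) auto
    finally show ?thesis .
  qed
  ultimately show ?thesis by (auto intro: INF_greatest)
qed

text \<open>The positive and negative parts of h - c on \<open>R\<close> are taken as densities of
  two measures. The tested inequality compares these measures, while the second one vanishes on the
  set where h > c.\<close>

lemma le_const_from_test:
  fixes h :: "real \<Rightarrow> real"
  assumes h: "integrable lborel h" and R: "open R" "bounded R"
    and le: "\<And>z K. continuous_on UNIV z \<Longrightarrow> (\<forall>x. 0 \<le> z x \<and> z x \<le> 1) \<Longrightarrow> compact K \<Longrightarrow> K \<subseteq> R \<Longrightarrow> (\<forall>x. x \<notin> K \<longrightarrow> z x = 0)
      \<Longrightarrow> (\<integral>t. z t * h t \<partial>lborel) \<le> c * (\<integral>t. z t \<partial>lborel)"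
  shows "AE t in lborel. t \<in> R \<longrightarrow> h t \<le> c"
proof -
  have hm [measurable]: "h \<in> borel_measurable borel" using h by auto
  have Rb [measurable]: "R \<in> sets borel" using R by simp
  define g where "g t = (h t - c) * indicator R t" for t
  have iR: "integrable lborel (\<lambda>t. indicator R t :: real)"
    using emeasure_bounded_finite[OF R(2)] by (intro integrable_real_indicator) auto
  have ig: "integrable lborel g"
    unfolding g_def left_diff_distrib using integrable_real_mult_indicator[OF _ h, of R] iR by (auto intro!: Bochner_Integration.integrable_diff)
  have gm [measurable]: "g \<in> borel_measurable borel" using ig by auto
  define mu nu where "mu = density lborel (\<lambda>t. ennreal (max 0 (g t)))" and "nu = density lborel (\<lambda>t. ennreal (max 0 (- g t)))"
  have ip: "integrable lborel (\<lambda>t. max 0 (g t))" "integrable lborel (\<lambda>t. max 0 (- g t))" using ig by auto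
  have fin: "finite_measure nu"
  proof
    show "emeasure nu (space nu) \<noteq> \<infinity>"
      using ip(2) by (simp add: nu_def emeasure_density nn_integral_eq_integral)
  qed
  define A where "A = {t \<in> R. c < h t}"
  have A: "A \<in> sets borel" "A \<subseteq> R" unfolding A_def by auto
  have "emeasure mu A \<le> emeasure nu A"
  proof (rule measure_le_from_test[OF _ _ fin R _ A])
    fix z :: "real \<Rightarrow> real" and K
    assume z: "continuous_on UNIV z" "\<forall>x. 0 \<le> z x \<and> z x \<le> 1" "compact K" "K \<subseteq> R" "\<forall>x. x \<notin> K \<longrightarrow> z x = 0"
    have zm [measurable]: "z \<in> borel_measurable borel" using z(1) by (rule borel_measurable_continuous_onI)
    have zb: "integrable lborel (\<lambda>t. z t * f t)" if f: "integrable lborel f" for f :: "real \<Rightarrow> real"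
      by (rule Bochner_Integration.integrable_bound[OF f]) (use f z(2) in \<open>auto simp: abs_mult intro!: mult_left_le_one_le\<close>)
    have zi: "integrable lborel (\<lambda>t. z t * indicator R t)" by (rule zb[OF iR])
    have zR: "z t * indicator R t = z t" for t using z(4,5) by (auto simp: indicator_def)
    have "(\<integral>t. z t * g t \<partial>lborel) = (\<integral>t. z t * h t - c * (z t * indicator R t) \<partial>lborel)"
      using zR by (intro Bochner_Integration.integral_cong) (auto simp: g_def algebra_simps indicator_def)
    also have "\<dots> = (\<integral>t. z t * h t \<partial>lborel) - c * (\<integral>t. z t \<partial>lborel)"
      using zb[OF h] zi by (simp add: zR)
    finally have "(\<integral>t. z t * g t \<partial>lborel) \<le> 0" using le[OF z] by simp
    moreover have "(\<integral>t. z t * g t \<partial>lborel) = (\<integral>t. z t * max 0 (g t) \<partial>lborel) - (\<integral>t. z t * max 0 (- g t) \<partial>lborel)"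
    proof -
      have "(\<lambda>t. z t * g t) = (\<lambda>t. z t * max 0 (g t) - z t * max 0 (- g t))"
        by (rule ext) (auto simp: max_def)
      then show ?thesis using Bochner_Integration.integral_diff[OF zb[OF ip(1)] zb[OF ip(2)]] by simp
    qed
    ultimately have "(\<integral>t. z t * max 0 (g t) \<partial>lborel) \<le> (\<integral>t. z t * max 0 (- g t) \<partial>lborel)" by simp
    then have "(\<integral>\<^sup>+t. ennreal (z t * max 0 (g t)) \<partial>lborel) \<le> (\<integral>\<^sup>+t. ennreal (z t * max 0 (- g t)) \<partial>lborel)"
      using zb[OF ip(1)] zb[OF ip(2)] z(2) by (simp add: nn_integral_eq_integral ennreal_leI)
    then show "(\<integral>\<^sup>+x. ennreal (z x) \<partial>mu) \<le> (\<integral>\<^sup>+x. ennreal (z x) \<partial>nu)"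
      using z(2) by (simp add: mu_def nu_def nn_integral_density ennreal_mult'[symmetric] mult.commute)
  qed (simp_all add: mu_def nu_def)
  also have "emeasure nu A = 0"
    using A by (simp add: nu_def emeasure_density, subst nn_integral_0_iff_AE) (auto simp: A_def g_def indicator_def)
  finally have "emeasure mu A = 0" by simp
  then have "AE t in lborel. ennreal (max 0 (g t)) * indicator A t = 0"
    using A by (simp add: mu_def emeasure_density nn_integral_0_iff_AE)
  then show ?thesis
    by (rule AE_mp) (auto intro!: AE_I2 simp: A_def g_def indicator_def not_less ennreal_eq_0_iff split: if_splits)
qed

text \<open>If intervals carry at most \<open>C\<close> times their length, a null set inside
  \<open>(p, q)\<close> can be covered by intervals of small total mass. The contrapositive is what
  is wanted: where the singular part charges an interval, some subinterval has mean density above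
  any prescribed \<open>C\<close>. The shift \<open>h\<close> makes endpoints rational in the moving
  frame, not in the fixed one.\<close>

lemma sing_part_zero_on_interval:
  fixes mu :: "real measure"
  assumes fin: "finite_measure mu" and s: "sets mu = sets borel" and C: "0 \<le> C"
    and le: "\<And>a b :: rat. p \<le> of_rat a + h \<Longrightarrow> a < b \<Longrightarrow> of_rat b + h \<le> q
      \<Longrightarrow> measure mu {of_rat a + h<..<of_rat b + h} \<le> C * (of_rat b - of_rat a)"
  shows "emeasure (sing_part lborel mu) {p<..<q} = 0"
proof -
  interpret finite_measure mu by (rule fin)
  have sl: "sets mu = sets lborel" using s by simp
  have D: "lebesgue_decomposition lborel mu (ac_part lborel mu) (sing_part lborel mu)"
    by (rule lebesgue_decomposition_parts[OF fin sl])
  obtain Z where Z: "Z \<in> null_sets lborel" "\<And>A. A \<in> sets lborel \<Longrightarrow> emeasure (sing_part lborel mu) (A - Z) = 0"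
    using lebesgue_decomposition_null_set[OF D] by blast
  have Zb: "Z \<in> sets borel" using Z by auto
  \<comment> \<open>A closed interval is enclosed in a slightly longer one with shifted rational
    endpoints that still lies within \<open>(p, q)\<close>; the extra length is at most
    \<open>2 * e'\<close>, which costs at most \<open>e\<close>.\<close>
  have cb: "measure mu {c..d} \<le> C * (d - c)" if cd: "p < c" "c \<le> d" "d < q" for c d
  proof (rule field_le_epsilon)
    fix e :: real assume e: "0 < e"
    define e' where "e' = e / (2 * (C + 1))"
    have e': "0 < e'" using e C by (simp add: e'_def)
    have "max p (c - e') - h < c - h" "d - h < min q (d + e') - h" using cd e' by auto
    then obtain a b where a0: "max p (c - e') - h < of_rat a" "of_rat a < c - h" and b0: "d - h < of_rat b" "of_rat b < min q (d + e') - h"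
      using of_rat_dense by blast
    have a: "max p (c - e') < of_rat a + h" "of_rat a + h < c" and b: "d < of_rat b + h" "of_rat b + h < min q (d + e')"
      using a0 b0 by linarith+
    have ab: "of_rat a < (of_rat b :: real)" using a b cd by linarith
    have "measure mu {c..d} \<le> measure mu {of_rat a + h<..<of_rat b + h}"
      using a b s by (intro finite_measure_mono) auto
    also have "\<dots> \<le> C * (of_rat b - of_rat a)"
      by (rule le) (use a b ab in \<open>auto simp: of_rat_less\<close>)
    also have "\<dots> \<le> C * (d - c + 2 * e')" using a b C by (intro mult_left_mono) auto
    also have "\<dots> \<le> C * (d - c) + e"
    proof -
      have C1: "C + 1 > 0" using C by simp
      have "C * (2 * e') \<le> (C + 1) * (2 * e')" using e' by (intro mult_right_mono) auto
      also have "\<dots> = e" using C1 by (simp add: e'_def divide_simps)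
      finally show ?thesis by (simp add: distrib_left)
    qed
    finally show "measure mu {c..d} \<le> C * (d - c) + e" .
  qed
  have null: "emeasure mu (Z \<inter> {c..d}) = 0" if cd: "p < c" "c \<le> d" "d < q" for c d
  proof -
    have "measure mu (Z \<inter> {c..d}) \<le> 0 + e" if e: "0 < e" for e
    proof -
      define e' where "e' = e / (C + 1)"
      have e': "0 < e'" using e C by (simp add: e'_def)
      have ZL: "Z \<inter> {c..d} \<in> null_sets lebesgue" using Z(1) by (intro null_set_Int2 null_sets_completionI) auto
      then have lm: "Z \<inter> {c..d} \<in> lmeasurable" "measure lebesgue (Z \<inter> {c..d}) = 0" by (auto simp: fmeasurable_def null_sets_def measure_def)
      \<comment> \<open>The cover of the null set by intervals with disjoint interiors has total
        length at most \<open>e'\<close> and stays inside \<open>[c, d]\<close>, where the assumed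
        bound is available.\<close>
      obtain DD where DD: "countable DD" "\<And>K. K \<in> DD \<Longrightarrow> K \<subseteq> cbox c d \<and> K \<noteq> {} \<and> (\<exists>a b. K = cbox a b)"
        "pairwise (\<lambda>A B. interior A \<inter> interior B = {}) DD"
        "Z \<inter> {c..d} \<subseteq> \<Union>DD" "\<Union>DD \<in> lmeasurable" "measure lebesgue (\<Union>DD) \<le> measure lebesgue (Z \<inter> {c..d}) + e'"
        using measurable_outer_intervals_bounded[OF lm(1) _ e', of c d] by (metis Int_lower2 box_real(2))
      have lbK: "K \<in> lmeasurable" if "K \<in> DD" for K using DD(2)[OF that] by auto
      have negl: "pairwise (\<lambda>A B. negligible (A \<inter> B)) DD"
        unfolding pairwise_def
      proof (intro ballI impI)
        fix A B assume AB: "A \<in> DD" "B \<in> DD" "A \<noteq> B"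
        then have "convex (A \<inter> B)" using DD(2) by (metis convex_Int convex_box(1))
        moreover have "interior (A \<inter> B) = {}" using DD(3) AB by (auto simp: pairwise_def)
        ultimately show "negligible (A \<inter> B)" by (simp add: negligible_convex_interior)
      qed
      have finb: "measure mu (\<Union>F) \<le> C * e'" if F: "finite F" "F \<subseteq> DD" for F
      proof -
        have Fb: "K \<in> sets borel" "measure mu K \<le> C * measure lebesgue K" if K: "K \<in> F" for K
        proof -
          obtain a b where ab: "K = {a..b}" using DD(2)[of K] F K by auto
          have "a \<le> b" "{a..b} \<subseteq> {c..d}" using DD(2)[of K] F K ab by auto
          then have "p < a" "b < q" using cd by auto
          then show "measure mu K \<le> C * measure lebesgue K" using cb[of a b] \<open>a \<le> b\<close> ab by simp
          show "K \<in> sets borel" using ab by simp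
        qed
        have "measure mu (\<Union>F) \<le> (\<Sum>K\<in>F. measure mu K)"
          using F Fb s finite_measure_subadditive_finite[of F "\<lambda>K. K"] by auto
        also have "\<dots> \<le> (\<Sum>K\<in>F. C * measure lebesgue K)" using Fb by (intro sum_mono) auto
        also have "\<dots> = C * measure lebesgue (\<Union>F)"
        proof -
          have "measure lebesgue (\<Union>F) = (\<Sum>K\<in>F. measure lebesgue K)"
            by (rule measure_negligible_finite_Union[OF F(1) _ pairwise_subset[OF negl F(2)]]) (use F lbK in blast)
          then show ?thesis by (simp add: sum_distrib_left)
        qed
        also have "\<dots> \<le> C * e'"
        proof (intro mult_left_mono C)
          have "measure lebesgue (\<Union>F) \<le> measure lebesgue (\<Union>DD)"
            using F lbK DD(5) by (intro measure_mono_fmeasurable) (auto intro!: fmeasurableD fmeasurable.finite_Union)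
          then show "measure lebesgue (\<Union>F) \<le> e'" using DD(6) lm(2) by simp
        qed
        finally show ?thesis .
      qed
      have DDb: "K \<in> sets mu" if "K \<in> DD" for K using DD(2)[OF that] s by auto
      \<comment> \<open>The bound holds for finite subfamilies; an enumeration of the family and
        continuity from below extend it to the whole union.\<close>
      have "measure mu (\<Union>DD) \<le> C * e'"
      proof (cases "DD = {}")
        case True then show ?thesis using C e' by simp
      next
        case ne: False
        define W where "W n = \<Union>(from_nat_into DD ` {..<n})" for n
        have WD: "from_nat_into DD ` {..<n} \<subseteq> DD" for n using from_nat_into[OF ne] by auto
        have "(\<lambda>n. measure mu (W n)) \<longlonglongrightarrow> measure mu (\<Union>n. W n)"
        proof (rule finite_Lim_measure_incseq)
          show "range W \<subseteq> sets mu" unfolding W_def using WD DDb by (auto intro!: sets.finite_Union)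
          show "incseq W" unfolding W_def incseq_def by (auto intro: less_le_trans)
        qed
        moreover have "(\<Union>n. W n) = \<Union>DD"
        proof -
          have "(\<Union>n. W n) = \<Union>(range (from_nat_into DD))" unfolding W_def using lessThan_iff lessI by blast
          then show ?thesis using range_from_nat_into[OF ne DD(1)] by simp
        qed
        moreover have "measure mu (W n) \<le> C * e'" for n unfolding W_def by (rule finb) (use WD in auto)
        ultimately show ?thesis by (metis LIMSEQ_le_const2)
      qed
      then have "measure mu (Z \<inter> {c..d}) \<le> C * e'"
        using finite_measure_mono[OF DD(4)] DDb DD(1) by (meson order_trans sets.countable_Union subsetI)
      also have "\<dots> \<le> (C + 1) * e'" using e' by (intro mult_right_mono) auto
      also have "\<dots> = e" using C by (simp add: e'_def)
      finally show ?thesis by simp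
    qed
    then have "measure mu (Z \<inter> {c..d}) \<le> 0" by (rule field_le_epsilon)
    then show ?thesis by (simp add: emeasure_eq_measure measure_le_0_iff)
  qed
  have n1: "(\<Union>n. Z \<inter> {p + 1 / Suc n .. q - 1 / Suc n}) \<in> null_sets mu"
  proof (rule null_sets_UN)
    fix n :: nat
    show "Z \<inter> {p + 1 / Suc n .. q - 1 / Suc n} \<in> null_sets mu"
    proof (cases "p + 1 / Suc n \<le> q - 1 / Suc n")
      case True
      have "0 < 1 / real (Suc n)" by simp
      then have "emeasure mu (Z \<inter> {p + 1 / Suc n .. q - 1 / Suc n}) = 0" using True by (intro null) auto
      then show ?thesis using Zb s by auto
    qed simp
  qed
  have n2: "Z \<inter> {p<..<q} \<subseteq> (\<Union>n. Z \<inter> {p + 1 / Suc n .. q - 1 / Suc n})"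
  proof
    fix x assume x: "x \<in> Z \<inter> {p<..<q}"
    then have "0 < min (x - p) (q - x)" by simp
    then obtain n where "inverse (real (Suc n)) < min (x - p) (q - x)" using reals_Archimedean by blast
    then have "1 / real (Suc n) < x - p" "1 / real (Suc n) < q - x" by (simp_all add: inverse_eq_divide)
    then have "x \<in> {p + 1 / Suc n .. q - 1 / Suc n}" unfolding atLeastAtMost_iff by linarith
    then show "x \<in> (\<Union>n. Z \<inter> {p + 1 / Suc n .. q - 1 / Suc n})" using x by blast
  qed
  have "Z \<inter> {p<..<q} \<in> null_sets mu" by (rule null_sets_subset[OF n1 _ n2]) (use Zb s in simp)
  then show ?thesis
    using lebesgue_decomposition_formula(2)[OF D Z, of "{p<..<q}"] null_setsD1[of "Z \<inter> {p<..<q}" mu] by (simp add: Int_commute)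
qed

section \<open>Bumps in space and time\<close>

text \<open>As \<open>w\<close> sits to the left of \<open>z\<close>, the antiderivative of \<open>w - z\<close> is nonnegative, as required of a factor of an entropy test function.\<close>

lemma antiderivative_bump:
  fixes z w :: "real \<Rightarrow> real"
  assumes ab: "a' < a" "a < b" and z: "continuous_on UNIV z" "\<And>t. 0 \<le> z t" "\<And>t. t \<notin> {a..b} \<Longrightarrow> z t = 0"
    and w: "continuous_on UNIV w" "\<And>t. 0 \<le> w t" "\<And>t. t \<notin> {a'..a} \<Longrightarrow> w t = 0"
    and eq: "(\<integral>t. z t \<partial>lborel) = m" "(\<integral>t. w t \<partial>lborel) = m"
  obtains th where "\<And>t. (th has_real_derivative w t - z t) (at t)" "\<And>t. 0 \<le> th t" "\<And>t. th t \<le> m" "\<And>t. t \<notin> {a'..b} \<Longrightarrow> th t = 0"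
proof -
  define g where "g t = w t - z t" for t
  have gc: "continuous_on S g" for S unfolding g_def
    by (intro continuous_intros continuous_on_subset[OF w(1)] continuous_on_subset[OF z(1)]) auto
  have g0: "g t = 0" if "t \<notin> {a'..b}" for t using that z(3)[of t] w(3)[of t] ab by (auto simp: g_def)
  \<comment> \<open>The margin of 1 on both sides puts \<open>a'\<close> and \<open>b\<close> into
    the interior, where the fundamental theorem gives a two-sided derivative. Near the ends of the
    larger interval both expressions are 0.\<close>
  define th where "th t = (if t \<in> {a' - 1<..<b + 1} then integral {a' - 1..t} g else 0)" for t
  have mass: "integral {c..d} f = (\<integral>t. f t \<partial>lborel)"
    if "continuous_on UNIV f" "\<And>t. t \<notin> {c..d} \<Longrightarrow> f t = 0" for f :: "real \<Rightarrow> real" and c d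
  proof -
    have "(\<integral>t. f t \<partial>lborel) = (\<integral>t. indicator {c..d} t *\<^sub>R f t \<partial>lborel)"
      using that(2) by (intro Bochner_Integration.integral_cong) (auto simp: indicator_def)
    also have "\<dots> = integral {c..d} f"
    proof (rule set_borel_integral_eq_integral(2)[unfolded set_lebesgue_integral_def])
      show "set_integrable lborel {c..d} f"
        by (rule borel_integrable_atLeastAtMost') (rule continuous_on_subset[OF that(1)], simp)
    qed
    finally show ?thesis ..
  qed
  have gi: "g integrable_on {c..d}" for c d by (rule integrable_continuous_real[OF gc])
  have tot: "integral {a' - 1..t} g = 0" if "b \<le> t" for t
  proof -
    have "integral {a' - 1..t} g = integral {a' - 1..t} w - integral {a' - 1..t} z"
      unfolding g_def by (intro integral_diff integrable_continuous_real continuous_on_subset[OF w(1)] continuous_on_subset[OF z(1)]) auto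
    also have "integral {a' - 1..t} w = m" using w(3) that ab eq(2) by (subst mass[OF w(1)]) auto
    also have "integral {a' - 1..t} z = m" using z(3) that ab eq(1) by (subst mass[OF z(1)]) auto
    finally show ?thesis by simp
  qed
  have low: "integral {a' - 1..t} g = 0" if "t \<le> a'" for t
  proof -
    have "integral {a' - 1..t} g = integral {a' - 1..t} (\<lambda>_. 0)"
    proof (rule integral_spike[of "{a'}"])
      show "0 = g x" if "x \<in> {a' - 1..t} - {a'}" for x using g0[of x] that \<open>t \<le> a'\<close> by auto
    qed simp
    then show ?thesis by simp
  qed
  have zero: "th t = 0" if "t \<notin> {a'<..<b}" for t
  proof (cases "t \<in> {a' - 1<..<b + 1}")
    case True
    then have "t \<le> a' \<or> b \<le> t" using that by auto
    then show ?thesis using low tot True by (auto simp: th_def)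
  next
    case False
    then show ?thesis unfolding th_def by (rule if_not_P)
  qed
  have d: "(th has_real_derivative g t) (at t)" for t
  proof (cases "t \<in> {a' - 1<..<b + 1}")
    case True
    have dw: "((\<lambda>x. integral {a' - 1..x} g) has_real_derivative g t) (at t within {a' - 1..b + 1})"
      by (rule integral_has_real_derivative[OF gc]) (use True in auto)
    have ti: "t \<in> interior {a' - 1..b + 1}" using True by simp
    have "((\<lambda>x. integral {a' - 1..x} g) has_real_derivative g t) (at t)"
      using dw unfolding at_within_interior[OF ti] .
    then show ?thesis
      by (rule has_field_derivative_transform_within_open[where S = "{a' - 1<..<b + 1}"]) (use True in \<open>auto simp: th_def\<close>)
  next
    case False
    define S where "S = - {a'..b}"
    have "((\<lambda>_. 0) has_real_derivative 0) (at t)" by simp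
    then have "(th has_real_derivative 0) (at t)"
      by (rule has_field_derivative_transform_within_open[where S = S]) (use False zero in \<open>auto simp: S_def\<close>)
    then show ?thesis using g0[of t] False by auto
  qed
  have up: "th s \<le> th t" if "s \<le> t" "t \<le> a" for s t
  proof (rule DERIV_nonneg_imp_nondecreasing[OF that(1)])
    fix x assume "s \<le> x" "x \<le> t"
    have "z x = 0"
    proof (cases "x = a")
      case True
      have "z a = 0"
      proof (rule ccontr)
        assume "z a \<noteq> 0"
        then have za: "0 < z a" using z(2)[of a] by linarith
        have "(z \<longlongrightarrow> z a) (at_left a)"
          by (rule tendsto_mono[OF at_le[OF subset_UNIV]]) (use z(1) in \<open>simp add: continuous_on_def\<close>)
        then have "\<forall>\<^sub>F x in at_left a. 0 < z x" using za by (rule order_tendstoD)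
        moreover have "\<forall>\<^sub>F x in at_left a. x < a" by (simp add: eventually_at_filter)
        ultimately have "\<forall>\<^sub>F x in at_left a. False"
          by eventually_elim (use z(3) in force)
        then show False by (simp add: trivial_limit_at_left_real)
      qed
      then show ?thesis using True by simp
    qed (use z(3)[of x] \<open>x \<le> t\<close> that(2) in auto)
    then show "\<exists>y. (th has_real_derivative y) (at x) \<and> 0 \<le> y" using d[of x] w(2)[of x] by (auto simp: g_def)
  qed
  have down: "th t \<le> th s" if "a \<le> s" "s \<le> t" for s t
  proof (rule DERIV_nonpos_imp_nonincreasing[OF that(2)])
    fix x assume "s \<le> x" "x \<le> t"
    have "w x = 0"
    proof (cases "x = a")
      case True
      have "w a = 0"
      proof (rule ccontr)
        assume "w a \<noteq> 0"
        then have za: "0 < w a" using w(2)[of a] by linarith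
        have "(w \<longlongrightarrow> w a) (at_right a)"
          by (rule tendsto_mono[OF at_le[OF subset_UNIV]]) (use w(1) in \<open>simp add: continuous_on_def\<close>)
        then have "\<forall>\<^sub>F x in at_right a. 0 < w x" using za by (rule order_tendstoD)
        moreover have "\<forall>\<^sub>F x in at_right a. a < x" by (simp add: eventually_at_filter)
        ultimately have "\<forall>\<^sub>F x in at_right a. False"
          by eventually_elim (use w(3) in force)
        then show False by (simp add: trivial_limit_at_right_real)
      qed
      then show ?thesis using True by simp
    qed (use w(3)[of x] \<open>s \<le> x\<close> that(1) in auto)
    then show "\<exists>y. (th has_real_derivative y) (at x) \<and> y \<le> 0" using d[of x] z(2)[of x] by (auto simp: g_def)
  qed
  have nonneg: "0 \<le> th t" for t
  proof (cases "t \<le> a")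
    case True
    then show ?thesis using up[of "min t a'" t] zero[of "min t a'"] by auto
  next
    case False
    then show ?thesis using down[of t "max t b"] zero[of "max t b"] by auto
  qed
  have "th a \<le> m"
  proof -
    have "th a = integral {a' - 1..a} g" using ab by (simp add: th_def)
    also have "\<dots> \<le> integral {a' - 1..a} w"
      by (intro integral_le gi integrable_continuous_real continuous_on_subset[OF w(1)]) (use z(2) in \<open>auto simp: g_def\<close>)
    also have "\<dots> = m" using w(3) eq(2) ab by (subst mass[OF w(1)]) auto
    finally show ?thesis .
  qed
  moreover have "th t \<le> th a" for t using up[of t a] down[of a t] by (cases "t \<le> a") auto
  ultimately have le: "th t \<le> m" for t by (meson order_trans)
  show ?thesis
    by (rule that[of th]) (use d nonneg le zero in \<open>auto simp: g_def\<close>)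
qed

text \<open>A C^2 approximation of the indicator of the open interval from inside, with ramps of
  width 3/m and slopes at most m.\<close>

definition bump :: "real \<Rightarrow> real \<Rightarrow> real \<Rightarrow> real \<Rightarrow> real" where
  "bump m a b x = smooth_step (m * (x - a)) * smooth_step (m * (b - x))"

definition bump' :: "real \<Rightarrow> real \<Rightarrow> real \<Rightarrow> real \<Rightarrow> real" where
  "bump' m a b x = m * smooth_step' (m * (x - a)) * smooth_step (m * (b - x)) - m * smooth_step (m * (x - a)) * smooth_step' (m * (b - x))"

definition bump'' :: "real \<Rightarrow> real \<Rightarrow> real \<Rightarrow> real \<Rightarrow> real" where
  "bump'' m a b x = m\<^sup>2 * (smooth_step'' (m * (x - a)) * smooth_step (m * (b - x)) - 2 * smooth_step' (m * (x - a)) * smooth_step' (m * (b - x))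
     + smooth_step (m * (x - a)) * smooth_step'' (m * (b - x)))"

lemma bump_deriv:
  "(bump m a b has_real_derivative bump' m a b x) (at x)" "(bump' m a b has_real_derivative bump'' m a b x) (at x)"
  unfolding bump_def bump'_def bump''_def
  by (rule derivative_eq_intros refl | simp add: algebra_simps power2_eq_square)+

lemma bump_cont: "continuous_on S (bump m a b)" "continuous_on S (bump' m a b)" "continuous_on S (bump'' m a b)"
  unfolding bump_def bump'_def bump''_def by (intro continuous_intros)+

lemma bump_bounds: "0 \<le> bump m a b x" "bump m a b x \<le> 1"
  using smooth_step_bounds by (auto simp: bump_def intro!: mult_nonneg_nonneg mult_le_one)

lemma bump_zero:
  assumes "0 \<le> m" "x \<notin> {a<..<b}" shows "bump m a b x = 0" "bump' m a b x = 0"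
proof -
  have "m * (x - a) \<le> 0 \<or> m * (b - x) \<le> 0" using assms by (auto simp: mult_le_0_iff)
  then show "bump m a b x = 0" "bump' m a b x = 0" by (auto simp: bump_def bump'_def smooth_step_eq_0)
qed

lemma bump'_bound: "0 \<le> m \<Longrightarrow> \<bar>bump' m a b x\<bar> \<le> 2 * m"
proof -
  assume m: "0 \<le> m"
  have "0 \<le> smooth_step' s * smooth_step t \<and> smooth_step' s * smooth_step t \<le> 1" "0 \<le> smooth_step s * smooth_step' t \<and> smooth_step s * smooth_step' t \<le> 1" for s t
    using smooth_step_bounds smooth_step'_bounds by (auto intro!: mult_nonneg_nonneg mult_le_one)
  then have "\<bar>smooth_step' (m * (x - a)) * smooth_step (m * (b - x)) - smooth_step (m * (x - a)) * smooth_step' (m * (b - x))\<bar> \<le> 2"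
    by (smt (verit, best))
  then have "m * \<bar>smooth_step' (m * (x - a)) * smooth_step (m * (b - x)) - smooth_step (m * (x - a)) * smooth_step' (m * (b - x))\<bar> \<le> m * 2"
    using m by (rule mult_left_mono)
  also have "m * \<bar>smooth_step' (m * (x - a)) * smooth_step (m * (b - x)) - smooth_step (m * (x - a)) * smooth_step' (m * (b - x))\<bar>
      = \<bar>m * (smooth_step' (m * (x - a)) * smooth_step (m * (b - x)) - smooth_step (m * (x - a)) * smooth_step' (m * (b - x)))\<bar>"
    using m by (simp add: abs_mult)
  also have "m * (smooth_step' (m * (x - a)) * smooth_step (m * (b - x)) - smooth_step (m * (x - a)) * smooth_step' (m * (b - x))) = bump' m a b x"
    unfolding bump'_def by (simp only: right_diff_distrib mult.assoc)
  finally show ?thesis by simp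
qed

lemma bump_limit: "(\<lambda>n. bump (real n) a b x) \<longlonglongrightarrow> indicator {a<..<b} x"
proof (cases "x \<in> {a<..<b}")
  case True
  then obtain n1 n2 where n: "3 < real n1 * (x - a)" "3 < real n2 * (b - x)" using reals_Archimedean3 by (metis diff_gt_0_iff_gt greaterThanLessThan_iff)
  have "\<forall>\<^sub>F n in sequentially. bump (real n) a b x = 1"
    unfolding eventually_sequentially
  proof (intro exI allI impI)
    fix n assume "max n1 n2 \<le> n"
    then have "real n1 * (x - a) \<le> real n * (x - a)" "real n2 * (b - x) \<le> real n * (b - x)"
      using True by (auto intro!: mult_right_mono)
    then show "bump (real n) a b x = 1" using n by (simp add: bump_def smooth_step_eq_1)
  qed
  then show ?thesis using True by (simp add: tendsto_eventually)
next
  case False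
  then show ?thesis using bump_zero(1)[of "real n" x a b for n] by simp
qed

lemma emeasure_moving_strip:
  fixes c :: real
  assumes "a \<le> b" "p \<le> q"
  shows "emeasure lborel {(x, t). a \<le> t \<and> t \<le> b \<and> p \<le> x - c * t \<and> x - c * t \<le> q} = ennreal ((b - a) * (q - p))"
    "compact {(x, t). a \<le> t \<and> t \<le> b \<and> p \<le> x - c * t \<and> x - c * t \<le> q}"
proof -
  let ?S = "{(x, t). a \<le> t \<and> t \<le> b \<and> p \<le> x - c * t \<and> x - c * t \<le> q}"
  have im: "?S = (\<lambda>(y, t). (y + c * t, t)) ` ({p..q} \<times> {a..b})"
  proof (intro set_eqI iffI)
    fix z assume "z \<in> ?S"
    then have "z = (\<lambda>(y, t). (y + c * t, t)) (fst z - c * snd z, snd z)" "(fst z - c * snd z, snd z) \<in> {p..q} \<times> {a..b}" by auto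
    then show "z \<in> (\<lambda>(y, t). (y + c * t, t)) ` ({p..q} \<times> {a..b})" by (rule image_eqI)
  qed auto
  show c: "compact ?S" unfolding im case_prod_beta
    by (intro compact_continuous_image compact_Times compact_Icc continuous_intros)
  then have "?S \<in> sets lborel" by (simp add: compact_imp_closed)
  then have S: "?S \<in> sets (lborel \<Otimes>\<^sub>M lborel)" by (subst lborel_prod)
  have "emeasure lborel ?S = (\<integral>\<^sup>+t. emeasure lborel ((\<lambda>x. (x, t)) -` ?S) \<partial>lborel)"
    using lborel_pair.emeasure_pair_measure_alt2[OF S] by (simp add: lborel_prod)
  also have "\<dots> = (\<integral>\<^sup>+t. ennreal (q - p) * indicator {a..b} t \<partial>lborel)"
  proof (rule nn_integral_cong)
    fix t
    have "(\<lambda>x. (x, t)) -` ?S = (if t \<in> {a..b} then {p + c * t..q + c * t} else {})" by auto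
    then show "emeasure lborel ((\<lambda>x. (x, t)) -` ?S) = ennreal (q - p) * indicator {a..b} t"
      using assms by simp
  qed
  also have "\<dots> = ennreal ((b - a) * (q - p))"
    using assms by (simp add: nn_integral_cmult_indicator ennreal_mult'[symmetric] mult.commute)
  finally show "emeasure lborel ?S = ennreal ((b - a) * (q - p))" .
qed

section \<open>Weak continuity in time\<close>

text \<open>\<open>un\<close> collects Borel representatives of the approximating solutions along
  the subsequence. Each of them is bounded, with a bound depending on \<open>n\<close>; the uniform
  estimate is the bound \<open>Bd\<close> for \<open>f w - C * w\<close>.\<close>

locale approximation = halfline_C1 f for f +
  fixes T C Bd :: real and un :: "nat \<Rightarrow> real \<times> real \<Rightarrow> real" and u :: "(real \<times> real) measure" and U :: "real \<Rightarrow> real measure"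
  assumes T: "0 < T" and bd: "\<And>w. 0 \<le> w \<Longrightarrow> \<bar>f w - C * w\<bar> \<le> Bd"
    and un_meas [measurable]: "\<And>n. un n \<in> borel_measurable borel" and un_nonneg: "\<And>n p. 0 \<le> un n p" and un_bdd: "\<And>n. \<exists>B. \<forall>p. un n p \<le> B"
    and weak: "\<And>n s. subconserved T (\<lambda>p. s * un n p) (\<lambda>p. s * f (un n p))"
    and u: "u \<in> Radon_pos (strip T)"
    and conv: "\<And>z K. continuous_on UNIV z \<Longrightarrow> compact K \<Longrightarrow> K \<subseteq> strip T \<Longrightarrow> (\<forall>p. p \<notin> K \<longrightarrow> z p = 0) \<Longrightarrow>
      (\<lambda>n. \<integral>p. z p * un n p \<partial>lborel) \<longlonglongrightarrow> (\<integral>p. z p \<partial>u)"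
    and U: "time_slices T u U"
begin

definition moving_bump :: "real \<Rightarrow> real \<Rightarrow> real \<Rightarrow> real \<times> real \<Rightarrow> real" where
  "moving_bump m \<alpha> \<beta> p = bump m \<alpha> \<beta> (fst p - C * snd p)"

definition moving_mass :: "real \<Rightarrow> real \<Rightarrow> real \<Rightarrow> nat \<Rightarrow> real \<Rightarrow> real" where
  "moving_mass m \<alpha> \<beta> n t = (\<integral>x. moving_bump m \<alpha> \<beta> (x, t) * un n (x, t) \<partial>lborel)"

definition slice_mass :: "real \<Rightarrow> real \<Rightarrow> real \<Rightarrow> real \<Rightarrow> real" where
  "slice_mass m \<alpha> \<beta> t = (\<integral>x. moving_bump m \<alpha> \<beta> (x, t) \<partial>U t)"

text \<open>A bound for the rate of change of \<open>moving_mass\<close>, uniform in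
  \<open>n\<close>: slope \<open>2 * m\<close> of the bump times flux \<open>Bd\<close> in the
  moving frame times the length of the interval.\<close>

definition lipschitz_const :: "real \<Rightarrow> real \<Rightarrow> real \<Rightarrow> real" where
  "lipschitz_const m \<alpha> \<beta> = 2 * m * Bd * (\<beta> - \<alpha>)"

lemma Bd_nonneg: "0 \<le> Bd"
  using bd[of 0] by linarith

lemma moving_bump_cont: "continuous_on S (moving_bump m \<alpha> \<beta>)"
  unfolding moving_bump_def by (intro continuous_on_compose2[OF bump_cont(1)[of UNIV]] continuous_intros) auto

lemma moving_bump_meas [measurable]: "moving_bump m \<alpha> \<beta> \<in> borel_measurable borel"
  by (rule borel_measurable_continuous_onI[OF moving_bump_cont])

context
  fixes m \<alpha> \<beta> a' a b :: real
  assumes m: "0 \<le> m" and ab: "\<alpha> < \<beta>" and t: "0 < a'" "a' < a" "a < b" "b < T"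
begin

definition S where "S = {(x, s). a' \<le> s \<and> s \<le> b \<and> \<alpha> \<le> x - C * s \<and> x - C * s \<le> \<beta>}"

lemma S: "emeasure lborel S = ennreal ((b - a') * (\<beta> - \<alpha>))" "compact S" "S \<subseteq> strip T" "S \<in> sets borel"
proof -
  show "emeasure lborel S = ennreal ((b - a') * (\<beta> - \<alpha>))" "compact S"
    unfolding S_def using emeasure_moving_strip[of a' b \<alpha> \<beta> C] t ab by auto
  then show "S \<in> sets borel" by (simp add: compact_imp_closed)
  show "S \<subseteq> strip T" using t by (auto simp: S_def strip_def)
qed

lemma window_out:
  assumes "p \<notin> S" shows "snd p \<notin> {a'..b} \<or> fst p - C * snd p \<notin> {\<alpha><..<\<beta>}"
  using assms by (cases p) (auto simp: S_def)

lemma integrable_window: "integrable lborel (\<lambda>p. c * indicator S p :: real)"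
  using S by (intro integrable_mult_right integrable_real_indicator) auto

lemma slice_integral:
  assumes z [measurable]: "z \<in> borel_measurable borel" and zb: "\<And>t. \<bar>z t\<bar> \<le> Z" and z0: "\<And>t. t \<notin> {a'..b} \<Longrightarrow> z t = 0"
  shows "integrable lborel (\<lambda>t. z t * moving_mass m \<alpha> \<beta> n t)"
    "(\<integral>t. z t * moving_mass m \<alpha> \<beta> n t \<partial>lborel) = (\<integral>p. z (snd p) * moving_bump m \<alpha> \<beta> p * un n p \<partial>lborel)"
proof -
  obtain B where B: "\<And>p. un n p \<le> B" using un_bdd by blast
  have Z0: "0 \<le> Z" using zb[of 0] by linarith
  have B0: "0 \<le> B" using B un_nonneg order_trans by blast
  have "integrable lborel (\<lambda>p. z (snd p) * moving_bump m \<alpha> \<beta> p * un n p)"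
  proof (rule Bochner_Integration.integrable_bound[OF integrable_window[of "Z * B"]])
    show "AE p in lborel. norm (z (snd p) * moving_bump m \<alpha> \<beta> p * un n p) \<le> norm (Z * B * indicator S p)"
    proof (rule AE_I2)
      fix p
      show "norm (z (snd p) * moving_bump m \<alpha> \<beta> p * un n p) \<le> norm (Z * B * indicator S p)"
      proof (cases "p \<in> S")
        case True
        have "\<bar>z (snd p)\<bar> * \<bar>moving_bump m \<alpha> \<beta> p\<bar> * \<bar>un n p\<bar> \<le> Z * 1 * B"
          using zb[of "snd p"] B[of p] un_nonneg[of n p] bump_bounds[of m \<alpha> \<beta> "fst p - C * snd p"] Z0
          by (intro mult_mono) (auto simp: moving_bump_def)
        then show ?thesis using True Z0 B0 by (simp add: abs_mult)
      next
        case False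
        then have "z (snd p) = 0 \<or> moving_bump m \<alpha> \<beta> p = 0"
          using window_out[OF False] z0 bump_zero(1)[OF m] by (auto simp: moving_bump_def)
        then show ?thesis by auto
      qed
    qed
  qed measurable
  then have I: "integrable (lborel \<Otimes>\<^sub>M lborel) (case_prod (\<lambda>x t. z t * moving_bump m \<alpha> \<beta> (x, t) * un n (x, t)))"
    by (simp add: lborel_prod case_prod_unfold)
  have e: "(\<integral>x. z t * moving_bump m \<alpha> \<beta> (x, t) * un n (x, t) \<partial>lborel) = z t * moving_mass m \<alpha> \<beta> n t" for t
    by (simp add: moving_mass_def mult.assoc)
  show "integrable lborel (\<lambda>t. z t * moving_mass m \<alpha> \<beta> n t)"
    using lborel_pair.integrable_snd[OF I] by (simp add: e)
  show "(\<integral>t. z t * moving_mass m \<alpha> \<beta> n t \<partial>lborel) = (\<integral>p. z (snd p) * moving_bump m \<alpha> \<beta> p * un n p \<partial>lborel)"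
    using lborel_pair.integral_snd[OF I] by (simp add: e lborel_prod case_prod_unfold)
qed

text \<open>The equation is tested with th(t) bump(x - C t), where th' = w - z. The part C u of the
  flux cancels against the motion of the frame, and the remaining flux f(u) - C u is at most
  \<open>Bd\<close>. Two time averages of equal weight therefore differ by an amount that does not
  involve the size of \<open>un\<close>.\<close>

lemma time_increment:
  assumes z: "continuous_on UNIV z" "\<And>t. 0 \<le> z t" "\<And>t. t \<notin> {a..b} \<Longrightarrow> z t = 0"
    and w: "continuous_on UNIV w" "\<And>t. 0 \<le> w t" "\<And>t. t \<notin> {a'..a} \<Longrightarrow> w t = 0"
    and eq: "(\<integral>t. z t \<partial>lborel) = Z" "(\<integral>t. w t \<partial>lborel) = Z"
  shows "\<bar>\<integral>p. (w (snd p) - z (snd p)) * moving_bump m \<alpha> \<beta> p * un n p \<partial>lborel\<bar> \<le> Z * lipschitz_const m \<alpha> \<beta> * (b - a')"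
proof -
  obtain th where th: "\<And>t. (th has_real_derivative w t - z t) (at t)" "\<And>t. 0 \<le> th t" "\<And>t. th t \<le> Z" "\<And>t. t \<notin> {a'..b} \<Longrightarrow> th t = 0"
    using antiderivative_bump[OF t(2,3) z w eq] by metis
  have Z0: "0 \<le> Z" using th(2,3) order_trans by blast
  have thc: "continuous_on UNIV th" using th(1) by (meson DERIV_isCont continuous_at_imp_continuous_on)
  have [measurable]: "th \<in> borel_measurable borel" "bump' m \<alpha> \<beta> \<in> borel_measurable borel"
    using thc bump_cont(2) by (auto intro: borel_measurable_continuous_onI)
  obtain B where B: "\<And>p. un n p \<le> B" using un_bdd by blast
  have B0: "0 \<le> B" using B un_nonneg order_trans by blast
  define gt where "gt = (\<lambda>p. (w (snd p) - z (snd p)) * moving_bump m \<alpha> \<beta> p - C * th (snd p) * bump' m \<alpha> \<beta> (fst p - C * snd p))"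
  define gx where "gx = (\<lambda>p. th (snd p) * bump' m \<alpha> \<beta> (fst p - C * snd p))"
  have "test_fn T (\<lambda>(x, t). th t * 1 * bump m \<alpha> \<beta> (x - C * t))
    (\<lambda>(x, t). (w t - z t) * 1 * bump m \<alpha> \<beta> (x - C * t) - C * th t * 1 * bump' m \<alpha> \<beta> (x - C * t))
    (\<lambda>(x, t). th t * 0 * bump m \<alpha> \<beta> (x - C * t) + th t * 1 * bump' m \<alpha> \<beta> (x - C * t))"
  proof (rule test_fn_product[where K = S])
    show "(bump m \<alpha> \<beta> has_real_derivative bump' m \<alpha> \<beta> s) (at s)" "(bump' m \<alpha> \<beta> has_real_derivative bump'' m \<alpha> \<beta> s) (at s)" for s
      by (rule bump_deriv)+
    show "continuous_on UNIV (\<lambda>t. w t - z t)" by (intro continuous_intros z w)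
    show "th t * 1 * bump m \<alpha> \<beta> (x - C * t) = 0" if "(x, t) \<notin> S" for x t
      using window_out[OF that] th(4) bump_zero(1)[OF m] by auto
  qed (use th S bump_cont in auto)
  then have tf: "test_fn T (\<lambda>p. th (snd p) * moving_bump m \<alpha> \<beta> p) gt gx"
    by (simp add: gt_def gx_def moving_bump_def case_prod_unfold)
  have g0: "0 \<le> th (snd p) * moving_bump m \<alpha> \<beta> p" for p using th(2) bump_bounds by (simp add: moving_bump_def)
  \<comment> \<open>The values 1 and -1 of \<open>s\<close> turn the inequality into an
    equation.\<close>
  have "0 \<le> (\<integral>p. s * un n p * gt p + s * f (un n p) * gx p \<partial>lborel)" for s
    using weak[of s n] tf g0 unfolding subconserved_def by blast
  from this[of 1] this[of "-1"] have E: "(\<integral>p. un n p * gt p + f (un n p) * gx p \<partial>lborel) = 0"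
  proof -
    assume 1: "0 \<le> (\<integral>p. 1 * un n p * gt p + 1 * f (un n p) * gx p \<partial>lborel)"
      and 2: "0 \<le> (\<integral>p. (-1) * un n p * gt p + (-1) * f (un n p) * gx p \<partial>lborel)"
    have "(\<lambda>p. (-1) * un n p * gt p + (-1) * f (un n p) * gx p) = (\<lambda>p. - (un n p * gt p + f (un n p) * gx p))" by auto
    with 2 have "0 \<le> - (\<integral>p. un n p * gt p + f (un n p) * gx p \<partial>lborel)" by (simp only: Bochner_Integration.integral_minus)
    with 1 show ?thesis by simp
  qed
  \<comment> \<open>The flux relative to the moving frame. It is written with \<open>fe\<close> so
    that measurability does not depend on \<open>f\<close> at negative arguments.\<close>
  define k where "k = (\<lambda>p. (fe (un n p) - C * un n p) * gx p)"
  have kb: "\<bar>k p\<bar> \<le> Bd * Z * (2 * m) * indicator S p" for p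
  proof (cases "p \<in> S")
    case True
    have "\<bar>fe (un n p) - C * un n p\<bar> * (\<bar>th (snd p)\<bar> * \<bar>bump' m \<alpha> \<beta> (fst p - C * snd p)\<bar>) \<le> Bd * (Z * (2 * m))"
      using bd[OF un_nonneg[of n p]] th(2,3)[of "snd p"] bump'_bound[OF m, of \<alpha> \<beta> "fst p - C * snd p"] Bd_nonneg Z0 m
      by (intro mult_mono) (auto simp: fe_eq un_nonneg)
    then show ?thesis using True by (simp add: k_def gx_def abs_mult mult.assoc)
  next
    case False
    then have "gx p = 0" using window_out[OF False] th(4) bump_zero(2)[OF m] by (auto simp: gx_def)
    then show ?thesis using False by (simp add: k_def)
  qed
  have km: "k \<in> borel_measurable borel" unfolding k_def gx_def by measurable
  have ki: "integrable lborel k"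
    by (rule Bochner_Integration.integrable_bound[OF integrable_window[of "Bd * Z * (2 * m)"]])
       (use kb km Bd_nonneg Z0 m in \<open>auto intro!: AE_I2 simp: abs_mult\<close>)
  define l where "l = (\<lambda>p. (w (snd p) - z (snd p)) * moving_bump m \<alpha> \<beta> p * un n p)"
  have "un n p * gt p + f (un n p) * gx p = l p + k p" for p
    by (simp add: l_def k_def gt_def gx_def fe_eq un_nonneg algebra_simps)
  with E have E': "(\<integral>p. l p + k p \<partial>lborel) = 0" by simp
  have li: "integrable lborel l"
  proof -
    have wz0: "w t - z t = 0" if "t \<notin> {a'..b}" for t using that z(3)[of t] w(3)[of t] t by auto
    have "compact ((\<lambda>t. w t - z t) ` {a'..b})"
      by (intro compact_continuous_image continuous_intros continuous_on_subset[OF w(1)] continuous_on_subset[OF z(1)]) auto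
    then obtain D where D: "\<forall>t\<in>{a'..b}. \<bar>w t - z t\<bar> \<le> D" by (metis (no_types) bounded_real compact_imp_bounded imageI)
    have D': "\<bar>w t - z t\<bar> \<le> \<bar>D\<bar>" for t using D wz0[of t] by (cases "t \<in> {a'..b}") force+
    have [measurable]: "w \<in> borel_measurable borel" "z \<in> borel_measurable borel" using w z by (auto intro: borel_measurable_continuous_onI)
    show ?thesis
    proof (rule Bochner_Integration.integrable_bound[OF integrable_window[of "\<bar>D\<bar> * B"]])
      show "l \<in> borel_measurable lborel" unfolding l_def by measurable
      show "AE p in lborel. norm (l p) \<le> norm (\<bar>D\<bar> * B * indicator S p)"
      proof (rule AE_I2)
        fix p
        show "norm (l p) \<le> norm (\<bar>D\<bar> * B * indicator S p)"
        proof (cases "p \<in> S")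
          case True
          have "\<bar>w (snd p) - z (snd p)\<bar> * \<bar>moving_bump m \<alpha> \<beta> p\<bar> * \<bar>un n p\<bar> \<le> \<bar>D\<bar> * 1 * B"
            using D'[of "snd p"] B[of p] un_nonneg[of n p] bump_bounds[of m \<alpha> \<beta> "fst p - C * snd p"]
            by (intro mult_mono) (auto simp: moving_bump_def)
          then show ?thesis using True B0 by (simp add: abs_mult l_def)
        next
          case False
          then show ?thesis using window_out[OF False] wz0 bump_zero(1)[OF m] by (auto simp: l_def moving_bump_def)
        qed
      qed
    qed
  qed
  have "(\<integral>p. l p \<partial>lborel) = - (\<integral>p. k p \<partial>lborel)" using E' li ki by simp
  then have "\<bar>\<integral>p. l p \<partial>lborel\<bar> = \<bar>\<integral>p. k p \<partial>lborel\<bar>" by simp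
  also have "\<dots> \<le> (\<integral>p. \<bar>k p\<bar> \<partial>lborel)" by (rule integral_abs_bound)
  also have "\<dots> \<le> (\<integral>p. Bd * Z * (2 * m) * indicator S p \<partial>lborel)"
    using ki kb by (intro integral_mono integrable_abs integrable_window) auto
  also have "\<dots> = Bd * Z * (2 * m) * ((b - a') * (\<beta> - \<alpha>))"
    using S t ab by (simp add: measure_def)
  also have "\<dots> = Z * lipschitz_const m \<alpha> \<beta> * (b - a')" by (simp add: lipschitz_const_def)
  finally show ?thesis unfolding l_def .
qed

end

end

lemma integrable_lebesgue_on_borel_version:
  fixes F :: "real \<Rightarrow> real"
  assumes F: "integrable (lebesgue_on S) F" and S: "S \<in> sets borel"
  obtains h where "integrable lborel h" "AE t in lborel. t \<in> S \<longrightarrow> F t = h t" "\<And>t. t \<notin> S \<Longrightarrow> h t = 0"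
proof -
  have SL: "S \<in> sets lebesgue" using S by simp
  have I: "integrable lebesgue (\<lambda>t. indicator S t *\<^sub>R F t)"
    using F SL by (simp add: integrable_restrict_space)
  then have "(\<lambda>t. indicator S t *\<^sub>R F t) \<in> borel_measurable (completion lborel)" by (rule borel_measurable_integrable)
  then obtain g where g [measurable]: "g \<in> borel_measurable lborel" and ae: "AE t in lborel. indicator S t *\<^sub>R F t = g t"
    using completion_ex_borel_measurable_real by blast
  define h where "h t = indicator S t * g t" for t
  have hm [measurable]: "h \<in> borel_measurable lborel" unfolding h_def using S g by measurable
  have aeh: "AE t in lborel. indicator S t *\<^sub>R F t = h t"
    using ae by eventually_elim (auto simp: h_def indicator_def)
  have "integrable lebesgue h"
    by (rule Bochner_Integration.integrable_cong_AE[THEN iffD1, OF _ _ _ I])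
       (use aeh AE_completion[OF aeh] borel_measurable_integrable[OF I] measurable_completion[OF hm] in auto)
  then have "integrable lborel h" using integrable_completion[OF hm] by blast
  then show ?thesis
    by (rule that) (use aeh in eventually_elim, auto simp: h_def indicator_def)
qed

section \<open>Comparison with an average over earlier times\<close>

context approximation
begin

context
  fixes m \<alpha> \<beta> a' a b :: real
  assumes m: "0 \<le> m" and ab: "\<alpha> < \<beta>" and t: "0 < a'" "a' < a" "a < b" "b < T"
begin

text \<open>A probability density on the times in [a', a], before the window (a, b). Both the
  approximations and the limit are compared with this one average, which avoids values at single
  times.\<close>

definition unit_pulse :: "real \<Rightarrow> real" where
  "unit_pulse s = pulse (a - a') (s - a') / (\<integral>s. pulse (a - a') s \<partial>lborel)"

lemma unit_pulse: "continuous_on UNIV unit_pulse" "0 \<le> unit_pulse s" "s \<notin> {a'..a} \<Longrightarrow> unit_pulse s = 0" "(\<integral>s. unit_pulse s \<partial>lborel) = 1" "\<exists>W. \<forall>s. \<bar>unit_pulse s\<bar> \<le> W"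
proof -
  let ?e = "a - a'"
  have e: "0 < ?e" using t by simp
  have oc: "continuous_on UNIV (pulse ?e)" using continuous_on_pulse(1)[OF continuous_on_id, of UNIV ?e] by (simp add: id_def)
  have oi: "integrable lborel (\<lambda>s. 1 * pulse ?e s)"
    by (rule integrable_bounded_times_compact[where K = "{0..?e}" and M = 1]) (use oc in \<open>auto simp: pulse_eq_0\<close>)
  then have "(\<integral>\<^sup>+s. ennreal (pulse ?e s) \<partial>lborel) = ennreal (\<integral>s. pulse ?e s \<partial>lborel)"
    by (intro nn_integral_eq_integral) (auto simp: pulse_nonneg)
  with pulse_pos_mass(1)[OF e] have ne: "(\<integral>s. pulse ?e s \<partial>lborel) \<noteq> 0" by auto
  moreover have "0 \<le> (\<integral>s. pulse ?e s \<partial>lborel)" by (intro integral_nonneg_AE AE_I2 pulse_nonneg)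
  ultimately have pos: "0 < (\<integral>s. pulse ?e s \<partial>lborel)" by simp
  show c: "continuous_on UNIV unit_pulse" unfolding unit_pulse_def by (intro continuous_intros) (use ne in auto)
  show "0 \<le> unit_pulse s" using pos pulse_nonneg by (simp add: unit_pulse_def)
  show z: "s \<notin> {a'..a} \<Longrightarrow> unit_pulse s = 0" for s by (auto simp: unit_pulse_def pulse_eq_0)
  show "(\<integral>s. unit_pulse s \<partial>lborel) = 1"
    unfolding unit_pulse_def using translation_lborel(1)[of "pulse ?e" "- a'"] ne by simp
  have "compact (unit_pulse ` {a'..a})" by (intro compact_continuous_image continuous_on_subset[OF c]) auto
  then obtain D where D: "\<forall>s\<in>{a'..a}. \<bar>unit_pulse s\<bar> \<le> D" by (metis (no_types) bounded_real compact_imp_bounded imageI)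
  have "\<bar>unit_pulse s\<bar> \<le> \<bar>D\<bar>" for s using D z[of s] by (cases "s \<in> {a'..a}") force+
  then show "\<exists>W. \<forall>s. \<bar>unit_pulse s\<bar> \<le> W" by blast
qed

definition past_mass :: "nat \<Rightarrow> real" where "past_mass n = (\<integral>p. unit_pulse (snd p) * moving_bump m \<alpha> \<beta> p * un n p \<partial>lborel)"

definition past_slice_mass :: real where "past_slice_mass = (\<integral>p. unit_pulse (snd p) * moving_bump m \<alpha> \<beta> p \<partial>u)"

text \<open>An arbitrary test function \<open>z\<close> in the window is paired with the earlier
  pulse of the same mass \<open>Z\<close>, as \<open>time_increment\<close> demands; since
  \<open>z\<close> is arbitrary, estimates almost everywhere in the window result.\<close>

lemma test_props:
  assumes z: "continuous_on UNIV z" "\<forall>s. 0 \<le> z s \<and> z s \<le> 1" and K: "K \<subseteq> {a<..<b}" "\<forall>s. s \<notin> K \<longrightarrow> z s = 0"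
  defines "Z \<equiv> \<integral>s. z s \<partial>lborel"
  shows "\<bar>\<integral>p. (Z * unit_pulse (snd p) - z (snd p)) * moving_bump m \<alpha> \<beta> p * un n p \<partial>lborel\<bar> \<le> Z * lipschitz_const m \<alpha> \<beta> * (b - a')"
    "z s \<noteq> 0 \<Longrightarrow> s \<in> {a<..<b}" "0 \<le> Z"
proof -
  show z0: "s \<in> {a<..<b}" if "z s \<noteq> 0" for s using K that by blast
  show Z0: "0 \<le> Z" unfolding Z_def by (intro integral_nonneg_AE AE_I2) (use z in auto)
  show "\<bar>\<integral>p. (Z * unit_pulse (snd p) - z (snd p)) * moving_bump m \<alpha> \<beta> p * un n p \<partial>lborel\<bar> \<le> Z * lipschitz_const m \<alpha> \<beta> * (b - a')"
  proof (rule time_increment[OF m ab t, where w = "\<lambda>s. Z * unit_pulse s" and z = z])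
    show "z s = 0" if "s \<notin> {a..b}" for s using z0[of s] that by fastforce
    show "Z * unit_pulse s = 0" if "s \<notin> {a'..a}" for s using unit_pulse(3)[OF that] by simp
    show "continuous_on UNIV (\<lambda>s. Z * unit_pulse s)" by (intro continuous_intros unit_pulse)
    show "(\<integral>s. Z * unit_pulse s \<partial>lborel) = Z" using unit_pulse(4) by simp
  qed (use z Z0 unit_pulse Z_def in auto)
qed

lemma moving_mass_lower: "AE s in lborel. s \<in> {a<..<b} \<longrightarrow> past_mass n - lipschitz_const m \<alpha> \<beta> * (b - a') \<le> moving_mass m \<alpha> \<beta> n s"
proof -
  obtain W where W: "\<And>s. \<bar>unit_pulse s\<bar> \<le> W" using unit_pulse(5) by blast
  have [measurable]: "unit_pulse \<in> borel_measurable borel" using unit_pulse(1) by (rule borel_measurable_continuous_onI)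
  \<comment> \<open>\<open>le_const_from_test\<close> yields upper bounds, so it is applied to the
    negative of the mass; the indicator makes that function integrable on the whole line.\<close>
  have "AE s in lborel. s \<in> {a<..<b} \<longrightarrow> - (indicator {a..b} s * moving_mass m \<alpha> \<beta> n s) \<le> - (past_mass n - lipschitz_const m \<alpha> \<beta> * (b - a'))"
  proof (rule le_const_from_test)
    show "integrable lborel (\<lambda>s. - (indicator {a..b} s * moving_mass m \<alpha> \<beta> n s))"
      by (intro Bochner_Integration.integrable_minus slice_integral(1)[OF m ab t, where Z = 1])
         (use t in \<open>auto simp: indicator_def\<close>)
    fix z :: "real \<Rightarrow> real" and K
    assume z: "continuous_on UNIV z" "\<forall>s. 0 \<le> z s \<and> z s \<le> 1" and K: "compact K" "K \<subseteq> {a<..<b}" "\<forall>s. s \<notin> K \<longrightarrow> z s = 0"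
    define Z where "Z = (\<integral>s. z s \<partial>lborel)"
    note tp = test_props[OF z K(2,3), folded Z_def]
    have [measurable]: "z \<in> borel_measurable borel" using z(1) by (rule borel_measurable_continuous_onI)
    have z0: "z s = 0" if "s \<notin> {a'..b}" for s using tp(2)[of s] that t by fastforce
    have iw: "integrable lborel (\<lambda>s. unit_pulse s * moving_mass m \<alpha> \<beta> n s)" "(\<integral>s. unit_pulse s * moving_mass m \<alpha> \<beta> n s \<partial>lborel) = past_mass n"
    proof -
      have wl0: "unit_pulse s = 0" if "s \<notin> {a'..b}" for s by (rule unit_pulse(3)) (use that t in auto)
      have wm: "unit_pulse \<in> borel_measurable borel" by measurable
      show "integrable lborel (\<lambda>s. unit_pulse s * moving_mass m \<alpha> \<beta> n s)" by (rule slice_integral(1)[OF m ab t wm W wl0])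
      show "(\<integral>s. unit_pulse s * moving_mass m \<alpha> \<beta> n s \<partial>lborel) = past_mass n" unfolding past_mass_def by (rule slice_integral(2)[OF m ab t wm W wl0])
    qed
    have iz: "integrable lborel (\<lambda>s. z s * moving_mass m \<alpha> \<beta> n s)"
      using slice_integral(1)[OF m ab t, of z 1 n] z(2) z0 by auto
    have "(\<integral>p. (Z * unit_pulse (snd p) - z (snd p)) * moving_bump m \<alpha> \<beta> p * un n p \<partial>lborel) = (\<integral>s. (Z * unit_pulse s - z s) * moving_mass m \<alpha> \<beta> n s \<partial>lborel)"
    proof (rule slice_integral(2)[OF m ab t, where Z = "\<bar>Z\<bar> * W + 1", symmetric])
      show "\<bar>Z * unit_pulse s - z s\<bar> \<le> \<bar>Z\<bar> * W + 1" for s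
      proof -
        have "\<bar>Z * unit_pulse s\<bar> \<le> \<bar>Z\<bar> * W" using W[of s] by (simp add: abs_mult mult_left_mono)
        moreover have "\<bar>z s\<bar> \<le> 1" using z(2) by simp
        ultimately show ?thesis by linarith
      qed
      show "Z * unit_pulse s - z s = 0" if "s \<notin> {a'..b}" for s using z0[OF that] unit_pulse(3)[of s] that t by auto
    qed measurable
    also have "\<dots> = (\<integral>s. Z * (unit_pulse s * moving_mass m \<alpha> \<beta> n s) - z s * moving_mass m \<alpha> \<beta> n s \<partial>lborel)" by (simp add: algebra_simps)
    also have "\<dots> = Z * past_mass n - (\<integral>s. z s * moving_mass m \<alpha> \<beta> n s \<partial>lborel)" using iw iz by simp
    finally have "Z * past_mass n - (\<integral>s. z s * moving_mass m \<alpha> \<beta> n s \<partial>lborel) \<le> Z * lipschitz_const m \<alpha> \<beta> * (b - a')" using tp(1)[of n] by linarith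
    moreover have "(\<integral>s. z s * - (indicator {a..b} s * moving_mass m \<alpha> \<beta> n s) \<partial>lborel) = - (\<integral>s. z s * moving_mass m \<alpha> \<beta> n s \<partial>lborel)"
    proof -
      have "(\<lambda>s. z s * - (indicator {a..b} s * moving_mass m \<alpha> \<beta> n s)) = (\<lambda>s. - (z s * moving_mass m \<alpha> \<beta> n s))"
        using tp(2) by (fastforce simp: indicator_def)
      then show ?thesis by simp
    qed
    ultimately show "(\<integral>s. z s * - (indicator {a..b} s * moving_mass m \<alpha> \<beta> n s) \<partial>lborel) \<le> - (past_mass n - lipschitz_const m \<alpha> \<beta> * (b - a')) * (\<integral>s. z s \<partial>lborel)"
      unfolding Z_def[symmetric] by (simp add: algebra_simps)
  qed auto
  then show ?thesis by (rule eventually_mono) (auto simp: indicator_def)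
qed

lemma past_mass_tendsto: "past_mass \<longlonglongrightarrow> past_slice_mass"
proof -
  have "(\<lambda>n. \<integral>p. (unit_pulse (snd p) * moving_bump m \<alpha> \<beta> p) * un n p \<partial>lborel) \<longlonglongrightarrow> (\<integral>p. unit_pulse (snd p) * moving_bump m \<alpha> \<beta> p \<partial>u)"
  proof (rule conv[OF _ S(2)[OF m ab t] S(3)[OF m ab t]])
    show "continuous_on UNIV (\<lambda>p. unit_pulse (snd p) * moving_bump m \<alpha> \<beta> p)"
      by (intro continuous_intros moving_bump_cont continuous_on_compose2[OF unit_pulse(1)]) auto
    show "\<forall>p. p \<notin> S \<alpha> \<beta> a' b \<longrightarrow> unit_pulse (snd p) * moving_bump m \<alpha> \<beta> p = 0"
    proof (intro allI impI)
      fix p assume p: "p \<notin> S \<alpha> \<beta> a' b"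
      show "unit_pulse (snd p) * moving_bump m \<alpha> \<beta> p = 0"
        using window_out[OF m ab t p] unit_pulse(3)[of "snd p"] bump_zero(1)[OF m] t by (auto simp: moving_bump_def)
    qed
  qed
  then show ?thesis unfolding past_mass_def past_slice_mass_def .
qed

text \<open>The estimate of \<open>test_props\<close> is linear in \<open>un\<close>, with a fixed
  continuous test function of compact support, so it passes to the weak limit. Disintegration of
  \<open>u\<close> into its slices then gives a bound for almost every time.\<close>

lemma slice_mass_upper: "AE s in lborel. s \<in> {a<..<b} \<longrightarrow> slice_mass m \<alpha> \<beta> s \<le> past_slice_mass + lipschitz_const m \<alpha> \<beta> * (b - a')"
proof -
  have su: "sets u = sets (restrict_space borel (strip T))" and fu: "finite_measure u" using u by (auto simp: Radon_pos_def)
  interpret finite_measure u by (rule fu)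
  have ui: "integrable u g" if "continuous_on UNIV g" "\<And>p. \<bar>g p\<bar> \<le> D" for g :: "real \<times> real \<Rightarrow> real" and D
  proof (rule integrable_const_bound[of _ D])
    show "g \<in> borel_measurable u"
      unfolding measurable_cong_sets[OF su refl]
      by (rule measurable_restrict_space1[OF borel_measurable_continuous_onI[OF that(1)]])
  qed (use that in auto)
  have mem: "(\<lambda>p. g (snd p) * moving_bump m \<alpha> \<beta> p) \<in> Cc (UNIV \<times> {0..T})" if "continuous_on UNIV g" for g
    unfolding Cc_def
  proof (intro CollectI conjI exI ballI)
    let ?K = "{(x, s). 0 \<le> s \<and> s \<le> T \<and> \<alpha> \<le> x - C * s \<and> x - C * s \<le> \<beta>}"
    show "continuous_on (UNIV \<times> {0..T}) (\<lambda>p. g (snd p) * moving_bump m \<alpha> \<beta> p)"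
      by (intro continuous_intros moving_bump_cont continuous_on_compose2[OF that]) auto
    show "compact ?K" using emeasure_moving_strip(2)[of 0 T \<alpha> \<beta> C] T ab by simp
    show "?K \<subseteq> UNIV \<times> {0..T}" by auto
    fix p assume "p \<in> UNIV \<times> {0..T} - ?K"
    then have "fst p - C * snd p \<notin> {\<alpha><..<\<beta>}" by (cases p) auto
    then show "g (snd p) * moving_bump m \<alpha> \<beta> p = 0" using bump_zero(1)[OF m] by (simp add: moving_bump_def)
  qed
  have sl: "integrable (lebesgue_on {0<..<T}) (\<lambda>s. g s * slice_mass m \<alpha> \<beta> s)"
    "(\<integral>p. g (snd p) * moving_bump m \<alpha> \<beta> p \<partial>u) = (\<integral>s. g s * slice_mass m \<alpha> \<beta> s \<partial>lebesgue_on {0<..<T})" if "continuous_on UNIV g" for g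
    using U mem[OF that] unfolding time_slices_def by (auto simp: slice_mass_def)
  have FI: "integrable (lebesgue_on {0<..<T}) (slice_mass m \<alpha> \<beta>)" using sl(1)[of "\<lambda>_. 1"] by simp
  obtain h where h: "integrable lborel h" "AE s in lborel. s \<in> {0<..<T} \<longrightarrow> slice_mass m \<alpha> \<beta> s = h s" "\<And>s. s \<notin> {0<..<T} \<Longrightarrow> h s = 0"
    using integrable_lebesgue_on_borel_version[OF FI] by (metis borel_open open_greaterThanLessThan)
  have [measurable]: "h \<in> borel_measurable borel" using h(1) by auto
  obtain W where W: "\<And>s. \<bar>unit_pulse s\<bar> \<le> W" using unit_pulse(5) by blast
  have "AE s in lborel. s \<in> {a<..<b} \<longrightarrow> h s \<le> past_slice_mass + lipschitz_const m \<alpha> \<beta> * (b - a')"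
  proof (rule le_const_from_test[OF h(1)])
    fix z :: "real \<Rightarrow> real" and K
    assume z: "continuous_on UNIV z" "\<forall>s. 0 \<le> z s \<and> z s \<le> 1" and K: "compact K" "K \<subseteq> {a<..<b}" "\<forall>s. s \<notin> K \<longrightarrow> z s = 0"
    define Z where "Z = (\<integral>s. z s \<partial>lborel)"
    note tp = test_props[OF z K(2,3), folded Z_def]
    have [measurable]: "z \<in> borel_measurable borel" using z(1) by (rule borel_measurable_continuous_onI)
    have z0: "z s = 0" if "s \<notin> {a'..b}" for s using tp(2)[of s] that t by fastforce
    have cz: "continuous_on UNIV (\<lambda>p. g (snd p) * moving_bump m \<alpha> \<beta> p)" if "continuous_on UNIV g" for g :: "real \<Rightarrow> real"
      by (intro continuous_intros moving_bump_cont continuous_on_compose2[OF that]) auto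
    have cw: "continuous_on UNIV (\<lambda>s. Z * unit_pulse s - z s)" by (intro continuous_intros unit_pulse z)
    have "(\<lambda>n. \<integral>p. ((Z * unit_pulse (snd p) - z (snd p)) * moving_bump m \<alpha> \<beta> p) * un n p \<partial>lborel)
        \<longlonglongrightarrow> (\<integral>p. (Z * unit_pulse (snd p) - z (snd p)) * moving_bump m \<alpha> \<beta> p \<partial>u)"
    proof (rule conv[OF cz[OF cw] S(2)[OF m ab t] S(3)[OF m ab t]], intro allI impI)
      fix p assume p: "p \<notin> S \<alpha> \<beta> a' b"
      show "(Z * unit_pulse (snd p) - z (snd p)) * moving_bump m \<alpha> \<beta> p = 0"
        using window_out[OF m ab t p] unit_pulse(3)[of "snd p"] z0[of "snd p"] bump_zero(1)[OF m] t by (auto simp: moving_bump_def)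
    qed
    then have "(\<lambda>n. \<bar>\<integral>p. (Z * unit_pulse (snd p) - z (snd p)) * moving_bump m \<alpha> \<beta> p * un n p \<partial>lborel\<bar>)
        \<longlonglongrightarrow> \<bar>\<integral>p. (Z * unit_pulse (snd p) - z (snd p)) * moving_bump m \<alpha> \<beta> p \<partial>u\<bar>" by (rule tendsto_rabs)
    then have "\<bar>\<integral>p. (Z * unit_pulse (snd p) - z (snd p)) * moving_bump m \<alpha> \<beta> p \<partial>u\<bar> \<le> Z * lipschitz_const m \<alpha> \<beta> * (b - a')"
      using tp(1) by (intro LIMSEQ_le_const2) auto
    moreover have "(\<integral>p. (Z * unit_pulse (snd p) - z (snd p)) * moving_bump m \<alpha> \<beta> p \<partial>u) = Z * past_slice_mass - (\<integral>p. z (snd p) * moving_bump m \<alpha> \<beta> p \<partial>u)"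
    proof -
      have iw: "integrable u (\<lambda>p. unit_pulse (snd p) * moving_bump m \<alpha> \<beta> p)"
      proof (rule ui[OF cz[OF unit_pulse(1)]])
        fix p have "\<bar>unit_pulse (snd p)\<bar> * \<bar>moving_bump m \<alpha> \<beta> p\<bar> \<le> W * 1"
          using W[of "snd p"] bump_bounds[of m \<alpha> \<beta> "fst p - C * snd p"] by (intro mult_mono) (auto simp: moving_bump_def)
        then show "\<bar>unit_pulse (snd p) * moving_bump m \<alpha> \<beta> p\<bar> \<le> W" by (simp add: abs_mult)
      qed
      have iz: "integrable u (\<lambda>p. z (snd p) * moving_bump m \<alpha> \<beta> p)"
      proof (rule ui[OF cz[OF z(1)]])
        fix p have "\<bar>z (snd p)\<bar> * \<bar>moving_bump m \<alpha> \<beta> p\<bar> \<le> 1 * 1"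
          using z(2) bump_bounds[of m \<alpha> \<beta> "fst p - C * snd p"] by (intro mult_mono) (auto simp: moving_bump_def)
        then show "\<bar>z (snd p) * moving_bump m \<alpha> \<beta> p\<bar> \<le> 1" by (simp add: abs_mult)
      qed
      have "(\<integral>p. (Z * unit_pulse (snd p) - z (snd p)) * moving_bump m \<alpha> \<beta> p \<partial>u) = (\<integral>p. Z * (unit_pulse (snd p) * moving_bump m \<alpha> \<beta> p) - z (snd p) * moving_bump m \<alpha> \<beta> p \<partial>u)"
        by (simp add: algebra_simps)
      also have "\<dots> = Z * past_slice_mass - (\<integral>p. z (snd p) * moving_bump m \<alpha> \<beta> p \<partial>u)" using iw iz by (simp add: past_slice_mass_def)
      finally show ?thesis .
    qed
    ultimately have "(\<integral>p. z (snd p) * moving_bump m \<alpha> \<beta> p \<partial>u) \<le> Z * past_slice_mass + Z * lipschitz_const m \<alpha> \<beta> * (b - a')" by linarith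
    also have "(\<integral>p. z (snd p) * moving_bump m \<alpha> \<beta> p \<partial>u) = (\<integral>s. z s * slice_mass m \<alpha> \<beta> s \<partial>lebesgue_on {0<..<T})" by (rule sl(2)[OF z(1)])
    also have "\<dots> = (\<integral>s. z s * h s \<partial>lborel)"
    proof (rule integral_lebesgue_on_eq_lborel)
      show "AE s in lborel. s \<in> {0<..<T} \<longrightarrow> z s * slice_mass m \<alpha> \<beta> s = z s * h s" using h(2) by eventually_elim auto
      show "(\<lambda>s. z s * slice_mass m \<alpha> \<beta> s) \<in> borel_measurable (lebesgue_on {0<..<T})" using sl(1)[OF z(1)] by auto
    qed (use h(3) in auto)
    finally show "(\<integral>s. z s * h s \<partial>lborel) \<le> (past_slice_mass + lipschitz_const m \<alpha> \<beta> * (b - a')) * (\<integral>s. z s \<partial>lborel)"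
      unfolding Z_def[symmetric] by (simp add: algebra_simps)
  qed auto
  with h(2) show ?thesis by eventually_elim (use t in auto)
qed

text \<open>The step from the slice at \<open>s\<close> back to the earlier average of
  \<open>u\<close> costs one Lipschitz term, the step from the average of \<open>un\<close> to the
  time \<open>s'\<close> another one; in between, the averages converge. The strict inequality pays
  for the convergence, and the threshold for \<open>n\<close> is the same for all
  \<open>s'\<close>.\<close>

lemma persistence:
  "AE s in lborel. s \<in> {a<..<b} \<longrightarrow> (\<forall>c. c + 2 * lipschitz_const m \<alpha> \<beta> * (b - a') < slice_mass m \<alpha> \<beta> s \<longrightarrow>
     (\<forall>\<^sub>F n in sequentially. AE s' in lborel. s' \<in> {a<..<b} \<longrightarrow> c < moving_mass m \<alpha> \<beta> n s'))"
  using slice_mass_upper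
proof (rule eventually_mono, intro impI allI)
  fix s c assume "s \<in> {a<..<b} \<longrightarrow> slice_mass m \<alpha> \<beta> s \<le> past_slice_mass + lipschitz_const m \<alpha> \<beta> * (b - a')" "s \<in> {a<..<b}"
    and "c + 2 * lipschitz_const m \<alpha> \<beta> * (b - a') < slice_mass m \<alpha> \<beta> s"
  then have "c + lipschitz_const m \<alpha> \<beta> * (b - a') < past_slice_mass" by simp
  with past_mass_tendsto have "\<forall>\<^sub>F n in sequentially. c + lipschitz_const m \<alpha> \<beta> * (b - a') < past_mass n" by (rule order_tendstoD(1))
  then show "\<forall>\<^sub>F n in sequentially. AE s' in lborel. s' \<in> {a<..<b} \<longrightarrow> c < moving_mass m \<alpha> \<beta> n s'"
  proof (rule eventually_mono)
    fix n assume "c + lipschitz_const m \<alpha> \<beta> * (b - a') < past_mass n"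
    then show "AE s' in lborel. s' \<in> {a<..<b} \<longrightarrow> c < moving_mass m \<alpha> \<beta> n s'"
      using moving_mass_lower[of n] by (auto elim!: eventually_mono)
  qed
qed

end

end

section \<open>The limit\<close>

locale ordered_approximation = approximation f T C Bd un u U for f T C Bd un u U +
  fixes sg :: real
  assumes sg: "sg = 1 \<or> sg = - 1"
    and dec: "\<And>v w. 0 \<le> v \<Longrightarrow> v < w \<Longrightarrow> sg * hderiv f w < sg * hderiv f v"
    and sub_below: "\<And>n k. 0 \<le> k \<Longrightarrow> subconserved T (\<lambda>p. max 0 (k - un n p)) (\<lambda>p. f k - f (min (un n p) k))"
    and sub_above: "\<And>n k. 0 \<le> k \<Longrightarrow> subconserved T (\<lambda>p. max 0 (un n p - k)) (\<lambda>p. f (max (un n p) k) - f k)"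
begin

text \<open>The relative speed of the characteristics of the levels \<open>k\<close> and
  \<open>j\<close>, counted positively in both cases; times \<open>t\<close>, it is the length in
  Oleinik's inequality.\<close>

definition gap :: "real \<Rightarrow> real \<Rightarrow> real" where "gap k j = sg * (hderiv f k - hderiv f j)"

lemma gap_pos: "0 \<le> k \<Longrightarrow> k < j \<Longrightarrow> 0 < gap k j"
  using dec[of k j] by (simp add: gap_def algebra_simps)

lemma oleinik_un:
  assumes "0 \<le> k" "k < j"
  shows "AE t in lborel. 0 < t \<and> t < T \<longrightarrow> (AE x1 in lborel. AE x2 in lborel.
    0 < sg * (x2 - x1) \<and> sg * (x2 - x1) < gap k j * t \<longrightarrow> \<not> (j < un n (x1, t) \<and> un n (x2, t) < k))"
proof -
  obtain B where "\<And>p. un n p \<le> B" using un_bdd by blast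
  from oleinik[OF sg T un_meas un_nonneg this f_deriv dec sub_below sub_above assms]
  show ?thesis by (simp add: gap_def)
qed

lemma section_meas: "(\<lambda>x. un n (x, t)) \<in> borel_measurable borel" "(\<lambda>x. moving_bump m \<alpha> \<beta> (x, t)) \<in> borel_measurable borel"
proof -
  have "(\<lambda>x::real. (x, t)) \<in> borel \<rightarrow>\<^sub>M borel" by (intro borel_measurable_continuous_onI continuous_intros)
  from measurable_compose[OF this un_meas] measurable_compose[OF this moving_bump_meas]
  show "(\<lambda>x. un n (x, t)) \<in> borel_measurable borel" "(\<lambda>x. moving_bump m \<alpha> \<beta> (x, t)) \<in> borel_measurable borel" .
qed

lemma moving_mass_le:
  assumes m: "0 \<le> m" and ab: "\<alpha> < \<beta>" and j: "0 \<le> j"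
    and le: "AE x in lborel. x - C * t \<in> {\<alpha><..<\<beta>} \<longrightarrow> un n (x, t) \<le> j"
  shows "moving_mass m \<alpha> \<beta> n t \<le> j * (\<beta> - \<alpha>)"
proof -
  note [measurable] = section_meas
  let ?I = "{\<alpha> + C * t..\<beta> + C * t}"
  have i: "integrable lborel (\<lambda>x. D * indicator ?I x :: real)" for D
    by (intro integrable_mult_right integrable_real_indicator) (auto simp: emeasure_lborel_Icc_eq)
  obtain B where B: "\<And>p. un n p \<le> B" using un_bdd by blast
  have B0: "0 \<le> B" using B un_nonneg order_trans by blast
  have out: "moving_bump m \<alpha> \<beta> (x, t) = 0" if "x \<notin> ?I" for x
    unfolding moving_bump_def by (rule bump_zero(1)[OF m]) (use that in auto)
  have mb: "0 \<le> moving_bump m \<alpha> \<beta> (x, t)" "moving_bump m \<alpha> \<beta> (x, t) \<le> 1" for x by (simp_all add: moving_bump_def bump_bounds)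
  have "integrable lborel (\<lambda>x. moving_bump m \<alpha> \<beta> (x, t) * un n (x, t))"
  proof (rule Bochner_Integration.integrable_bound[OF i[of B]])
    show "AE x in lborel. norm (moving_bump m \<alpha> \<beta> (x, t) * un n (x, t)) \<le> norm (B * indicator ?I x)"
    proof (rule AE_I2)
      fix x
      have "moving_bump m \<alpha> \<beta> (x, t) * un n (x, t) \<le> 1 * B" using mb[of x] B[of "(x, t)"] un_nonneg[of n "(x, t)"] by (intro mult_mono) auto
      then show "norm (moving_bump m \<alpha> \<beta> (x, t) * un n (x, t)) \<le> norm (B * indicator ?I x)"
        using out[of x] mb[of x] un_nonneg[of n "(x, t)"] B0 by (cases "x \<in> ?I") (auto simp: abs_mult)
    qed
  qed measurable
  then have "moving_mass m \<alpha> \<beta> n t \<le> (\<integral>x. j * indicator ?I x \<partial>lborel)"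
    unfolding moving_mass_def
  proof (rule integral_mono_AE[OF _ i])
    show "AE x in lborel. moving_bump m \<alpha> \<beta> (x, t) * un n (x, t) \<le> j * indicator ?I x"
      using le
    proof (rule eventually_mono)
      fix x assume h: "x - C * t \<in> {\<alpha><..<\<beta>} \<longrightarrow> un n (x, t) \<le> j"
      show "moving_bump m \<alpha> \<beta> (x, t) * un n (x, t) \<le> j * indicator ?I x"
      proof (cases "x - C * t \<in> {\<alpha><..<\<beta>}")
        case True
        then have "moving_bump m \<alpha> \<beta> (x, t) * un n (x, t) \<le> 1 * j" using h mb[of x] un_nonneg[of n "(x, t)"] by (intro mult_mono) auto
        then show ?thesis using True by auto
      next
        case False
        then have "moving_bump m \<alpha> \<beta> (x, t) = 0" unfolding moving_bump_def by (intro bump_zero(1)[OF m]) auto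
        then show ?thesis using j by simp
      qed
    qed
  qed
  also have "\<dots> = j * (\<beta> - \<alpha>)" using ab by simp
  finally show ?thesis .
qed

text \<open>A smoothed mass above \<open>j\<close> times the length forces values above
  \<open>j\<close> on a set of positive measure, so a point \<open>x1\<close> can be picked outside
  the null set of Oleinik's inequality. From it the bound \<open>k\<close> spreads over the length
  \<open>D\<close>. As \<open>x1\<close> is known only up to \<delta> around \<open>y\<close>, the
  amount \<delta> is lost at both ends.\<close>

lemma spread:
  assumes m: "0 \<le> m" and ab: "\<alpha> < \<beta>" "y - \<delta> \<le> \<alpha>" "\<beta> \<le> y + \<delta>" and j: "0 \<le> j"
    and ole: "AE x1 in lborel. AE x2 in lborel. 0 < sg * (x2 - x1) \<and> sg * (x2 - x1) < D \<longrightarrow> \<not> (j < un n (x1, t) \<and> un n (x2, t) < k)"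
    and F: "j * (\<beta> - \<alpha>) < moving_mass m \<alpha> \<beta> n t"
  shows "AE x in lborel. \<delta> < sg * (x - C * t - y) \<and> sg * (x - C * t - y) < D - \<delta> \<longrightarrow> k \<le> un n (x, t)"
proof -
  have "\<exists>x1. (AE x2 in lborel. 0 < sg * (x2 - x1) \<and> sg * (x2 - x1) < D \<longrightarrow> \<not> (j < un n (x1, t) \<and> un n (x2, t) < k))
     \<and> x1 - C * t \<in> {\<alpha><..<\<beta>} \<and> j < un n (x1, t)"
  proof (rule ccontr)
    assume no: "\<not> ?thesis"
    have "AE x in lborel. x - C * t \<in> {\<alpha><..<\<beta>} \<longrightarrow> un n (x, t) \<le> j"
      using ole by (rule eventually_mono) (use no in \<open>meson not_less\<close>)
    from moving_mass_le[OF m ab(1) j this] F show False by simp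
  qed
  then obtain x1 where x1: "AE x2 in lborel. 0 < sg * (x2 - x1) \<and> sg * (x2 - x1) < D \<longrightarrow> \<not> (j < un n (x1, t) \<and> un n (x2, t) < k)"
    "x1 - C * t \<in> {\<alpha><..<\<beta>}" "j < un n (x1, t)" by blast
  have b: "\<bar>x1 - C * t - y\<bar> < \<delta>" using x1(2) ab by (auto simp: abs_less_iff)
  show ?thesis
    using x1(1)
  proof (rule eventually_mono, intro impI)
    fix x assume h: "0 < sg * (x - x1) \<and> sg * (x - x1) < D \<longrightarrow> \<not> (j < un n (x1, t) \<and> un n (x, t) < k)"
      and x: "\<delta> < sg * (x - C * t - y) \<and> sg * (x - C * t - y) < D - \<delta>"
    have "0 < sg * (x - x1) \<and> sg * (x - x1) < D" using x b sg by (auto simp: abs_less_iff)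
    with h x1(3) show "k \<le> un n (x, t)" by auto
  qed
qed

text \<open>A rectangle in the moving frame. Its width uses the initial time \<open>a\<close>, where
  the length from Oleinik's inequality is smallest, so that one open set serves the whole
  window.\<close>

definition region :: "real \<Rightarrow> real \<Rightarrow> real \<Rightarrow> real \<Rightarrow> real \<Rightarrow> (real \<times> real) set" where
  "region D y \<delta> a b = {p. a < snd p \<and> snd p < b \<and> \<delta> < sg * (fst p - C * snd p - y) \<and> sg * (fst p - C * snd p - y) < D * a - \<delta>}"

lemma region_props:
  assumes "0 < a" "b < T"
  shows "open (region D y \<delta> a b)" "bounded (region D y \<delta> a b)" "region D y \<delta> a b \<subseteq> strip T"
proof -
  show "open (region D y \<delta> a b)" unfolding region_def by (intro open_Collect_conj open_Collect_less continuous_intros)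
  show "region D y \<delta> a b \<subseteq> strip T" using assms by (auto simp: region_def strip_def)
  show "bounded (region D y \<delta> a b)"
  proof (cases "a < b")
    case True
    define q where "q = \<bar>y\<bar> + \<bar>D * a\<bar> + \<bar>\<delta>\<bar>"
    have "compact {(x, t). a \<le> t \<and> t \<le> b \<and> - q \<le> x - C * t \<and> x - C * t \<le> q}"
      using emeasure_moving_strip(2)[of a b "-q" q C] True by (simp add: q_def)
    then have "bounded {(x, t). a \<le> t \<and> t \<le> b \<and> - q \<le> x - C * t \<and> x - C * t \<le> q}" by (rule compact_imp_bounded)
    then show ?thesis
      by (rule bounded_subset) (use sg in \<open>auto simp: region_def q_def\<close>)
  next
    case False
    then have "region D y \<delta> a b = {}" by (auto simp: region_def)
    then show ?thesis by simp
  qed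
qed

lemma un_ge_on_region:
  assumes k: "0 \<le> k" "k < j" and m: "0 \<le> m" and ab: "\<alpha> < \<beta>" "y - \<delta> \<le> \<alpha>" "\<beta> \<le> y + \<delta>" and t: "0 < a" "b < T"
    and F: "AE s in lborel. s \<in> {a<..<b} \<longrightarrow> j * (\<beta> - \<alpha>) < moving_mass m \<alpha> \<beta> n s"
  shows "AE p in lborel. p \<in> region (gap k j) y \<delta> a b \<longrightarrow> k \<le> un n p"
proof -
  have "AE s in lborel. AE x in lborel. (x, s) \<in> region (gap k j) y \<delta> a b \<longrightarrow> k \<le> un n (x, s)"
    using F oleinik_un[OF k, of n]
  proof eventually_elim
    case (elim s)
    show ?case
    proof (cases "s \<in> {a<..<b}")
      case True
      have "AE x in lborel. \<delta> < sg * (x - C * s - y) \<and> sg * (x - C * s - y) < gap k j * s - \<delta> \<longrightarrow> k \<le> un n (x, s)"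
        by (rule spread[OF m ab]) (use elim True t k in auto)
      moreover have "gap k j * a \<le> gap k j * s" using gap_pos[OF k] True by (intro mult_left_mono) auto
      ultimately show ?thesis by (elim eventually_mono) (auto simp: region_def)
    qed (auto simp: region_def)
  qed
  moreover have Rb [measurable]: "region (gap k j) y \<delta> a b \<in> sets borel" using region_props(1)[OF t] by simp
  have meas: "{p \<in> space (lborel \<Otimes>\<^sub>M lborel). (\<lambda>x s. (x, s) \<in> region (gap k j) y \<delta> a b \<longrightarrow> k \<le> un n (x, s)) (fst p) (snd p)} \<in> sets (lborel \<Otimes>\<^sub>M lborel)"
    unfolding lborel_prod prod.collapse by measurable
  ultimately have "AE x in lborel. AE s in lborel. (x, s) \<in> region (gap k j) y \<delta> a b \<longrightarrow> k \<le> un n (x, s)"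
    using lborel_pair.AE_commute[OF meas] by blast
  then have "AE p in lborel \<Otimes>\<^sub>M lborel. p \<in> region (gap k j) y \<delta> a b \<longrightarrow> k \<le> un n p"
    using lborel_pair.AE_pair_measure[of "\<lambda>p. p \<in> region (gap k j) y \<delta> a b \<longrightarrow> k \<le> un n p"] meas by (simp add: prod.collapse)
  then show ?thesis by (subst (asm) lborel_prod)
qed

lemma u_sets: "sets u = sets (restrict_space lborel (strip T))" "finite_measure u"
  using u sets_restrict_space_cong[of borel lborel] by (auto simp: Radon_pos_def)

lemma strip_borel: "strip T \<in> sets borel"
  by (simp add: strip_def borel_open open_Times)

text \<open>A lower bound \<open>k\<close> for \<open>un\<close> is linear and survives the weak
  limit as an inequality between k times Lebesgue measure and \<open>u\<close> on \<open>R\<close>.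
  The density inherits it because the singular part sits on a null set.\<close>

lemma reg_ge_on_region:
  assumes k: "0 \<le> k" and R: "open R" "bounded R" "R \<subseteq> strip T"
    and ge: "\<forall>\<^sub>F n in sequentially. AE p in lborel. p \<in> R \<longrightarrow> k \<le> un n p"
  shows "AE p in lborel. p \<in> R \<longrightarrow> k \<le> reg T u p"
proof -
  interpret finite_measure u by (rule u_sets)
  have su: "sets u = sets (restrict_space borel (strip T))" using u by (simp add: Radon_pos_def)
  have idm: "(\<lambda>p. p) \<in> u \<rightarrow>\<^sub>M borel"
    unfolding measurable_cong_sets[OF su refl] by (intro measurable_restrict_space1) simp
  \<comment> \<open>The measure \<open>u\<close> lives on the strip; its image under the inclusion
    is a Borel measure on the plane, as the comparison lemma expects.\<close>
  define nu where "nu = distr u borel (\<lambda>p. p)"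
  define mu where "mu = density lborel (\<lambda>_::real \<times> real. ennreal k)"
  have spu: "space u = strip T" using sets_eq_imp_space_eq[OF su] by (simp add: space_restrict_space)
  have le: "emeasure mu A \<le> emeasure nu A" if A: "A \<in> sets borel" "A \<subseteq> R" for A
  proof (rule measure_le_from_test[OF _ _ _ R(1,2) _ A])
    show "finite_measure nu" unfolding nu_def using idm by (rule finite_measure_distr)
    fix z :: "real \<times> real \<Rightarrow> real" and K
    assume z: "continuous_on UNIV z" "\<forall>x. 0 \<le> z x \<and> z x \<le> 1" and K: "compact K" "K \<subseteq> R" "\<forall>x. x \<notin> K \<longrightarrow> z x = 0"
    have [measurable]: "z \<in> borel_measurable borel" using z(1) by (rule borel_measurable_continuous_onI)
    have zu: "z \<in> borel_measurable u" using measurable_compose[OF idm borel_measurable_continuous_onI[OF z(1)]] by simp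
    have iz: "integrable lborel z"
      using integrable_bounded_times_compact[of "\<lambda>_. 1" 1 z K] z K by auto
    have izu: "integrable u z" by (rule integrable_const_bound[of _ 1]) (use z zu in auto)
    have "k * (\<integral>p. z p \<partial>lborel) \<le> (\<integral>p. z p \<partial>u)"
    proof (rule LIMSEQ_le_const[OF conv[OF z(1) K(1)]])
      show "K \<subseteq> strip T" using K R by blast
      show "\<forall>p. p \<notin> K \<longrightarrow> z p = 0" by (rule K)
      obtain N where N: "\<And>n. N \<le> n \<Longrightarrow> AE p in lborel. p \<in> R \<longrightarrow> k \<le> un n p" using ge by (auto simp: eventually_sequentially)
      have "k * (\<integral>p. z p \<partial>lborel) \<le> (\<integral>p. z p * un n p \<partial>lborel)" if n: "N \<le> n" for n
      proof -
        obtain B where B: "\<And>p. un n p \<le> B" using un_bdd by blast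
        have "integrable lborel (\<lambda>p. un n p * z p)"
          by (rule integrable_bounded_times_compact[where M = B and K = K]) (use z K B un_nonneg in \<open>auto simp: abs_of_nonneg\<close>)
        then have izn: "integrable lborel (\<lambda>p. z p * un n p)" by (simp add: mult.commute)
        have "(\<integral>p. k * z p \<partial>lborel) \<le> (\<integral>p. z p * un n p \<partial>lborel)"
        proof (rule integral_mono_AE[OF _ izn])
          show "AE p in lborel. k * z p \<le> z p * un n p"
            using N[OF n]
          proof (rule eventually_mono)
            fix p assume h: "p \<in> R \<longrightarrow> k \<le> un n p"
            show "k * z p \<le> z p * un n p"
            proof (cases "p \<in> K")
              case True
              have "0 \<le> z p" using z(2) by blast
              moreover have "k \<le> un n p" using h K(2) True by blast
              ultimately have "z p * k \<le> z p * un n p" by (intro mult_left_mono)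
              then show ?thesis by (simp add: mult.commute)
            next
              case False
              then have "z p = 0" using K(3) by blast
              then show ?thesis by simp
            qed
          qed
        qed (use iz in simp)
        then show ?thesis by simp
      qed
      then show "\<exists>N. \<forall>n\<ge>N. k * (\<integral>p. z p \<partial>lborel) \<le> (\<integral>p. z p * un n p \<partial>lborel)" by blast
    qed
    then have "ennreal (k * (\<integral>p. z p \<partial>lborel)) \<le> ennreal (\<integral>p. z p \<partial>u)" by (rule ennreal_leI)
    also have "ennreal (\<integral>p. z p \<partial>u) = (\<integral>\<^sup>+p. ennreal (z p) \<partial>u)"
      using nn_integral_eq_integral[OF izu] z(2) by (metis AE_I2)
    also have "\<dots> = (\<integral>\<^sup>+p. ennreal (z p) \<partial>nu)"
      unfolding nu_def using idm by (subst nn_integral_distr) auto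
    also have "ennreal (k * (\<integral>p. z p \<partial>lborel)) = (\<integral>\<^sup>+p. ennreal (z p) \<partial>mu)"
    proof -
      have "(\<integral>\<^sup>+p. ennreal (z p) \<partial>mu) = ennreal k * (\<integral>\<^sup>+p. ennreal (z p) \<partial>lborel)"
        by (simp add: mu_def nn_integral_density nn_integral_cmult)
      also have "(\<integral>\<^sup>+p. ennreal (z p) \<partial>lborel) = ennreal (\<integral>p. z p \<partial>lborel)"
        using nn_integral_eq_integral[OF iz] z(2) by (metis AE_I2)
      finally show ?thesis using k by (simp add: ennreal_mult')
    qed
    finally show "(\<integral>\<^sup>+p. ennreal (z p) \<partial>mu) \<le> (\<integral>\<^sup>+p. ennreal (z p) \<partial>nu)" .
  qed (simp_all add: mu_def nu_def)
  let ?M = "restrict_space lborel (strip T)"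
  have Rs: "R \<in> sets borel" using R by simp
  have "AE p in ?M. p \<in> R \<longrightarrow> k \<le> ac_density ?M u p"
  proof (rule ac_density_ge[OF u_sets(2,1) sigma_finite_measure_restrict_space[OF sigma_finite_lborel]])
    show "strip T \<in> sets lborel" using strip_borel by simp
    show "R \<in> sets ?M" using Rs R strip_borel by (subst sets_restrict_space_iff) auto
    have "emeasure ?M R = emeasure lborel R" using R strip_borel by (intro emeasure_restrict_space) auto
    also have "\<dots> < \<infinity>" by (rule emeasure_bounded_finite[OF R(2)])
    finally show "emeasure ?M R < \<infinity>" .
    fix A assume A: "A \<in> sets ?M" "A \<subseteq> R"
    have Ab: "A \<in> sets borel" using A(1) strip_borel by (subst (asm) sets_restrict_space_iff) auto
    have "ennreal k * emeasure ?M A = ennreal k * emeasure lborel A"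
      using A R strip_borel by (subst emeasure_restrict_space) auto
    also have "\<dots> = emeasure mu A" using Ab by (simp add: mu_def emeasure_density nn_integral_cmult_indicator)
    also have "\<dots> \<le> emeasure nu A" by (rule le[OF Ab A(2)])
    also have "\<dots> = emeasure u A"
    proof -
      have "(\<lambda>p. p) -` A \<inter> space u = A" using A R spu by auto
      then show ?thesis unfolding nu_def using emeasure_distr[OF idm Ab] by simp
    qed
    finally show "ennreal k * emeasure ?M A \<le> emeasure u A" .
  qed
  then have "AE p in lborel. p \<in> strip T \<longrightarrow> p \<in> R \<longrightarrow> k \<le> reg T u p"
    using strip_borel by (simp add: AE_restrict_space_iff reg_def)
  then show ?thesis by (rule eventually_mono) (use R in auto)
qed

end

section \<open>From lower bounds at all levels to the essential limit\<close>

lemma ess_limit_from_levels: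
  fixes g :: "real \<Rightarrow> real" and d :: "nat \<Rightarrow> real"
  assumes sg: "sg = 1 \<or> sg = - 1" and d: "\<And>k. 0 < d k"
    and ge: "\<And>k. AE x in lborel. 0 < sg * (x - x0) \<and> sg * (x - x0) < d k \<longrightarrow> real k \<le> g x"
  shows "\<exists>N\<in>null_sets lebesgue. \<forall>X. (\<forall>n. 0 < sg * (X n - x0) \<and> X n \<notin> N) \<and> X \<longlonglongrightarrow> x0 \<longrightarrow>
    (\<lambda>n. ereal (g (X n))) \<longlonglongrightarrow> \<infinity>"
proof -
  have "AE x in lborel. \<forall>k. 0 < sg * (x - x0) \<and> sg * (x - x0) < d k \<longrightarrow> real k \<le> g x"
    using ge by (subst AE_all_countable) blast
  then obtain N where N: "{x \<in> space lborel. \<not> (\<forall>k. 0 < sg * (x - x0) \<and> sg * (x - x0) < d k \<longrightarrow> real k \<le> g x)} \<subseteq> N"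
    "emeasure lborel N = 0" "N \<in> sets lborel" by (rule AE_E)
  have null: "N \<in> null_sets lebesgue" using N by (intro null_sets_completionI) auto
  show ?thesis
  proof (rule bexI[OF _ null], intro allI impI, elim conjE)
    fix X assume X: "\<forall>n. 0 < sg * (X n - x0) \<and> X n \<notin> N" and lim: "X \<longlonglongrightarrow> x0"
    show "(\<lambda>n. ereal (g (X n))) \<longlonglongrightarrow> \<infinity>"
      unfolding tendsto_PInfty
    proof
      fix r :: real
      obtain k :: nat where k: "r < real k" using reals_Archimedean2 by blast
      have "\<forall>\<^sub>F n in sequentially. dist (X n) x0 < d k" using lim d[of k] by (rule tendstoD)
      then show "\<forall>\<^sub>F n in sequentially. ereal r < ereal (g (X n))"
      proof (rule eventually_mono)
        fix n assume "dist (X n) x0 < d k"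
        then have "sg * (X n - x0) < d k" using sg by (auto simp: dist_real_def abs_less_iff)
        moreover have "X n \<notin> N" "0 < sg * (X n - x0)" using X by auto
        ultimately have "real k \<le> g (X n)" using N(1) by auto
        then show "ereal r < ereal (g (X n))" using k by simp
      qed
    qed
  qed
qed

text \<open>The condition \<open>t / 2 < of_rat a\<close> keeps the width \<open>D * a\<close> of a
  region above \<open>D * t / 2\<close>, however short the window has to be.\<close>

lemma rational_bracket:
  fixes t T h :: real
  assumes "0 < t" "t < T" "0 < h"
  obtains a' a b :: rat where "0 < (of_rat a' :: real)" "(of_rat a' :: real) < of_rat a" "of_rat a < t" "t < of_rat b" "of_rat b < T"
    "t / 2 < of_rat a" "of_rat b - of_rat a' < h"
proof -
  have "max (t / 2) (t - h / 2) < t" using assms by simp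
  then obtain a' where a': "max (t / 2) (t - h / 2) < of_rat a'" "of_rat a' < t" using of_rat_dense by blast
  obtain a where a: "(of_rat a' :: real) < of_rat a" "of_rat a < t" using a'(2) of_rat_dense by blast
  have "t < min T (t + h / 2)" using assms by simp
  then obtain b where b: "t < of_rat b" "of_rat b < min T (t + h / 2)" using of_rat_dense by blast
  show ?thesis
  proof (rule that[of a' a b])
    show "of_rat b - of_rat a' < h" using a' b by argo
    show "0 < (of_rat a' :: real)" "t / 2 < of_rat a" using a' a assms by argo+
  qed (use a b in auto)
qed

section \<open>Lower bounds next to the singular support\<close>

context ordered_approximation
begin

text \<open>At a good time every neighbourhood of x_0 contains an interval with more than
  \<open>j\<close> times its length of mass, since otherwise the singular part would vanish there.
  The excess survives smoothing with a large \<open>m\<close> and then a sufficiently short window,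
  so \<open>un\<close> is at least \<open>k\<close> on a region for all large \<open>n\<close>, and
  \<open>u\<close> inherits the bound.\<close>

lemma lower_bound_near_singular_support:
  "AE t in lborel. t \<in> {0<..<T} \<longrightarrow> (\<forall>x0 \<in> msupport (translate (- C * t) (sing_part lborel (U t))). \<forall>k::nat.
     AE x in lborel. 0 < sg * (x - x0) \<and> sg * (x - x0) < gap k (k + 1) * t / 2 \<longrightarrow> real k \<le> reg T u (x + C * t, t))"
proof -
  \<comment> \<open>Whether a rational region carries the bound does not depend on the time or on
    x_0. There are countably many parameters, so one null set of times covers the sections of all
    good regions, chosen before x_0 is known.\<close>
  define good where "good = (\<lambda>(y, \<delta>, a, b, k :: nat). AE p in lborel.
    p \<in> region (gap k (k + 1)) (of_rat y) (of_rat \<delta>) (of_rat a) (of_rat b) \<longrightarrow> real k \<le> reg T u p)"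
  define lvl where "lvl = (\<lambda>t (y, \<delta>, a, b, k :: nat). AE x in lborel.
    (x, t) \<in> region (gap k (k + 1)) (of_rat y) (of_rat \<delta>) (of_rat a) (of_rat b) \<longrightarrow> real k \<le> reg T u (x, t))"
  have A1: "AE t in lborel. \<forall>q\<in>Collect good. lvl t q"
  proof (subst AE_ball_countable)
    show "countable (Collect good)" by (rule countableI_type)
    show "\<forall>q\<in>Collect good. AE t in lborel. lvl t q"
      unfolding good_def lvl_def by (auto dest: AE_lborel_swap)
  qed
  define ok where "ok = (\<lambda>(m :: nat, \<alpha> :: rat, \<beta> :: rat, a' :: rat, a :: rat, b :: rat).
    \<alpha> < \<beta> \<and> 0 < (of_rat a' :: real) \<and> a' < a \<and> a < b \<and> of_rat b < T)"
  define pers where "pers = (\<lambda>t (m :: nat, \<alpha> :: rat, \<beta> :: rat, a' :: rat, a :: rat, b :: rat).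
    t \<in> {of_rat a<..<of_rat b} \<longrightarrow> (\<forall>c. c + 2 * lipschitz_const (real m) (of_rat \<alpha>) (of_rat \<beta>) * (of_rat b - of_rat a') < slice_mass (real m) (of_rat \<alpha>) (of_rat \<beta>) t \<longrightarrow>
     (\<forall>\<^sub>F n in sequentially. AE s in lborel. s \<in> {of_rat a<..<of_rat b} \<longrightarrow> c < moving_mass (real m) (of_rat \<alpha>) (of_rat \<beta>) n s)))"
  have A2: "AE t in lborel. \<forall>q\<in>Collect ok. pers t q"
  proof (subst AE_ball_countable)
    show "countable (Collect ok)" by (rule countableI_type)
    show "\<forall>q\<in>Collect ok. AE t in lborel. pers t q"
    proof (intro ballI)
      fix q assume q: "q \<in> Collect ok"
      obtain m \<alpha> \<beta> a' a b where qe: "q = (m, \<alpha>, \<beta>, a', a, b)" by (metis surj_pair)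
      have h: "0 \<le> real m" "of_rat \<alpha> < (of_rat \<beta> :: real)" "0 < (of_rat a' :: real)" "of_rat a' < (of_rat a :: real)" "of_rat a < (of_rat b :: real)" "of_rat b < T"
        using q unfolding qe ok_def by (auto simp: of_rat_less)
      show "AE t in lborel. pers t q"
        unfolding qe pers_def prod.case by (rule persistence[OF h])
    qed
  qed
  have "AE t in lebesgue_on {0<..<T}. U t \<in> Radon_pos UNIV" using U by (simp add: time_slices_def)
  then have A3: "AE t in lborel. t \<in> {0<..<T} \<longrightarrow> U t \<in> Radon_pos UNIV"
    by (simp add: AE_restrict_space_iff AE_completion_iff)
  show ?thesis
    using A1 A2 A3
  proof (eventually_elim, intro impI ballI allI)
    fix t x0 :: real and k :: nat
    assume B1: "\<forall>q\<in>Collect good. lvl t q" and B2: "\<forall>q\<in>Collect ok. pers t q"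
      and B3: "t \<in> {0<..<T} \<longrightarrow> U t \<in> Radon_pos UNIV" and t: "t \<in> {0<..<T}"
      and x0: "x0 \<in> msupport (translate (- C * t) (sing_part lborel (U t)))"
    have sU: "sets (U t) = sets borel" and fU: "finite_measure (U t)" using B3 t by (auto simp: Radon_pos_def)
    interpret Ut: finite_measure "U t" by (rule fU)
    have D: "lebesgue_decomposition lborel (U t) (ac_part lborel (U t)) (sing_part lborel (U t))"
      by (rule lebesgue_decomposition_parts[OF fU]) (simp add: sU)
    then have ss: "sets (sing_part lborel (U t)) = sets borel" by (simp add: lebesgue_decomposition_def)
    \<comment> \<open>Some level strictly above \<open>k\<close> is required to give the region
      positive width.\<close>
    define j where "j = real k + 1"
    have gp: "0 < gap k (k + 1)" by (rule gap_pos) auto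
    have step: "AE x in lborel. 2 * of_rat \<delta> < sg * (x - x0) \<and> sg * (x - x0) < gap k (k + 1) * t / 2 - 2 * of_rat \<delta>
        \<longrightarrow> real k \<le> reg T u (x + C * t, t)" if \<delta>: "0 < \<delta>" for \<delta> :: rat
    proof -
      have d0: "0 < (of_rat \<delta> :: real)" using \<delta> by simp
      then have "x0 - of_rat \<delta> < x0" by simp
      \<comment> \<open>The region must have a rational centre; its distance from \<open>x0\<close>
        costs another \<delta>, whence the two \<delta> at each end of the claim.\<close>
      then obtain y where y: "x0 - of_rat \<delta> < of_rat y" "of_rat y < x0" using of_rat_dense by blast
      define p q where "p = of_rat y - of_rat \<delta> + C * t" and "q = of_rat y + of_rat \<delta> + C * t"
      have "0 < emeasure (translate (- C * t) (sing_part lborel (U t))) {of_rat y - of_rat \<delta><..<of_rat y + of_rat \<delta>}"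
        using x0 y d0 unfolding msupport_def by auto
      also have "\<dots> = emeasure (sing_part lborel (U t)) {p<..<q}"
      proof -
        have "(\<lambda>x. x + - C * t) \<in> sing_part lborel (U t) \<rightarrow>\<^sub>M borel"
          unfolding measurable_cong_sets[OF ss refl] by simp
        moreover have "(\<lambda>x. x + - C * t) -` {of_rat y - of_rat \<delta><..<of_rat y + of_rat \<delta>} \<inter> space (sing_part lborel (U t)) = {p<..<q}"
          using sets_eq_imp_space_eq[OF ss] by (auto simp: p_def q_def)
        ultimately show ?thesis unfolding translate_def by (simp add: emeasure_distr)
      qed
      finally have "emeasure (sing_part lborel (U t)) {p<..<q} \<noteq> 0" by simp
      then have "\<not> (\<forall>\<alpha> \<beta> :: rat. p \<le> of_rat \<alpha> + C * t \<longrightarrow> \<alpha> < \<beta> \<longrightarrow> of_rat \<beta> + C * t \<le> q \<longrightarrow>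
          measure (U t) {of_rat \<alpha> + C * t<..<of_rat \<beta> + C * t} \<le> j * (of_rat \<beta> - of_rat \<alpha>))"
        using sing_part_zero_on_interval[OF fU sU, of j p "C * t" q] by (auto simp: j_def)
      then obtain \<alpha> \<beta> :: rat where ab: "p \<le> of_rat \<alpha> + C * t" "\<alpha> < \<beta>" "of_rat \<beta> + C * t \<le> q"
        "j * (of_rat \<beta> - of_rat \<alpha>) < measure (U t) {of_rat \<alpha> + C * t<..<of_rat \<beta> + C * t}" by (auto simp: not_le)
      have ab': "of_rat \<alpha> < (of_rat \<beta> :: real)" using ab(2) by (simp add: of_rat_less)
      \<comment> \<open>The bumps fill the open interval as \<open>m\<close> grows. A suitable
        \<open>m\<close> is fixed before the window is chosen, because the Lipschitz constant grows
        with \<open>m\<close>.\<close>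
      have "(\<lambda>m. slice_mass (real m) (of_rat \<alpha>) (of_rat \<beta>) t) \<longlonglongrightarrow> (\<integral>x. indicator {of_rat \<alpha> + C * t<..<of_rat \<beta> + C * t} x \<partial>U t)"
        unfolding slice_mass_def
      proof (rule integral_dominated_convergence[where w = "\<lambda>_. 1"])
        show "(\<lambda>x. moving_bump (real m) (of_rat \<alpha>) (of_rat \<beta>) (x, t)) \<in> borel_measurable (U t)" for m
          unfolding measurable_cong_sets[OF sU refl] by (rule section_meas)
        show "indicator {of_rat \<alpha> + C * t<..<of_rat \<beta> + C * t} \<in> borel_measurable (U t)"
          unfolding measurable_cong_sets[OF sU refl] by simp
        show "AE x in U t. (\<lambda>m. moving_bump (real m) (of_rat \<alpha>) (of_rat \<beta>) (x, t)) \<longlonglongrightarrow> indicator {of_rat \<alpha> + C * t<..<of_rat \<beta> + C * t} x"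
        proof (rule AE_I2)
          fix x
          have "indicator {of_rat \<alpha><..<of_rat \<beta>} (x - C * t) = (indicator {of_rat \<alpha> + C * t<..<of_rat \<beta> + C * t} x :: real)"
            by (auto simp: indicator_def)
          then show "(\<lambda>m. moving_bump (real m) (of_rat \<alpha>) (of_rat \<beta>) (x, t)) \<longlonglongrightarrow> indicator {of_rat \<alpha> + C * t<..<of_rat \<beta> + C * t} x"
            using bump_limit[of "of_rat \<alpha>" "of_rat \<beta>" "x - C * t"] by (simp add: moving_bump_def)
        qed
        show "AE x in U t. norm (moving_bump (real m) (of_rat \<alpha>) (of_rat \<beta>) (x, t)) \<le> 1" for m
          by (rule AE_I2) (simp add: moving_bump_def bump_bounds abs_of_nonneg)
      qed simp
      then have "(\<lambda>m. slice_mass (real m) (of_rat \<alpha>) (of_rat \<beta>) t) \<longlonglongrightarrow> measure (U t) {of_rat \<alpha> + C * t<..<of_rat \<beta> + C * t}"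
        using sU sets_eq_imp_space_eq[OF sU] by simp
      from order_tendstoD(1)[OF this ab(4)] obtain m :: nat where m: "j * (of_rat \<beta> - of_rat \<alpha>) < slice_mass (real m) (of_rat \<alpha>) (of_rat \<beta>) t"
        by (auto simp: eventually_sequentially)
      define L where "L = lipschitz_const (real m) (of_rat \<alpha>) (of_rat \<beta>)"
      have L0: "0 \<le> L" using Bd_nonneg ab' by (simp add: L_def lipschitz_const_def)
      define gm where "gm = slice_mass (real m) (of_rat \<alpha>) (of_rat \<beta>) t - j * (of_rat \<beta> - of_rat \<alpha>)"
      have gm: "0 < gm" using m by (simp add: gm_def)
      \<comment> \<open>A window of this length keeps the loss \<open>2 * L * (b - a')\<close> below
        the excess \<open>gm\<close>; \<open>+ 1\<close> covers \<open>L = 0\<close>.\<close>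
      have h0: "0 < gm / (2 * L + 1)" using gm L0 by simp
      obtain a' a b :: rat where r: "0 < (of_rat a' :: real)" "(of_rat a' :: real) < of_rat a" "of_rat a < t" "t < of_rat b" "of_rat b < T"
        "t / 2 < of_rat a" "of_rat b - of_rat a' < gm / (2 * L + 1)"
        using rational_bracket[of t T, OF _ _ h0] t by (metis greaterThanLessThan_iff)
      have "2 * L * (of_rat b - of_rat a') \<le> (2 * L) * (gm / (2 * L + 1))" using L0 r by (intro mult_left_mono) auto
      also have "\<dots> < (2 * L + 1) * (gm / (2 * L + 1))" using h0 by (intro mult_strict_right_mono) auto
      also have "\<dots> = gm" using L0 by simp
      finally have small: "j * (of_rat \<beta> - of_rat \<alpha>) + 2 * L * (of_rat b - of_rat a') < slice_mass (real m) (of_rat \<alpha>) (of_rat \<beta>) t"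
        by (simp add: gm_def)
      have "ok (m, \<alpha>, \<beta>, a', a, b)"
      proof -
        have "a' < a" using r(2) by (simp add: of_rat_less)
        moreover have "(of_rat a :: real) < of_rat b" using r by linarith
        then have "a < b" by (simp add: of_rat_less)
        ultimately show ?thesis using r ab by (simp add: ok_def)
      qed
      then have "pers t (m, \<alpha>, \<beta>, a', a, b)" using B2 by blast
      with r small have ev: "\<forall>\<^sub>F n in sequentially. AE s in lborel. s \<in> {of_rat a<..<of_rat b} \<longrightarrow>
          j * (of_rat \<beta> - of_rat \<alpha>) < moving_mass m (of_rat \<alpha>) (of_rat \<beta>) n s"
        unfolding L_def pers_def by auto
      define R where "R = region (gap k (k + 1)) (of_rat y) (of_rat \<delta>) (of_rat a) (of_rat b)"
      have a0: "0 < (of_rat a :: real)" using r by linarith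
      have "\<forall>\<^sub>F n in sequentially. AE p in lborel. p \<in> R \<longrightarrow> real k \<le> un n p"
        using ev
      proof (rule eventually_mono)
        fix n assume "AE s in lborel. s \<in> {of_rat a<..<of_rat b} \<longrightarrow> j * (of_rat \<beta> - of_rat \<alpha>) < moving_mass m (of_rat \<alpha>) (of_rat \<beta>) n s"
        then have "AE p in lborel. p \<in> region (gap k j) (of_rat y) (of_rat \<delta>) (of_rat a) (of_rat b) \<longrightarrow> real k \<le> un n p"
          using ab ab' r a0 by (intro un_ge_on_region[where \<alpha> = "of_rat \<alpha>" and \<beta> = "of_rat \<beta>" and m = "real m"]) (auto simp: j_def p_def q_def)
        then show "AE p in lborel. p \<in> R \<longrightarrow> real k \<le> un n p" by (simp add: R_def j_def add.commute)
      qed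
      then have "AE p in lborel. p \<in> R \<longrightarrow> real k \<le> reg T u p"
        unfolding R_def by (intro reg_ge_on_region region_props a0 r) auto
      then have "good (y, \<delta>, a, b, k)" by (simp add: good_def R_def)
      then have "lvl t (y, \<delta>, a, b, k)" using B1 by blast
      then have "AE x in lborel. (x, t) \<in> R \<longrightarrow> real k \<le> reg T u (x, t)" unfolding R_def lvl_def by simp
      from AE_lborel_translate[OF this, of "C * t"] show ?thesis
      proof (rule eventually_mono, intro impI)
        fix x assume h: "(C * t + x, t) \<in> R \<longrightarrow> real k \<le> reg T u (C * t + x, t)"
          and x: "2 * of_rat \<delta> < sg * (x - x0) \<and> sg * (x - x0) < gap k (k + 1) * t / 2 - 2 * of_rat \<delta>"
        have "gap k (k + 1) * (t / 2) \<le> gap k (k + 1) * of_rat a" using gp r by (intro mult_left_mono) auto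
        moreover have "\<bar>sg * (x - of_rat y) - sg * (x - x0)\<bar> < of_rat \<delta>"
          using sg y by (auto simp: abs_less_iff)
        ultimately have "of_rat \<delta> < sg * (x - of_rat y) \<and> sg * (x - of_rat y) < gap k (k + 1) * of_rat a - of_rat \<delta>"
          using x by (auto simp: abs_less_iff)
        then have "(C * t + x, t) \<in> R" using r by (simp add: R_def region_def)
        with h show "real k \<le> reg T u (x + C * t, t)" by (simp add: add.commute)
      qed
    qed
    \<comment> \<open>Letting \<delta> tend to 0 through the rationals removes both margins at the
      price of countably many null sets.\<close>
    have "AE x in lborel. \<forall>\<delta>\<in>{\<delta> :: rat. 0 < \<delta>}. 2 * of_rat \<delta> < sg * (x - x0) \<and> sg * (x - x0) < gap k (k + 1) * t / 2 - 2 * of_rat \<delta>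
        \<longrightarrow> real k \<le> reg T u (x + C * t, t)"
      by (subst AE_ball_countable) (use step in \<open>auto intro: countableI_type\<close>)
    then show "AE x in lborel. 0 < sg * (x - x0) \<and> sg * (x - x0) < gap k (k + 1) * t / 2 \<longrightarrow> real k \<le> reg T u (x + C * t, t)"
    proof (rule eventually_mono, intro impI)
      fix x assume h: "\<forall>\<delta>\<in>{\<delta> :: rat. 0 < \<delta>}. 2 * of_rat \<delta> < sg * (x - x0) \<and> sg * (x - x0) < gap k (k + 1) * t / 2 - 2 * of_rat \<delta>
        \<longrightarrow> real k \<le> reg T u (x + C * t, t)" and x: "0 < sg * (x - x0) \<and> sg * (x - x0) < gap k (k + 1) * t / 2"
      have "0 < min (sg * (x - x0)) (gap k (k + 1) * t / 2 - sg * (x - x0)) / 2" using x by simp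
      then obtain \<delta> :: rat where "0 < (of_rat \<delta> :: real)" "of_rat \<delta> < min (sg * (x - x0)) (gap k (k + 1) * t / 2 - sg * (x - x0)) / 2"
        using of_rat_dense by blast
      then have "0 < \<delta>" "2 * of_rat \<delta> < sg * (x - x0)" "sg * (x - x0) < gap k (k + 1) * t / 2 - 2 * of_rat \<delta>" by auto
      with h show "real k \<le> reg T u (x + C * t, t)" by blast
    qed
  qed
qed

end

section \<open>Sign and monotonicity of the relative characteristic speed\<close>

lemma smooth_halfline_deriv:
  assumes "smooth_halfline f" "0 \<le> w"
  shows "(f has_real_derivative hderiv f w) (at w within {0..})"
    "(hderiv f has_real_derivative hderiv (hderiv f) w) (at w within {0..})"
    "(hderiv (hderiv f) has_real_derivative hderiv (hderiv (hderiv f)) w) (at w within {0..})"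
proof -
  have d: "((hderiv ^^ k) f has_real_derivative hderiv ((hderiv ^^ k) f) w) (at w within {0..})" for k
    using assms by (simp add: smooth_halfline_def hderiv_def vector_derivative_works has_real_derivative_iff_has_vector_derivative)
  show "(f has_real_derivative hderiv f w) (at w within {0..})"
    "(hderiv f has_real_derivative hderiv (hderiv f) w) (at w within {0..})"
    "(hderiv (hderiv f) has_real_derivative hderiv (hderiv (hderiv f)) w) (at w within {0..})"
    using d[of 0] d[of 1] d[of 2] by (simp_all add: numeral_2_eq_2)
qed

text \<open>The structural condition makes \<open>f''\<close> vanish nowhere. If its sign agreed with that of \<open>f' - C\<close>, then
  \<open>f u - C * u\<close> would grow at least linearly; hence \<open>f' - C\<close> decreases in absolute value.\<close>

lemma speed_monotone:
  assumes sm: "smooth_halfline f" and sg: "sg = 1 \<or> sg = - 1" and ne: "\<And>w. 0 \<le> w \<Longrightarrow> hderiv (hderiv f) w \<noteq> 0"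
    and bd: "\<And>w. 0 \<le> w \<Longrightarrow> \<bar>f w - C * w\<bar> \<le> Bd" and gt: "\<And>w. 0 \<le> w \<Longrightarrow> 0 < sg * (hderiv f w - C)"
    and vw: "0 \<le> v" "v < w"
  shows "sg * hderiv f w < sg * hderiv f v"
proof -
  note d = smooth_halfline_deriv[OF sm]
  have c2: "continuous_on {0..} (hderiv (hderiv f))" by (rule continuous_on_halflineI[OF d(3)])
  have "sg * hderiv (hderiv f) z < 0" if z: "0 \<le> z" for z
  proof (rule ccontr)
    assume "\<not> sg * hderiv (hderiv f) z < 0"
    then have pz: "0 < sg * hderiv (hderiv f) z" using ne[OF z] sg by auto
    have pos: "0 < sg * hderiv (hderiv f) y" if y: "0 \<le> y" for y
    proof (rule ccontr)
      assume "\<not> 0 < sg * hderiv (hderiv f) y"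
      then have ny: "sg * hderiv (hderiv f) y \<le> 0" by simp
      have "connected ((\<lambda>w. sg * hderiv (hderiv f) w) ` {0..})"
        by (intro connected_continuous_image continuous_intros c2) (simp add: convex_connected)
      then have "0 \<in> (\<lambda>w. sg * hderiv (hderiv f) w) ` {0..}"
        using ny pz z y connectedD_interval[of "(\<lambda>w. sg * hderiv (hderiv f) w) ` {0..}" "sg * hderiv (hderiv f) y" "sg * hderiv (hderiv f) z" 0] by auto
      then show False using ne sg by auto
    qed
    define A where "A = sg * (hderiv f 0 - C)"
    have A: "0 < A" unfolding A_def by (rule gt) simp
    have inc: "A \<le> sg * (hderiv f y - C)" if y: "0 < y" for y
    proof -
      obtain x where x: "0 < x" "hderiv f y - hderiv f 0 = (y - 0) * hderiv (hderiv f) x"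
        using halfline_mvt[of "hderiv f", OF d(2) order_refl y] by auto
      have "sg * hderiv f y - sg * hderiv f 0 = y * (sg * hderiv (hderiv f) x)"
        using x(2) by (simp add: right_diff_distrib[symmetric])
      moreover have "0 < y * (sg * hderiv (hderiv f) x)" using mult_pos_pos[OF y pos[of x]] x by simp
      ultimately show ?thesis by (simp add: A_def right_diff_distrib)
    qed
    \<comment> \<open>Growth at rate at least \<open>A\<close> over this length exceeds
      \<open>2 * Bd\<close>, the largest variation that the bound permits.\<close>
    define y where "y = (2 * \<bar>Bd\<bar> + 1) / A"
    have y: "0 < y" using A by (simp add: y_def)
    have "((\<lambda>w. f w - C * w) has_real_derivative hderiv f w - C) (at w within {0..})" if "0 \<le> w" for w
      using DERIV_diff[OF d(1)[OF that] DERIV_cmult_Id[of C]] by simp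
    from halfline_mvt[of "\<lambda>w. f w - C * w", OF this order_refl y]
    obtain x where x: "0 < x" "(f y - C * y) - (f 0 - C * 0) = (y - 0) * (hderiv f x - C)" by auto
    have "2 * \<bar>Bd\<bar> + 1 = y * A" using A by (simp add: y_def)
    also have "\<dots> \<le> y * (sg * (hderiv f x - C))" using inc[OF x(1)] y by (intro mult_left_mono) auto
    also have "\<dots> = sg * ((f y - C * y) - (f 0 - C * 0))" using x(2) by simp
    also have "\<dots> \<le> \<bar>f y - C * y\<bar> + \<bar>f 0 - C * 0\<bar>" using sg by auto
    also have "\<dots> \<le> Bd + Bd" using bd[of y] bd[of 0] y by (intro add_mono) auto
    finally show False by linarith
  qed
  note neg = this
  obtain x where x: "v < x" "hderiv f w - hderiv f v = (w - v) * hderiv (hderiv f) x"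
    using halfline_mvt[of "hderiv f", OF d(2) vw] by auto
  have "sg * hderiv f w - sg * hderiv f v = (w - v) * (sg * hderiv (hderiv f) x)"
    using x(2) by (simp add: right_diff_distrib[symmetric])
  moreover have "(w - v) * (sg * hderiv (hderiv f) x) < 0" using mult_pos_neg[of "w - v" "sg * hderiv (hderiv f) x"] neg[of x] x vw by simp
  ultimately show ?thesis by simp
qed

text \<open>Here \<open>sg\<close> is the sign of \<phi>' - C. Relative to the singular part, which
  moves with speed C, characteristics run in the direction \<open>sg\<close>, and this is the side
  of the blow-up.\<close>

lemma one_sided_blowup:
  fixes \<phi> :: "real \<Rightarrow> real"
  assumes T: "T > 0" and sm: "smooth_halfline \<phi>" and sg: "sg = 1 \<or> sg = - 1"
    and ne: "\<And>w. 0 \<le> w \<Longrightarrow> hderiv (hderiv \<phi>) w \<noteq> 0"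
    and bd: "\<And>w. 0 \<le> w \<Longrightarrow> \<bar>\<phi> w - C * w\<bar> \<le> Bd"
    and gt: "\<And>w. 0 \<le> w \<Longrightarrow> 0 < sg * (hderiv \<phi> w - C)"
    and sol: "constructed_entropy_solution T \<phi> C u\<^sub>0 u"
  shows "AE t in lebesgue_on {0<..<T}. \<forall>x\<^sub>0 \<in> msupport (translate (- C * t) (slice_s T u t)).
    \<exists>N\<in>null_sets lebesgue. \<forall>X. (\<forall>n. 0 < sg * (X n - x\<^sub>0) \<and> X n \<notin> N) \<and> X \<longlonglongrightarrow> x\<^sub>0 \<longrightarrow>
      (\<lambda>n. ereal (reg T u (X n + C * t, t))) \<longlonglongrightarrow> \<infinity>"
proof -
  interpret halfline_C1 \<phi>
    by unfold_locales (use smooth_halfline_deriv[OF sm] continuous_on_halflineI[OF smooth_halfline_deriv(2)[OF sm]] in auto)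
  have uL: "u \<in> Linf_Radon_pos T"
    using sol by (simp add: constructed_entropy_solution_def entropy_solution_def solution_def)
  then have uR: "u \<in> Radon_pos (strip T)" and "\<exists>U. time_slices T u U" by (auto simp: Linf_Radon_pos_def)
  then have ts: "time_slices T u (slice T u)" unfolding slice_def by (metis someI_ex)
  obtain v\<^sub>0 :: "nat \<Rightarrow> real \<Rightarrow> real" and v r where K: "\<And>n. kruzkov_solution T \<phi> (v\<^sub>0 n) (v n)"
    and vc: "\<And>\<zeta>. \<zeta> \<in> Cc (strip T) \<Longrightarrow> (\<lambda>n. \<integral>p. \<zeta> p * v (r n) p \<partial>lebesgue_on (strip T)) \<longlonglongrightarrow> (\<integral>p. \<zeta> p \<partial>u)"
    using conjunct2[OF sol[unfolded constructed_entropy_solution_def]]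
  proof (elim exE conjE)
    fix v\<^sub>0 :: "nat \<Rightarrow> real \<Rightarrow> real" and v r
    assume "\<forall>n. kruzkov_solution T \<phi> (v\<^sub>0 n) (v n)"
      and "\<forall>\<zeta> \<in> Cc (strip T). (\<lambda>n. \<integral>p. \<zeta> p * v (r n) p \<partial>lebesgue_on (strip T)) \<longlonglongrightarrow> (\<integral>p. \<zeta> p \<partial>u)"
    then show thesis by (intro that[of v\<^sub>0 v r]) (erule spec | erule (1) bspec)+
  qed
  \<comment> \<open>All properties of a Borel representative are bundled in one predicate, so that a
    single choice provides a sequence having them simultaneously.\<close>
  define appr where "appr n w \<longleftrightarrow> w \<in> borel_measurable borel \<and> (\<forall>p. 0 \<le> w p) \<and> (\<exists>B. \<forall>p. w p \<le> B) \<and>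
    (AE p in lborel. p \<in> strip T \<longrightarrow> v (r n) p = w p) \<and> v (r n) \<in> borel_measurable (lebesgue_on (strip T)) \<and>
    (\<forall>k\<ge>0. subconserved T (\<lambda>p. max 0 (k - w p)) (\<lambda>p. \<phi> k - \<phi> (min (w p) k))) \<and>
    (\<forall>k\<ge>0. subconserved T (\<lambda>p. max 0 (w p - k)) (\<lambda>p. \<phi> (max (w p) k) - \<phi> k)) \<and>
    (\<forall>s. subconserved T (\<lambda>p. s * w p) (\<lambda>p. s * \<phi> (w p)))" for n w
  have "\<exists>w. appr n w" for n
  proof (rule kruzkov_borel_version[OF K[of "r n"]])
    fix w B
    assume "w \<in> borel_measurable borel" "\<And>p. 0 \<le> w p" "\<And>p. w p \<le> B" "AE p in lborel. p \<in> strip T \<longrightarrow> v (r n) p = w p"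
      "v (r n) \<in> borel_measurable (lebesgue_on (strip T))"
      "\<And>k. 0 \<le> k \<Longrightarrow> subconserved T (\<lambda>p. max 0 (k - w p)) (\<lambda>p. \<phi> k - \<phi> (min (w p) k))"
      "\<And>k. 0 \<le> k \<Longrightarrow> subconserved T (\<lambda>p. max 0 (w p - k)) (\<lambda>p. \<phi> (max (w p) k) - \<phi> k)"
      "\<And>s. subconserved T (\<lambda>p. s * w p) (\<lambda>p. s * \<phi> (w p))"
    then have "appr n w" unfolding appr_def by (intro conjI) blast+
    then show "\<exists>w. appr n w" by (rule exI[of "appr n" w])
  qed
  then obtain un where un0: "\<And>n. appr n (un n)" by metis
  have un: "un n \<in> borel_measurable borel" "0 \<le> un n p" "\<exists>B. \<forall>p. un n p \<le> B"
    "AE p in lborel. p \<in> strip T \<longrightarrow> v (r n) p = un n p" "v (r n) \<in> borel_measurable (lebesgue_on (strip T))"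
    "0 \<le> k \<Longrightarrow> subconserved T (\<lambda>p. max 0 (k - un n p)) (\<lambda>p. \<phi> k - \<phi> (min (un n p) k))"
    "0 \<le> k \<Longrightarrow> subconserved T (\<lambda>p. max 0 (un n p - k)) (\<lambda>p. \<phi> (max (un n p) k) - \<phi> k)"
    "subconserved T (\<lambda>p. s * un n p) (\<lambda>p. s * \<phi> (un n p))" for n p k s
    using un0[of n] unfolding appr_def by blast+
  have SB: "strip T \<in> sets borel" by (simp add: strip_def borel_open open_Times)
  interpret ordered_approximation \<phi> T C Bd un u "slice T u" sg
  proof unfold_locales
    show "sg * hderiv \<phi> w < sg * hderiv \<phi> v" if "0 \<le> v" "v < w" for v w
      using speed_monotone[OF sm sg ne bd gt that] .
    fix z :: "real \<times> real \<Rightarrow> real" and G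
    assume z: "continuous_on UNIV z" "compact G" "G \<subseteq> strip T" "\<forall>p. p \<notin> G \<longrightarrow> z p = 0"
    have [measurable]: "z \<in> borel_measurable borel" using z(1) by (rule borel_measurable_continuous_onI)
    have zC: "z \<in> Cc (strip T)" unfolding Cc_def using z continuous_on_subset[OF z(1)] by blast
    have "(\<integral>p. z p * v (r n) p \<partial>lebesgue_on (strip T)) = (\<integral>p. z p * un n p \<partial>lborel)" for n
    proof (rule integral_lebesgue_on_eq_lborel[OF SB])
      show "AE p in lborel. p \<in> strip T \<longrightarrow> z p * v (r n) p = z p * un n p" using un(4)[of n] by eventually_elim auto
      show "z p * un n p = 0" if "p \<notin> strip T" for p
      proof -
        have "z p = 0" using z(3,4) that by blast
        then show ?thesis by simp
      qed
      have "z \<in> borel_measurable (lebesgue_on (strip T))" by (intro measurable_restrict_space1 measurable_completion) simp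
      then show "(\<lambda>p. z p * v (r n) p) \<in> borel_measurable (lebesgue_on (strip T))" using un(5)[of n] by simp
    qed (use un(1) in simp)
    then show "(\<lambda>n. \<integral>p. z p * un n p \<partial>lborel) \<longlonglongrightarrow> (\<integral>p. z p \<partial>u)" using vc[OF zC] by simp
  qed (use T bd un uR ts sg in auto)
  have "AE t in lborel. t \<in> {0<..<T} \<longrightarrow> (\<forall>x\<^sub>0 \<in> msupport (translate (- C * t) (slice_s T u t)).
    \<exists>N\<in>null_sets lebesgue. \<forall>X. (\<forall>n. 0 < sg * (X n - x\<^sub>0) \<and> X n \<notin> N) \<and> X \<longlonglongrightarrow> x\<^sub>0 \<longrightarrow>
      (\<lambda>n. ereal (reg T u (X n + C * t, t))) \<longlonglongrightarrow> \<infinity>)"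
    using lower_bound_near_singular_support
  proof (rule eventually_mono, intro impI ballI)
    fix t x\<^sub>0 assume h: "t \<in> {0<..<T} \<longrightarrow> (\<forall>x0\<in>msupport (translate (- C * t) (sing_part lborel (slice T u t))). \<forall>k::nat.
        AE x in lborel. 0 < sg * (x - x0) \<and> sg * (x - x0) < gap k (k + 1) * t / 2 \<longrightarrow> real k \<le> reg T u (x + C * t, t))"
      and t: "t \<in> {0<..<T}" and x0: "x\<^sub>0 \<in> msupport (translate (- C * t) (slice_s T u t))"
    show "\<exists>N\<in>null_sets lebesgue. \<forall>X. (\<forall>n. 0 < sg * (X n - x\<^sub>0) \<and> X n \<notin> N) \<and> X \<longlonglongrightarrow> x\<^sub>0 \<longrightarrow>
      (\<lambda>n. ereal (reg T u (X n + C * t, t))) \<longlonglongrightarrow> \<infinity>"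
    proof (rule ess_limit_from_levels[OF sg, where d = "\<lambda>k::nat. gap (real k) (real (k + 1)) * t / 2"])
      show "0 < gap (real k) (real (k + 1)) * t / 2" for k :: nat using gap_pos[of k "real (k + 1)"] t by simp
      show "AE x in lborel. 0 < sg * (x - x\<^sub>0) \<and> sg * (x - x\<^sub>0) < gap (real k) (real (k + 1)) * t / 2 \<longrightarrow> real k \<le> reg T u (x + C * t, t)" for k :: nat
        using h t x0 unfolding slice_s_def by blast
    qed
  qed
  then show ?thesis by (simp add: AE_restrict_space_iff AE_completion_iff)
qed

theorem proposition3p7:
  fixes T C :: real and \<phi> :: "real \<Rightarrow> real"
    and u\<^sub>0 :: "real measure" and u :: "(real \<times> real) measure"
  assumes "T > 0"
    and "u\<^sub>0 \<in> Radon_pos UNIV"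
    and "smooth_halfline \<phi>" and "\<phi> 0 = 0" and "hderiv \<phi> \<in> Linf (lebesgue_on {0<..})"
    and "((\<lambda>v. \<phi> v / v) \<longlongrightarrow> C) at_top"
    and "\<exists>H K. H \<ge> -1 \<and> (\<forall>v\<ge>0.
           hderiv (hderiv \<phi>) v * (H * (\<phi> v - C * v) + K) \<le> - (hderiv \<phi> v - C)\<^sup>2 \<and>
           - (hderiv \<phi> v - C)\<^sup>2 < 0)"
    and "bounded ((\<lambda>v. \<phi> v - C * v) ` {0<..})"
    and "constructed_entropy_solution T \<phi> C u\<^sub>0 u"
  shows "AE t in lebesgue_on {0<..<T}. \<forall>x\<^sub>0 \<in> msupport (translate (- C * t) (slice_s T u t)).
           ((\<forall>v\<ge>0. hderiv \<phi> v > C) \<longrightarrow> ess_lim_right (\<lambda>x. reg T u (x + C * t, t)) x\<^sub>0 \<infinity>) \<and>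
           ((\<forall>v\<ge>0. hderiv \<phi> v < C) \<longrightarrow> ess_lim_left (\<lambda>x. reg T u (x + C * t, t)) x\<^sub>0 \<infinity>)"
proof -
  obtain Bd where Bd: "\<And>w. 0 < w \<Longrightarrow> \<bar>\<phi> w - C * w\<bar> \<le> Bd"
    using assms(8) by (auto simp: bounded_iff)
  \<comment> \<open>The point 0 is added to the assumed bound through \<phi>(0) = 0; the absolute
    value makes the bound visibly nonnegative.\<close>
  have bd: "\<bar>\<phi> w - C * w\<bar> \<le> \<bar>Bd\<bar>" if "0 \<le> w" for w
    using Bd[of w] that assms(4) by (cases "w = 0") auto
  \<comment> \<open>The structural condition makes a product with \<phi>'' strictly negative, so
    \<phi>'' has no zero.\<close>
  have ne: "hderiv (hderiv \<phi>) w \<noteq> 0" if "0 \<le> w" for w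
    using assms(7) that by fastforce
  note main = one_sided_blowup[OF assms(1,3) _ ne bd _ assms(9)]
  consider "\<forall>v\<ge>0. hderiv \<phi> v > C" | "\<forall>v\<ge>0. hderiv \<phi> v < C" | "\<not> (\<forall>v\<ge>0. hderiv \<phi> v > C)" "\<not> (\<forall>v\<ge>0. hderiv \<phi> v < C)"
    by blast
  then show ?thesis
  proof cases
    case 1
    then have "\<not> (\<forall>v\<ge>0. hderiv \<phi> v < C)" by (meson less_asym order_refl)
    with main[of 1] 1 show ?thesis unfolding ess_lim_right_def by (auto elim!: eventually_mono)
  next
    case 2
    then have n: "\<not> (\<forall>v\<ge>0. hderiv \<phi> v > C)" by (meson less_asym order_refl)
    with main[of "- 1"] 2 show ?thesis unfolding ess_lim_left_def by (auto elim!: eventually_mono)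
  next
    case 3
    then show ?thesis by (intro AE_I2) blast
  qed
qed

end
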